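(* Let $q\ge2$ be a power of two, let $$SD=\langle g,h\mid g^{4q}=1,\ h^2=1,\ hgh^{-1}=g^{2q-1}\rangle$$ be the semidihedral group of order $8q$, and let $k$ be a field of characteristic two. In the group algebra $k\,SD$ set $$X=1+h,\qquad Y=(1+h)\left(\sum_{i=0}^{\frac q2-1}g^{4i+1}+\sum_{i=\frac q2+1}^{q}g^{4i-1}\right)+g^{2q}+hg^{4q-1}.$$ With this choice of $X$ and $Y$, the group algebra has the presentation $$k\,SD=k\langle X,Y\mid X^2=0,\ Y^2=X(YX)^{2q-1}+(YX)^{2q}\rangle.$$
   Context: $k\langle X,Y\mid\cdots\rangle$ denotes the free associative unital $k$-algebra on $X,Y$ modulo the two-sided ideal generated by the given relations. *)

theory Defs
  imports "HOL-Algebra.Coset" "HOL-Algebra.QuotRing" "HOL-Algebra.Module"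
begin

section \<open>Groups given by generators and relators\<close>

text \<open>
  A word over the generators and their formal inverses is a list of pairs: the letter
  \<open>(x, True)\<close> stands for \<open>x\<close> and \<open>(x, False)\<close> for the inverse of \<open>x\<close>.
  The free group consists of the words modulo insertion and deletion of adjacent inverse letters.
\<close>

type_synonym 'x group_word = "('x \<times> bool) list"

inductive cancel_step :: "'x group_word \<Rightarrow> 'x group_word \<Rightarrow> bool" where
  "cancel_step (u @ [(x, b), (x, \<not> b)] @ v) (u @ v)"

definition word_rel :: "('x group_word \<times> 'x group_word) set" where
  "word_rel = {(u, v). equivclp cancel_step u v}"

definition free_group :: "'x group_word set monoid" where
  "free_group =
    \<lparr>carrier = UNIV // word_rel,
     mult = (\<lambda>A B. \<Union>a\<in>A. \<Union>b\<in>B. word_rel `` {a @ b}),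
     one = word_rel `` {[]}\<rparr>"

definition fg_gen :: "'x \<Rightarrow> 'x group_word set" where
  "fg_gen x = word_rel `` {[(x, True)]}"

definition normal_closure :: "('g, 'c) monoid_scheme \<Rightarrow> 'g set \<Rightarrow> 'g set" where
  "normal_closure G R = \<Inter>{N. N \<lhd> G \<and> R \<subseteq> N}"

definition presented_group :: "'x group_word set set \<Rightarrow> 'x group_word set set monoid" where
  "presented_group R = free_group Mod normal_closure free_group R"

definition pg_gen :: "'x group_word set set \<Rightarrow> 'x \<Rightarrow> 'x group_word set set" where
  "pg_gen R x = normal_closure free_group R #>\<^bsub>free_group\<^esub> fg_gen x"


section \<open>Monoid algebras, group algebras and free algebras\<close>

text \<open>
  A formal linear combination \<open>\<Sum>m. f m \<cdot> m\<close> of elements of \<open>M\<close> is represented by its coefficient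
  function \<open>f\<close>, which has finite support inside the carrier of \<open>M\<close>; the values of \<open>f\<close> off the
  carrier are \<open>\<zero>\<close>, so that equality of elements is equality of functions.
  For a group \<open>M\<close> this is the group algebra.
\<close>

definition supp_on :: "('a, 'c) ring_scheme \<Rightarrow> ('m \<Rightarrow> 'a) \<Rightarrow> 'm set" where
  "supp_on k f = {m. f m \<noteq> \<zero>\<^bsub>k\<^esub>}"

definition monoid_algebra ::
    "('a, 'c) ring_scheme \<Rightarrow> ('m, 'd) monoid_scheme \<Rightarrow> ('a, 'm \<Rightarrow> 'a) module" where
  "monoid_algebra k M =
    \<lparr>carrier = {f. range f \<subseteq> carrier k \<and> finite (supp_on k f) \<and> supp_on k f \<subseteq> carrier M},
     mult = (\<lambda>f g m. \<Oplus>\<^bsub>k\<^esub>p\<in>{p \<in> supp_on k f \<times> supp_on k g. fst p \<otimes>\<^bsub>M\<^esub> snd p = m}.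
               f (fst p) \<otimes>\<^bsub>k\<^esub> g (snd p)),
     one = (\<lambda>m. if m = \<one>\<^bsub>M\<^esub> then \<one>\<^bsub>k\<^esub> else \<zero>\<^bsub>k\<^esub>),
     zero = (\<lambda>m. \<zero>\<^bsub>k\<^esub>),
     add = (\<lambda>f g m. f m \<oplus>\<^bsub>k\<^esub> g m),
     smult = (\<lambda>c f m. c \<otimes>\<^bsub>k\<^esub> f m)\<rparr>"

definition basis_elt :: "('a, 'c) ring_scheme \<Rightarrow> 'm \<Rightarrow> 'm \<Rightarrow> 'a" where
  "basis_elt k m = (\<lambda>x. if x = m then \<one>\<^bsub>k\<^esub> else \<zero>\<^bsub>k\<^esub>)"

definition free_monoid :: "'x list monoid" where
  "free_monoid = \<lparr>carrier = UNIV, mult = (@), one = []\<rparr>"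

definition free_algebra :: "('a, 'c) ring_scheme \<Rightarrow> ('a, 'x list \<Rightarrow> 'a) module" where
  "free_algebra k = monoid_algebra k free_monoid"

definition fa_gen :: "('a, 'c) ring_scheme \<Rightarrow> 'x \<Rightarrow> 'x list \<Rightarrow> 'a" where
  "fa_gen k x = basis_elt k [x]"


section \<open>Algebras given by generators and relations\<close>

definition quotient_algebra ::
    "('a, 'b, 'c) module_scheme \<Rightarrow> 'b set \<Rightarrow> ('a, 'b set) module" where
  "quotient_algebra A I =
    \<lparr>carrier = carrier (A Quot I),
     mult = mult (A Quot I), one = one (A Quot I),
     zero = zero (A Quot I), add = add (A Quot I),
     smult = (\<lambda>c C. \<Union>a\<in>C. I +>\<^bsub>A\<^esub> (c \<odot>\<^bsub>A\<^esub> a))\<rparr>"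

definition presented_algebra ::
    "('a, 'c) ring_scheme \<Rightarrow> ('x list \<Rightarrow> 'a) set \<Rightarrow> ('a, ('x list \<Rightarrow> 'a) set) module" where
  "presented_algebra k R = quotient_algebra (free_algebra k) (Idl\<^bsub>free_algebra k\<^esub> R)"

definition pa_gen ::
    "('a, 'c) ring_scheme \<Rightarrow> ('x list \<Rightarrow> 'a) set \<Rightarrow> 'x \<Rightarrow> ('x list \<Rightarrow> 'a) set" where
  "pa_gen k R x = Idl\<^bsub>free_algebra k\<^esub> R +>\<^bsub>free_algebra k\<^esub> fa_gen k x"

text \<open>Isomorphisms of unital algebras over \<open>k\<close>, i.e. linear ring isomorphisms. The library locale
  \<open>algebra\<close> is not used because it requires the algebra to be commutative.\<close>

definition algebra_iso ::
    "('a, 'c) ring_scheme \<Rightarrow> ('a, 'b, 'd) module_scheme \<Rightarrow> ('a, 'e, 'f) module_scheme \<Rightarrow> ('b \<Rightarrow> 'e) set"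
  where
  "algebra_iso k A B =
    {\<phi> \<in> ring_iso A B. \<forall>c\<in>carrier k. \<forall>a\<in>carrier A. \<phi> (c \<odot>\<^bsub>A\<^esub> a) = c \<odot>\<^bsub>B\<^esub> \<phi> a}"

definition ring_characteristic :: "('a, 'c) ring_scheme \<Rightarrow> nat" where
  "ring_characteristic k =
    (if \<exists>n>0. [(n::nat)] \<cdot>\<^bsub>k\<^esub> \<one>\<^bsub>k\<^esub> = \<zero>\<^bsub>k\<^esub>
     then LEAST n. n > 0 \<and> [(n::nat)] \<cdot>\<^bsub>k\<^esub> \<one>\<^bsub>k\<^esub> = \<zero>\<^bsub>k\<^esub> else 0)"


section \<open>The semidihedral group and its group algebra\<close>

datatype sd_gen = Gen_g | Gen_h

text \<open>A relation \<open>l = r\<close> between group elements is encoded by the relator \<open>l r\<^sup>-\<^sup>1\<close>.\<close>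

definition sd_relators :: "nat \<Rightarrow> sd_gen group_word set set" where
  "sd_relators q =
    (let F = free_group; g = fg_gen Gen_g; h = fg_gen Gen_h in
      {g [^]\<^bsub>F\<^esub> (4 * q),
       h [^]\<^bsub>F\<^esub> (2::nat),
       (h \<otimes>\<^bsub>F\<^esub> g \<otimes>\<^bsub>F\<^esub> inv\<^bsub>F\<^esub> h) \<otimes>\<^bsub>F\<^esub> inv\<^bsub>F\<^esub> (g [^]\<^bsub>F\<^esub> (2 * q - 1))})"

definition SD :: "nat \<Rightarrow> sd_gen group_word set set monoid" where
  "SD q = presented_group (sd_relators q)"

definition SD_g :: "nat \<Rightarrow> sd_gen group_word set set" where
  "SD_g q = pg_gen (sd_relators q) Gen_g"

definition SD_h :: "nat \<Rightarrow> sd_gen group_word set set" where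
  "SD_h q = pg_gen (sd_relators q) Gen_h"

definition kSD ::
    "('a, 'c) ring_scheme \<Rightarrow> nat \<Rightarrow> ('a, sd_gen group_word set set \<Rightarrow> 'a) module" where
  "kSD k q = monoid_algebra k (SD q)"

definition SD_X :: "('a, 'c) ring_scheme \<Rightarrow> nat \<Rightarrow> sd_gen group_word set set \<Rightarrow> 'a" where
  "SD_X k q = \<one>\<^bsub>kSD k q\<^esub> \<oplus>\<^bsub>kSD k q\<^esub> basis_elt k (SD_h q)"

definition SD_Y :: "('a, 'c) ring_scheme \<Rightarrow> nat \<Rightarrow> sd_gen group_word set set \<Rightarrow> 'a" where
  "SD_Y k q =
    (let A = kSD k q; G = SD q; g = SD_g q; h = SD_h q in
      (\<one>\<^bsub>A\<^esub> \<oplus>\<^bsub>A\<^esub> basis_elt k h) \<otimes>\<^bsub>A\<^esub>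
        ((\<Oplus>\<^bsub>A\<^esub>i\<in>{0..q div 2 - 1}. basis_elt k (g [^]\<^bsub>G\<^esub> (4 * i + 1))) \<oplus>\<^bsub>A\<^esub>
         (\<Oplus>\<^bsub>A\<^esub>i\<in>{q div 2 + 1..q}. basis_elt k (g [^]\<^bsub>G\<^esub> (4 * i - 1))))
      \<oplus>\<^bsub>A\<^esub> basis_elt k (g [^]\<^bsub>G\<^esub> (2 * q))
      \<oplus>\<^bsub>A\<^esub> basis_elt k (h \<otimes>\<^bsub>G\<^esub> g [^]\<^bsub>G\<^esub> (4 * q - 1)))"

datatype xy_gen = Gen_X | Gen_Y

text \<open>A relation \<open>l = r\<close> in an algebra is encoded by the element \<open>l - r\<close>.\<close>

definition xy_relations :: "('a, 'c) ring_scheme \<Rightarrow> nat \<Rightarrow> (xy_gen list \<Rightarrow> 'a) set" where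
  "xy_relations k q =
    (let F = free_algebra k; X = fa_gen k Gen_X; Y = fa_gen k Gen_Y in
      {X [^]\<^bsub>F\<^esub> (2::nat),
       Y [^]\<^bsub>F\<^esub> (2::nat) \<ominus>\<^bsub>F\<^esub>
         (X \<otimes>\<^bsub>F\<^esub> (Y \<otimes>\<^bsub>F\<^esub> X) [^]\<^bsub>F\<^esub> (2 * q - 1) \<oplus>\<^bsub>F\<^esub> (Y \<otimes>\<^bsub>F\<^esub> X) [^]\<^bsub>F\<^esub> (2 * q))})"

end

theory Submission
  imports "HOL-Library.Z2" "HOL-Computational_Algebra.Polynomial" "HOL-Number_Theory.Cong"
    "HOL-Algebra.Bij" Defs
begin

text \<open>
  In any algebra with \<open>x\<^sup>2 = 0\<close> and \<open>y\<^sup>2 = x(yx)\<^bsup>2q-1\<^esup> + (yx)\<^bsup>2q\<^esup>\<close>, comparing \<open>y\<^sup>2 y\<close> with \<open>y y\<^sup>2\<close> yields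
  \<open>(xy)\<^bsup>2q\<^esup> = (yx)\<^bsup>2q\<^esup>\<close> and the vanishing of all longer alternating words, so that the alternating words
  of length at most \<open>4q\<close> span the presented algebra. Left multiplication by a suitable word moves
  the lowest coefficient of any nonzero element to the socle word \<open>(yx)\<^bsup>2q\<^esup>\<close>; hence a homomorphism
  that does not kill \<open>(yx)\<^bsup>2q\<^esup>\<close> is injective.

  In \<open>k SD\<close> write \<open>\<sigma>\<close> for conjugation by \<open>h\<close> on the group algebra of \<open>\<langle>g\<rangle>\<close>. Then
  \<open>X r X = (r + \<sigma>(r)) X\<close> and \<open>Y X = v X\<close> with \<open>v\<close> in the group algebra of \<open>\<langle>g\<rangle>\<close>, so
  \<open>(Y X)\<^bsup>n+1\<^esup> = v t\<^sup>n X\<close> and \<open>X (Y X)\<^sup>n = t\<^sup>n X\<close> with \<open>t = v + \<sigma>(v)\<close>. The relations thus become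
  congruences modulo \<open>u\<^bsup>4q\<^esup>\<close> in \<open>GF(2)[u]\<close>, where \<open>u = 1 + g\<close>, and \<open>(Y X)\<^bsup>2q\<^esup> = u\<^bsup>4q-1\<^esup> X\<close> is the sum
  of all group elements, which is not zero. Surjectivity holds because \<open>hY + X\<close> agrees with \<open>u\<close>
  modulo the square of the nilpotent ideal generated by \<open>u\<close>.
\<close>

section \<open>Monoid algebras\<close>

text \<open>The coefficients of \<open>X\<close> and \<open>Y\<close> lie in the prime field, so all
  computations with them take place in the image of GF(2)[u], whatever the field k is. That q is a
  power of two enters through Frobenius: \<open>1 + g^(2q) = u^(2q)\<close>, and the sum of the
  \<open>g^(4i)\<close> with i < q/2 is \<open>u^(2q-4)\<close>, which turns the two long sums of
  \<open>Y\<close> into one product.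

  No dimensions are compared and the order of SD is never computed. Injectivity asks for one nonzero
  element, whose coefficient at 1 is read off once no \<open>g^i\<close> with 0 < i < 4q and no
  \<open>g^i h\<close> is the identity; this is visible in the action of SD on Z/4q by n -> n + 1
  and n -> (2q-1)n.

  Behind the comparison of the two forms of \<open>y^3\<close> is \<open>y^2 x = 0\<close>: both
  terms of \<open>y^2\<close>, times x, end in \<open>x^2\<close>. Hence \<open>y V = 0\<close> for
  \<open>V = (yx)^(2q)\<close>, and the two forms give \<open>(xy)^(2q) + V y = V\<close>. The
  obstacle is the term \<open>V y\<close>, which disappears only after \<open>x V = 0\<close> is
  known.\<close>

locale unital_algebra = module k A + A?: ring A for k (structure) and A (structure) +
  assumes smult_mult_left:
      "\<lbrakk>c \<in> carrier k; x \<in> carrier A; y \<in> carrier A\<rbrakk> \<Longrightarrow>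
        (c \<odot>\<^bsub>A\<^esub> x) \<otimes>\<^bsub>A\<^esub> y = c \<odot>\<^bsub>A\<^esub> (x \<otimes>\<^bsub>A\<^esub> y)"
    and smult_mult_right:
      "\<lbrakk>c \<in> carrier k; x \<in> carrier A; y \<in> carrier A\<rbrakk> \<Longrightarrow>
        x \<otimes>\<^bsub>A\<^esub> (c \<odot>\<^bsub>A\<^esub> y) = c \<odot>\<^bsub>A\<^esub> (x \<otimes>\<^bsub>A\<^esub> y)"

lemma (in unital_algebra) one_add_one:
  assumes "\<one>\<^bsub>k\<^esub> \<oplus>\<^bsub>k\<^esub> \<one>\<^bsub>k\<^esub> = \<zero>\<^bsub>k\<^esub>"
  shows "\<one>\<^bsub>A\<^esub> \<oplus>\<^bsub>A\<^esub> \<one>\<^bsub>A\<^esub> = \<zero>\<^bsub>A\<^esub>"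
  using assms smult_l_distr[of "\<one>\<^bsub>k\<^esub>" "\<one>\<^bsub>k\<^esub>" "\<one>\<^bsub>A\<^esub>"] by simp

section \<open>Monoid algebras by coefficient functions\<close>

locale monoid_alg = k?: cring k + M: monoid M
  for k (structure) and M (structure)
begin

abbreviation kM where "kM \<equiv> monoid_algebra k M"

lemma monoid_algebra_carrier:
  "f \<in> carrier kM \<longleftrightarrow> (\<forall>m. f m \<in> carrier k) \<and> finite (supp_on k f) \<and> supp_on k f \<subseteq> carrier M"
  by (auto simp: monoid_algebra_def)

lemma monoid_algebra_simps:
  "one kM = basis_elt k \<one>\<^bsub>M\<^esub>" "zero kM = (\<lambda>m. \<zero>)"
  "f \<oplus>\<^bsub>kM\<^esub> g = (\<lambda>m. f m \<oplus> g m)" "c \<odot>\<^bsub>kM\<^esub> f = (\<lambda>m. c \<otimes> f m)"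
  by (simp_all add: monoid_algebra_def basis_elt_def)

lemma add_apply: "(f \<oplus>\<^bsub>kM\<^esub> g) m = f m \<oplus> g m"
  and smult_apply: "(c \<odot>\<^bsub>kM\<^esub> f) m = c \<otimes> f m"
  by (simp_all add: monoid_algebra_simps)

lemma coeff_closed: "f \<in> carrier kM \<Longrightarrow> f m \<in> carrier k"
  by (simp add: monoid_algebra_carrier)

lemma monoid_algebra_carrierI:
  assumes "\<And>m. f m \<in> carrier k" "finite S" "S \<subseteq> carrier M" "\<And>m. m \<notin> S \<Longrightarrow> f m = \<zero>"
  shows "f \<in> carrier kM"
proof -
  have "supp_on k f \<subseteq> S" using assms(4) by (auto simp: supp_on_def)
  then show ?thesis using assms finite_subset[of "supp_on k f" S]
    by (simp add: monoid_algebra_carrier)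
qed

lemma add_closed:
  assumes f: "f \<in> carrier kM" and g: "g \<in> carrier kM"
  shows "f \<oplus>\<^bsub>kM\<^esub> g \<in> carrier kM"
proof (rule monoid_algebra_carrierI)
  show "finite (supp_on k f \<union> supp_on k g)" "supp_on k f \<union> supp_on k g \<subseteq> carrier M"
    using f g by (simp_all add: monoid_algebra_carrier)
  show "(f \<oplus>\<^bsub>kM\<^esub> g) m \<in> carrier k" for m using f g by (simp add: coeff_closed add_apply)
  show "m \<notin> supp_on k f \<union> supp_on k g \<Longrightarrow> (f \<oplus>\<^bsub>kM\<^esub> g) m = \<zero>" for m
    by (simp add: add_apply supp_on_def)
qed

lemma smult_closed:
  assumes c: "c \<in> carrier k" and f: "f \<in> carrier kM"
  shows "c \<odot>\<^bsub>kM\<^esub> f \<in> carrier kM"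
proof (rule monoid_algebra_carrierI)
  show "finite (supp_on k f)" "supp_on k f \<subseteq> carrier M"
    using f by (simp_all add: monoid_algebra_carrier)
  show "(c \<odot>\<^bsub>kM\<^esub> f) m \<in> carrier k" for m using c f by (simp add: coeff_closed smult_apply)
  show "m \<notin> supp_on k f \<Longrightarrow> (c \<odot>\<^bsub>kM\<^esub> f) m = \<zero>" for m
    using c by (simp add: smult_apply supp_on_def)
qed

lemma basis_elt_closed [simp]: "m \<in> carrier M \<Longrightarrow> basis_elt k m \<in> carrier kM"
  by (rule monoid_algebra_carrierI[where S = "{m}"]) (auto simp: basis_elt_def)

lemma abelian_group_monoid_algebra: "abelian_group kM"
proof (rule abelian_groupI)
  show "\<zero>\<^bsub>kM\<^esub> \<in> carrier kM"
    by (rule monoid_algebra_carrierI[where S = "{}"]) (auto simp: monoid_algebra_simps)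
  fix f assume f: "f \<in> carrier kM"
  show "\<exists>g\<in>carrier kM. g \<oplus>\<^bsub>kM\<^esub> f = \<zero>\<^bsub>kM\<^esub>"
  proof
    show "(\<lambda>m. \<ominus> f m) \<oplus>\<^bsub>kM\<^esub> f = \<zero>\<^bsub>kM\<^esub>"
      using f by (simp add: monoid_algebra_simps coeff_closed l_neg)
    show "(\<lambda>m. \<ominus> f m) \<in> carrier kM"
      using f by (intro monoid_algebra_carrierI[where S = "supp_on k f"])
        (simp_all add: coeff_closed, simp_all add: monoid_algebra_carrier supp_on_def)
  qed
  show "\<zero>\<^bsub>kM\<^esub> \<oplus>\<^bsub>kM\<^esub> f = f" using f by (simp add: coeff_closed monoid_algebra_simps)
  fix g assume g: "g \<in> carrier kM"
  show "f \<oplus>\<^bsub>kM\<^esub> g \<in> carrier kM" using f g by (rule add_closed)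
  show "f \<oplus>\<^bsub>kM\<^esub> g = g \<oplus>\<^bsub>kM\<^esub> f" using f g by (simp add: coeff_closed monoid_algebra_simps a_comm)
  fix h assume "h \<in> carrier kM"
  with f g show "f \<oplus>\<^bsub>kM\<^esub> g \<oplus>\<^bsub>kM\<^esub> h = f \<oplus>\<^bsub>kM\<^esub> (g \<oplus>\<^bsub>kM\<^esub> h)"
    by (simp add: coeff_closed monoid_algebra_simps a_assoc)
qed

text \<open>Moving the condition on the product from the index set into the summand lets both
  factors range over any finite sets containing their supports. Products of different elements can
  then be compared over one index set.\<close>

lemma mult_eq:
  assumes f: "f \<in> carrier kM" and g: "g \<in> carrier kM"
    and "finite S" "supp_on k f \<subseteq> S" "finite T" "supp_on k g \<subseteq> T"
  shows "(f \<otimes>\<^bsub>kM\<^esub> g) m =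
    (\<Oplus>p\<in>S \<times> T. if fst p \<otimes>\<^bsub>M\<^esub> snd p = m then f (fst p) \<otimes> g (snd p) else \<zero>)"
proof -
  have "(f \<otimes>\<^bsub>kM\<^esub> g) m = (\<Oplus>p\<in>{p \<in> supp_on k f \<times> supp_on k g. fst p \<otimes>\<^bsub>M\<^esub> snd p = m}.
               f (fst p) \<otimes> g (snd p))"
    by (simp add: monoid_algebra_def)
  also have "\<dots> = (\<Oplus>p\<in>S \<times> T. if fst p \<otimes>\<^bsub>M\<^esub> snd p = m then f (fst p) \<otimes> g (snd p) else \<zero>)"
    using assms
    by (intro add.finprod_mono_neutral_cong_left) (auto simp: coeff_closed supp_on_def)
  finally show ?thesis .
qed

lemma mult_closed:
  assumes f: "f \<in> carrier kM" and g: "g \<in> carrier kM"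
  shows "f \<otimes>\<^bsub>kM\<^esub> g \<in> carrier kM"
proof (rule monoid_algebra_carrierI)
  let ?S = "supp_on k f" let ?T = "supp_on k g"
  have ST: "finite ?S" "finite ?T" "?S \<subseteq> carrier M" "?T \<subseteq> carrier M"
    using f g by (auto simp: monoid_algebra_carrier)
  have eq: "(f \<otimes>\<^bsub>kM\<^esub> g) m =
    (\<Oplus>p\<in>?S \<times> ?T. if fst p \<otimes>\<^bsub>M\<^esub> snd p = m then f (fst p) \<otimes> g (snd p) else \<zero>)" for m
    by (rule mult_eq) (use f g ST in auto)
  show "(f \<otimes>\<^bsub>kM\<^esub> g) m \<in> carrier k" for m
    unfolding eq using f g by (intro finsum_closed) (auto simp: coeff_closed)
  let ?I = "(\<lambda>p. fst p \<otimes>\<^bsub>M\<^esub> snd p) ` (?S \<times> ?T)"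
  show "finite ?I" using ST by auto
  show "?I \<subseteq> carrier M" using ST by (auto intro!: M.m_closed)
  fix m assume "m \<notin> ?I"
  then have "(\<Oplus>p\<in>?S \<times> ?T. if fst p \<otimes>\<^bsub>M\<^esub> snd p = m then f (fst p) \<otimes> g (snd p) else \<zero>)
      = (\<Oplus>p\<in>?S \<times> ?T. \<zero>)"
    using f g by (intro finsum_cong') (auto simp: coeff_closed)
  then show "(f \<otimes>\<^bsub>kM\<^esub> g) m = \<zero>" by (simp add: eq)
qed

lemma mult_add_left:
  assumes f: "f \<in> carrier kM" and g: "g \<in> carrier kM" and h: "h \<in> carrier kM"
  shows "(f \<oplus>\<^bsub>kM\<^esub> g) \<otimes>\<^bsub>kM\<^esub> h = f \<otimes>\<^bsub>kM\<^esub> h \<oplus>\<^bsub>kM\<^esub> g \<otimes>\<^bsub>kM\<^esub> h"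
proof
  fix m
  let ?S = "supp_on k f \<union> supp_on k g" let ?T = "supp_on k h"
  have fin: "finite ?S" "finite ?T" using assms by (auto simp: monoid_algebra_carrier)
  have sub: "supp_on k (f \<oplus>\<^bsub>kM\<^esub> g) \<subseteq> ?S" using assms by (auto simp: supp_on_def monoid_algebra_simps)
  have "((f \<oplus>\<^bsub>kM\<^esub> g) \<otimes>\<^bsub>kM\<^esub> h) m = (\<Oplus>p\<in>?S \<times> ?T.
      (if fst p \<otimes>\<^bsub>M\<^esub> snd p = m then f (fst p) \<otimes> h (snd p) else \<zero>) \<oplus>
      (if fst p \<otimes>\<^bsub>M\<^esub> snd p = m then g (fst p) \<otimes> h (snd p) else \<zero>))"
    unfolding mult_eq[OF add_closed[OF f g] h fin(1) sub fin(2) order_refl]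
    using f g h by (intro finsum_cong') (auto simp: coeff_closed add_apply l_distr)
  also have "\<dots> = (f \<otimes>\<^bsub>kM\<^esub> h \<oplus>\<^bsub>kM\<^esub> g \<otimes>\<^bsub>kM\<^esub> h) m"
    using f g h by (simp add: coeff_closed finsum_addf Pi_def add_apply mult_eq[OF _ _ fin(1) _ fin(2)])
  finally show "((f \<oplus>\<^bsub>kM\<^esub> g) \<otimes>\<^bsub>kM\<^esub> h) m = (f \<otimes>\<^bsub>kM\<^esub> h \<oplus>\<^bsub>kM\<^esub> g \<otimes>\<^bsub>kM\<^esub> h) m" .
qed

lemma mult_add_right:
  assumes f: "f \<in> carrier kM" and g: "g \<in> carrier kM" and h: "h \<in> carrier kM"
  shows "h \<otimes>\<^bsub>kM\<^esub> (f \<oplus>\<^bsub>kM\<^esub> g) = h \<otimes>\<^bsub>kM\<^esub> f \<oplus>\<^bsub>kM\<^esub> h \<otimes>\<^bsub>kM\<^esub> g"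
proof
  fix m
  let ?S = "supp_on k f \<union> supp_on k g" let ?T = "supp_on k h"
  have fin: "finite ?S" "finite ?T" using assms by (auto simp: monoid_algebra_carrier)
  have sub: "supp_on k (f \<oplus>\<^bsub>kM\<^esub> g) \<subseteq> ?S" using assms by (auto simp: supp_on_def monoid_algebra_simps)
  have "(h \<otimes>\<^bsub>kM\<^esub> (f \<oplus>\<^bsub>kM\<^esub> g)) m = (\<Oplus>p\<in>?T \<times> ?S.
      (if fst p \<otimes>\<^bsub>M\<^esub> snd p = m then h (fst p) \<otimes> f (snd p) else \<zero>) \<oplus>
      (if fst p \<otimes>\<^bsub>M\<^esub> snd p = m then h (fst p) \<otimes> g (snd p) else \<zero>))"
    unfolding mult_eq[OF h add_closed[OF f g] fin(2) order_refl fin(1) sub]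
    using f g h by (intro finsum_cong') (auto simp: coeff_closed add_apply r_distr)
  also have "\<dots> = (h \<otimes>\<^bsub>kM\<^esub> f \<oplus>\<^bsub>kM\<^esub> h \<otimes>\<^bsub>kM\<^esub> g) m"
    using f g h by (simp add: coeff_closed finsum_addf Pi_def add_apply mult_eq[OF _ _ fin(2) _ fin(1)])
  finally show "(h \<otimes>\<^bsub>kM\<^esub> (f \<oplus>\<^bsub>kM\<^esub> g)) m = (h \<otimes>\<^bsub>kM\<^esub> f \<oplus>\<^bsub>kM\<^esub> h \<otimes>\<^bsub>kM\<^esub> g) m" .
qed

lemma mult_smult_left:
  assumes c: "c \<in> carrier k" and f: "f \<in> carrier kM" and h: "h \<in> carrier kM"
  shows "(c \<odot>\<^bsub>kM\<^esub> f) \<otimes>\<^bsub>kM\<^esub> h = c \<odot>\<^bsub>kM\<^esub> (f \<otimes>\<^bsub>kM\<^esub> h)"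
proof
  fix m
  let ?S = "supp_on k f" let ?T = "supp_on k h"
  have fin: "finite ?S" "finite ?T" using assms by (auto simp: monoid_algebra_carrier)
  have sub: "supp_on k (c \<odot>\<^bsub>kM\<^esub> f) \<subseteq> ?S" using assms by (auto simp: supp_on_def monoid_algebra_simps)
  have "((c \<odot>\<^bsub>kM\<^esub> f) \<otimes>\<^bsub>kM\<^esub> h) m = (\<Oplus>p\<in>?S \<times> ?T.
      c \<otimes> (if fst p \<otimes>\<^bsub>M\<^esub> snd p = m then f (fst p) \<otimes> h (snd p) else \<zero>))"
    unfolding mult_eq[OF smult_closed[OF c f] h fin(1) sub fin(2) order_refl]
    using c f h by (intro finsum_cong') (auto simp: coeff_closed smult_apply m_assoc)
  also have "\<dots> = (c \<odot>\<^bsub>kM\<^esub> (f \<otimes>\<^bsub>kM\<^esub> h)) m"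
    using c f h fin by (simp add: coeff_closed finsum_rdistr Pi_def
        smult_apply mult_eq[OF _ _ fin(1) _ fin(2)])
  finally show "((c \<odot>\<^bsub>kM\<^esub> f) \<otimes>\<^bsub>kM\<^esub> h) m = (c \<odot>\<^bsub>kM\<^esub> (f \<otimes>\<^bsub>kM\<^esub> h)) m" .
qed

lemma mult_smult_right:
  assumes c: "c \<in> carrier k" and f: "f \<in> carrier kM" and h: "h \<in> carrier kM"
  shows "h \<otimes>\<^bsub>kM\<^esub> (c \<odot>\<^bsub>kM\<^esub> f) = c \<odot>\<^bsub>kM\<^esub> (h \<otimes>\<^bsub>kM\<^esub> f)"
proof
  fix m
  let ?S = "supp_on k f" let ?T = "supp_on k h"
  have fin: "finite ?S" "finite ?T" using assms by (auto simp: monoid_algebra_carrier)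
  have sub: "supp_on k (c \<odot>\<^bsub>kM\<^esub> f) \<subseteq> ?S" using assms by (auto simp: supp_on_def monoid_algebra_simps)
  have "(h \<otimes>\<^bsub>kM\<^esub> (c \<odot>\<^bsub>kM\<^esub> f)) m = (\<Oplus>p\<in>?T \<times> ?S.
      c \<otimes> (if fst p \<otimes>\<^bsub>M\<^esub> snd p = m then h (fst p) \<otimes> f (snd p) else \<zero>))"
    unfolding mult_eq[OF h smult_closed[OF c f] fin(2) order_refl fin(1) sub]
    using c f h by (intro finsum_cong') (auto simp: coeff_closed smult_apply m_lcomm)
  also have "\<dots> = (c \<odot>\<^bsub>kM\<^esub> (h \<otimes>\<^bsub>kM\<^esub> f)) m"
    using c f h fin by (simp add: coeff_closed finsum_rdistr Pi_def
        smult_apply mult_eq[OF _ _ fin(2) _ fin(1)])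
  finally show "(h \<otimes>\<^bsub>kM\<^esub> (c \<odot>\<^bsub>kM\<^esub> f)) m = (c \<odot>\<^bsub>kM\<^esub> (h \<otimes>\<^bsub>kM\<^esub> f)) m" .
qed

lemma basis_elt_mult:
  assumes "a \<in> carrier M" "b \<in> carrier M"
  shows "basis_elt k a \<otimes>\<^bsub>kM\<^esub> basis_elt k b = basis_elt k (a \<otimes>\<^bsub>M\<^esub> b)"
proof
  fix m
  have "(basis_elt k a \<otimes>\<^bsub>kM\<^esub> basis_elt k b) m = (\<Oplus>p\<in>{a} \<times> {b}.
      if fst p \<otimes>\<^bsub>M\<^esub> snd p = m then basis_elt k a (fst p) \<otimes> basis_elt k b (snd p) else \<zero>)"
    using assms by (intro mult_eq basis_elt_closed) (auto simp: supp_on_def basis_elt_def)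
  also have "\<dots> = basis_elt k (a \<otimes>\<^bsub>M\<^esub> b) m"
    by (simp add: basis_elt_def)
  finally show "(basis_elt k a \<otimes>\<^bsub>kM\<^esub> basis_elt k b) m = basis_elt k (a \<otimes>\<^bsub>M\<^esub> b) m" .
qed

text \<open>Peels off one support point at a time, so that additive and bilinear statements reduce
  to basis elements.\<close>

lemma monoid_algebra_induct [consumes 1, case_names zero add]:
  assumes f: "f \<in> carrier kM" and zero: "P \<zero>\<^bsub>kM\<^esub>"
    and add: "\<And>c m f. c \<in> carrier k \<Longrightarrow> m \<in> carrier M \<Longrightarrow> f \<in> carrier kM \<Longrightarrow> P f \<Longrightarrow>
      P (c \<odot>\<^bsub>kM\<^esub> basis_elt k m \<oplus>\<^bsub>kM\<^esub> f)"
  shows "P f"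
proof -
  have "finite S \<Longrightarrow> f \<in> carrier kM \<Longrightarrow> supp_on k f = S \<Longrightarrow> P f" for S
  proof (induction S arbitrary: f rule: finite_induct)
    case empty
    then have "f = \<zero>\<^bsub>kM\<^esub>" by (auto simp: supp_on_def monoid_algebra_simps)
    then show ?case using zero by simp
  next
    case (insert m S)
    let ?f = "f(m := \<zero>)"
    have m: "m \<in> carrier M" and S: "S \<subseteq> carrier M"
      using insert.prems by (auto simp: monoid_algebra_carrier)
    have f': "?f \<in> carrier kM"
      using insert by (intro monoid_algebra_carrierI[where S = S])
        (auto simp: S coeff_closed supp_on_def)
    have "supp_on k ?f = S" using insert.hyps insert.prems(2) by (auto simp: supp_on_def)
    with f' have "P ?f" by (rule insert.IH)
    with m f' insert.prems
    have "P (f m \<odot>\<^bsub>kM\<^esub> basis_elt k m \<oplus>\<^bsub>kM\<^esub> ?f)" by (intro add) (auto simp: coeff_closed)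
    also have "f m \<odot>\<^bsub>kM\<^esub> basis_elt k m \<oplus>\<^bsub>kM\<^esub> ?f = f"
      using insert.prems by (auto simp: coeff_closed monoid_algebra_simps basis_elt_def)
    finally show ?case .
  qed
  then show ?thesis using f by (auto simp: monoid_algebra_carrier)
qed

sublocale kM: abelian_group kM by (rule abelian_group_monoid_algebra)

lemma supp_on_zero [simp]: "supp_on k \<zero>\<^bsub>kM\<^esub> = {}"
  by (simp add: supp_on_def monoid_algebra_simps)

lemma mult_zero_left:
  assumes f: "f \<in> carrier kM"
  shows "\<zero>\<^bsub>kM\<^esub> \<otimes>\<^bsub>kM\<^esub> f = \<zero>\<^bsub>kM\<^esub>"
proof
  have "finite (supp_on k f)" using f by (simp add: monoid_algebra_carrier)
  then show "(\<zero>\<^bsub>kM\<^esub> \<otimes>\<^bsub>kM\<^esub> f) m = \<zero>\<^bsub>kM\<^esub> m" for m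
    using f by (subst mult_eq[where S = "{}" and T = "supp_on k f"])
      (simp_all, simp add: monoid_algebra_simps)
qed

lemma mult_zero_right:
  assumes f: "f \<in> carrier kM"
  shows "f \<otimes>\<^bsub>kM\<^esub> \<zero>\<^bsub>kM\<^esub> = \<zero>\<^bsub>kM\<^esub>"
proof
  have "finite (supp_on k f)" using f by (simp add: monoid_algebra_carrier)
  then show "(f \<otimes>\<^bsub>kM\<^esub> \<zero>\<^bsub>kM\<^esub>) m = \<zero>\<^bsub>kM\<^esub> m" for m
    using f by (subst mult_eq[where S = "supp_on k f" and T = "{}"])
      (simp_all, simp add: monoid_algebra_simps)
qed

lemmas closed = add_closed smult_closed mult_closed
lemmas bilinear = mult_add_left mult_add_right mult_smult_left mult_smult_right
  mult_zero_left mult_zero_right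

lemma smult_r_distr: "\<lbrakk>c \<in> carrier k; f \<in> carrier kM; g \<in> carrier kM\<rbrakk> \<Longrightarrow>
    c \<odot>\<^bsub>kM\<^esub> (f \<oplus>\<^bsub>kM\<^esub> g) = c \<odot>\<^bsub>kM\<^esub> f \<oplus>\<^bsub>kM\<^esub> c \<odot>\<^bsub>kM\<^esub> g"
  by (auto simp: coeff_closed monoid_algebra_simps r_distr)

text \<open>Associativity of \<open>M\<close> is transferred one factor at a time: the third factor
  becomes arbitrary here, then the second, then the first.\<close>

lemma mult_assoc_basis:
  assumes "a \<in> carrier M" "b \<in> carrier M" "h \<in> carrier kM"
  shows "(basis_elt k a \<otimes>\<^bsub>kM\<^esub> basis_elt k b) \<otimes>\<^bsub>kM\<^esub> h = basis_elt k a \<otimes>\<^bsub>kM\<^esub> (basis_elt k b \<otimes>\<^bsub>kM\<^esub> h)"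
  using assms(3)
proof (induction h rule: monoid_algebra_induct)
  case zero
  then show ?case using assms by (simp add: bilinear closed)
next
  case (add c m f)
  then show ?case using assms by (simp add: bilinear closed basis_elt_mult M.m_assoc)
qed

lemma mult_assoc_basis2:
  assumes "a \<in> carrier M" "g \<in> carrier kM" "h \<in> carrier kM"
  shows "(basis_elt k a \<otimes>\<^bsub>kM\<^esub> g) \<otimes>\<^bsub>kM\<^esub> h = basis_elt k a \<otimes>\<^bsub>kM\<^esub> (g \<otimes>\<^bsub>kM\<^esub> h)"
  using assms(2)
proof (induction g rule: monoid_algebra_induct)
  case zero
  then show ?case using assms by (simp add: bilinear closed)
next
  case (add c m f)
  then show ?case using assms by (simp add: bilinear closed mult_assoc_basis)
qed

lemma mult_assoc:
  assumes "f \<in> carrier kM" "g \<in> carrier kM" "h \<in> carrier kM"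
  shows "(f \<otimes>\<^bsub>kM\<^esub> g) \<otimes>\<^bsub>kM\<^esub> h = f \<otimes>\<^bsub>kM\<^esub> (g \<otimes>\<^bsub>kM\<^esub> h)"
  using assms(1)
proof (induction f rule: monoid_algebra_induct)
  case zero
  then show ?case using assms by (simp add: bilinear closed)
next
  case (add c m f)
  then show ?case using assms by (simp add: bilinear closed mult_assoc_basis2)
qed

lemma mult_one_left: "f \<in> carrier kM \<Longrightarrow> \<one>\<^bsub>kM\<^esub> \<otimes>\<^bsub>kM\<^esub> f = f"
proof (induction f rule: monoid_algebra_induct)
  case zero
  then show ?case by (simp add: bilinear closed monoid_algebra_simps(1))
next
  case (add c m f)
  then show ?case by (simp add: bilinear closed basis_elt_mult monoid_algebra_simps(1))
qed

lemma mult_one_right: "f \<in> carrier kM \<Longrightarrow> f \<otimes>\<^bsub>kM\<^esub> \<one>\<^bsub>kM\<^esub> = f"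
proof (induction f rule: monoid_algebra_induct)
  case zero
  then show ?case by (simp add: bilinear closed monoid_algebra_simps(1))
next
  case (add c m f)
  then show ?case by (simp add: bilinear closed basis_elt_mult monoid_algebra_simps(1))
qed

theorem unital_algebra_monoid_algebra: "unital_algebra k kM"
proof -
  have one: "\<one>\<^bsub>kM\<^esub> \<in> carrier kM"
    by (simp add: monoid_algebra_simps(1))
  have ring: "ring kM"
    by (intro ringI monoidI abelian_group_monoid_algebra)
      (simp_all add: bilinear closed mult_assoc mult_one_left mult_one_right one)
  have module: "module k kM"
  proof (intro moduleI abelian_group_monoid_algebra cring_axioms)
    fix c d f assume "c \<in> carrier k" "d \<in> carrier k" "f \<in> carrier kM"
    then show "(c \<oplus> d) \<odot>\<^bsub>kM\<^esub> f = c \<odot>\<^bsub>kM\<^esub> f \<oplus>\<^bsub>kM\<^esub> d \<odot>\<^bsub>kM\<^esub> f"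
      and "(c \<otimes> d) \<odot>\<^bsub>kM\<^esub> f = c \<odot>\<^bsub>kM\<^esub> (d \<odot>\<^bsub>kM\<^esub> f)"
      by (simp_all add: coeff_closed monoid_algebra_simps l_distr m_assoc)
  next
    fix f assume "f \<in> carrier kM"
    then show "\<one> \<odot>\<^bsub>kM\<^esub> f = f" by (simp add: coeff_closed monoid_algebra_simps)
  qed (simp_all add: smult_closed smult_r_distr)
  show ?thesis
    by (rule unital_algebra.intro[OF module ring], rule unital_algebra_axioms.intro)
      (simp_all add: bilinear)
qed

end

lemma (in monoid_alg) basis_elt_power:
  "m \<in> carrier M \<Longrightarrow> basis_elt k m [^]\<^bsub>kM\<^esub> (n::nat) = basis_elt k (m [^]\<^bsub>M\<^esub> n)"
  by (induction n) (simp_all add: monoid_algebra_simps(1) basis_elt_mult)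

lemma (in monoid_alg) finsum_apply:
  assumes "finite S" "\<And>i. i \<in> S \<Longrightarrow> F i \<in> carrier kM"
  shows "(\<Oplus>\<^bsub>kM\<^esub>i\<in>S. F i) m = (\<Oplus>i\<in>S. F i m)"
  using assms
proof (induction S rule: finite_induct)
  case empty
  then show ?case by (simp add: monoid_algebra_simps)
next
  case (insert j S)
  have "(\<Oplus>\<^bsub>kM\<^esub>i\<in>insert j S. F i) = F j \<oplus>\<^bsub>kM\<^esub> (\<Oplus>\<^bsub>kM\<^esub>i\<in>S. F i)"
    using insert.hyps insert.prems by (intro kM.finsum_insert) auto
  moreover have "(\<Oplus>i\<in>insert j S. F i m) = F j m \<oplus> (\<Oplus>i\<in>S. F i m)"
    using insert.hyps insert.prems coeff_closed by (intro finsum_insert) auto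
  ultimately show ?case using insert by (simp add: add_apply)
qed

section \<open>Homomorphisms, quotients and presentations of algebras\<close>

definition algebra_hom ::
    "('a, 'c) ring_scheme \<Rightarrow> ('a, 'b, 'd) module_scheme \<Rightarrow> ('a, 'e, 'f) module_scheme \<Rightarrow> ('b \<Rightarrow> 'e) set"
  where
  "algebra_hom k A B =
    {\<phi> \<in> ring_hom A B. \<forall>c\<in>carrier k. \<forall>a\<in>carrier A. \<phi> (c \<odot>\<^bsub>A\<^esub> a) = c \<odot>\<^bsub>B\<^esub> \<phi> a}"

section \<open>Linear extension of a multiplicative map on the monoid\<close>

locale monoid_alg_lift = unital_algebra k A + MA: monoid_alg k M
  for k (structure) and A (structure) and M (structure) +
  fixes \<theta>
  assumes hom_closed [simp]: "m \<in> carrier M \<Longrightarrow> \<theta> m \<in> carrier A"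
    and hom_mult: "m \<in> carrier M \<Longrightarrow> n \<in> carrier M \<Longrightarrow> \<theta> (m \<otimes>\<^bsub>M\<^esub> n) = \<theta> m \<otimes>\<^bsub>A\<^esub> \<theta> n"
    and hom_one: "\<theta> \<one>\<^bsub>M\<^esub> = \<one>\<^bsub>A\<^esub>"
begin

definition lift where
  "lift f = (\<Oplus>\<^bsub>A\<^esub>m\<in>supp_on k f. f m \<odot>\<^bsub>A\<^esub> \<theta> m)"

abbreviation kM where "kM \<equiv> monoid_algebra k M"

sublocale kM: unital_algebra k kM
  by (rule MA.unital_algebra_monoid_algebra)

text \<open>A common summation set makes additivity of \<open>lift\<close> a termwise statement,
  although the support of a sum may shrink.\<close>

lemma lift_eq:
  assumes f: "f \<in> carrier kM" and S: "finite S" "supp_on k f \<subseteq> S" "S \<subseteq> carrier M"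
  shows "lift f = (\<Oplus>\<^bsub>A\<^esub>m\<in>S. f m \<odot>\<^bsub>A\<^esub> \<theta> m)"
  unfolding lift_def
proof (rule add.finprod_mono_neutral_cong_left)
  show "f m \<odot>\<^bsub>A\<^esub> \<theta> m = \<zero>\<^bsub>A\<^esub>" if "m \<in> S - supp_on k f" for m
    using that S by (auto simp: supp_on_def)
  show "(\<lambda>m. f m \<odot>\<^bsub>A\<^esub> \<theta> m) \<in> S \<rightarrow> carrier A"
    using S by (auto simp: MA.coeff_closed[OF f])
qed (use S in auto)

lemma lift_closed:
  assumes f: "f \<in> carrier kM"
  shows "lift f \<in> carrier A"
proof -
  have "supp_on k f \<subseteq> carrier M" using f by (simp add: MA.monoid_algebra_carrier)
  then show ?thesis
    unfolding lift_def by (intro finsum_closed) (auto simp: MA.coeff_closed[OF f])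
qed

lemma lift_zero: "lift \<zero>\<^bsub>kM\<^esub> = \<zero>\<^bsub>A\<^esub>"
  unfolding lift_def by simp

lemma lift_add:
  assumes f: "f \<in> carrier kM" and g: "g \<in> carrier kM"
  shows "lift (f \<oplus>\<^bsub>kM\<^esub> g) = lift f \<oplus>\<^bsub>A\<^esub> lift g"
proof -
  let ?S = "supp_on k f \<union> supp_on k g"
  have S: "finite ?S" "?S \<subseteq> carrier M" using f g by (simp_all add: MA.monoid_algebra_carrier)
  have "supp_on k (f \<oplus>\<^bsub>kM\<^esub> g) \<subseteq> ?S" by (auto simp: supp_on_def MA.add_apply)
  then have "lift (f \<oplus>\<^bsub>kM\<^esub> g) = (\<Oplus>\<^bsub>A\<^esub>m\<in>?S. (f m \<oplus> g m) \<odot>\<^bsub>A\<^esub> \<theta> m)"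
    using f g S by (simp add: lift_eq[of _ ?S] MA.add_apply)
  also have "\<dots> = (\<Oplus>\<^bsub>A\<^esub>m\<in>?S. f m \<odot>\<^bsub>A\<^esub> \<theta> m \<oplus>\<^bsub>A\<^esub> g m \<odot>\<^bsub>A\<^esub> \<theta> m)"
    using S(2) by (intro finsum_cong')
      (auto simp: MA.coeff_closed[OF f] MA.coeff_closed[OF g] smult_l_distr)
  also have "\<dots> = (\<Oplus>\<^bsub>A\<^esub>m\<in>?S. f m \<odot>\<^bsub>A\<^esub> \<theta> m) \<oplus>\<^bsub>A\<^esub> (\<Oplus>\<^bsub>A\<^esub>m\<in>?S. g m \<odot>\<^bsub>A\<^esub> \<theta> m)"
    using S by (intro finsum_addf) (auto simp: MA.coeff_closed[OF f] MA.coeff_closed[OF g])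
  also have "\<dots> = lift f \<oplus>\<^bsub>A\<^esub> lift g"
    using f g S by (simp add: lift_eq[of _ ?S])
  finally show ?thesis .
qed

lemma finsum_smult:
  assumes "finite S" "c \<in> carrier k" "\<And>m. m \<in> S \<Longrightarrow> x m \<in> carrier A"
  shows "(\<Oplus>\<^bsub>A\<^esub>m\<in>S. c \<odot>\<^bsub>A\<^esub> x m) = c \<odot>\<^bsub>A\<^esub> (\<Oplus>\<^bsub>A\<^esub>m\<in>S. x m)"
  using assms by (induction S rule: finite_induct) (auto simp: smult_r_distr Pi_def)

lemma lift_smult:
  assumes c: "c \<in> carrier k" and f: "f \<in> carrier kM"
  shows "lift (c \<odot>\<^bsub>kM\<^esub> f) = c \<odot>\<^bsub>A\<^esub> lift f"
proof -
  let ?S = "supp_on k f"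
  have S: "finite ?S" "?S \<subseteq> carrier M" using f by (simp_all add: MA.monoid_algebra_carrier)
  have "supp_on k (c \<odot>\<^bsub>kM\<^esub> f) \<subseteq> ?S" using c by (auto simp: supp_on_def MA.smult_apply)
  then have "lift (c \<odot>\<^bsub>kM\<^esub> f) = (\<Oplus>\<^bsub>A\<^esub>m\<in>?S. (c \<otimes> f m) \<odot>\<^bsub>A\<^esub> \<theta> m)"
    using c f S by (simp add: lift_eq[of _ ?S] MA.smult_apply)
  also have "\<dots> = (\<Oplus>\<^bsub>A\<^esub>m\<in>?S. c \<odot>\<^bsub>A\<^esub> (f m \<odot>\<^bsub>A\<^esub> \<theta> m))"
    using S(2) c by (intro finsum_cong') (auto simp: MA.coeff_closed[OF f] smult_assoc1)
  also have "\<dots> = c \<odot>\<^bsub>A\<^esub> (\<Oplus>\<^bsub>A\<^esub>m\<in>?S. f m \<odot>\<^bsub>A\<^esub> \<theta> m)"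
    using S c by (intro finsum_smult) (auto simp: MA.coeff_closed[OF f])
  finally show ?thesis by (simp only: lift_def)
qed

lemma lift_basis_elt:
  assumes "m \<in> carrier M"
  shows "lift (basis_elt k m) = \<theta> m"
proof -
  have "lift (basis_elt k m) = (\<Oplus>\<^bsub>A\<^esub>n\<in>{m}. basis_elt k m n \<odot>\<^bsub>A\<^esub> \<theta> n)"
    using assms by (intro lift_eq MA.basis_elt_closed) (auto simp: supp_on_def basis_elt_def)
  also have "\<dots> = \<theta> m"
    using assms by (simp add: basis_elt_def)
  finally show ?thesis .
qed

lemma lift_mult_basis_elt:
  assumes m: "m \<in> carrier M" and g: "g \<in> carrier kM"
  shows "lift (basis_elt k m \<otimes>\<^bsub>kM\<^esub> g) = \<theta> m \<otimes>\<^bsub>A\<^esub> lift g"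
  using g
proof (induction g rule: MA.monoid_algebra_induct)
  case zero
  then show ?case using m by (simp add: lift_zero)
next
  case (add c n f)
  then show ?case using m
    by (simp add: kM.r_distr kM.smult_mult_right MA.basis_elt_mult lift_add lift_smult lift_closed
        lift_basis_elt hom_mult r_distr smult_mult_right)
qed

lemma lift_mult:
  assumes f: "f \<in> carrier kM" and g: "g \<in> carrier kM"
  shows "lift (f \<otimes>\<^bsub>kM\<^esub> g) = lift f \<otimes>\<^bsub>A\<^esub> lift g"
  using f
proof (induction f rule: MA.monoid_algebra_induct)
  case zero
  then show ?case using g by (simp add: lift_zero lift_closed)
next
  case (add c n f)
  then show ?case using g
    by (simp add: kM.l_distr kM.smult_mult_left lift_mult_basis_elt lift_add lift_smult lift_closed
        lift_basis_elt l_distr smult_mult_left)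
qed

lemma lift_one: "lift \<one>\<^bsub>kM\<^esub> = \<one>\<^bsub>A\<^esub>"
  by (simp add: MA.monoid_algebra_simps(1) lift_basis_elt hom_one)

theorem lift_hom: "lift \<in> algebra_hom k kM A"
  unfolding algebra_hom_def
  by (intro CollectI conjI ballI ring_hom_memI)
    (simp_all add: lift_closed lift_mult lift_add lift_one lift_smult)

end

text \<open>Scaling by \<open>c\<close> is left multiplication by the scalar multiple
  \<open>c\<close> of the unit, so ring ideals are subspaces.\<close>

lemma (in unital_algebra) ideal_smult_closed:
  assumes "ideal I A" "c \<in> carrier k" "i \<in> I"
  shows "c \<odot>\<^bsub>A\<^esub> i \<in> I"
proof -
  interpret I: ideal I A by fact
  have "(c \<odot>\<^bsub>A\<^esub> \<one>\<^bsub>A\<^esub>) \<otimes>\<^bsub>A\<^esub> i \<in> I" using assms by (intro I.I_l_closed) auto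
  then show ?thesis using assms I.Icarr by (simp add: smult_mult_left)
qed

section \<open>Quotient algebras\<close>

lemma quotient_algebra_simps:
  "carrier (quotient_algebra A I) = carrier (A Quot I)"
  "mult (quotient_algebra A I) = mult (A Quot I)"
  "one (quotient_algebra A I) = one (A Quot I)"
  "zero (quotient_algebra A I) = zero (A Quot I)"
  "add (quotient_algebra A I) = add (A Quot I)"
  "smult (quotient_algebra A I) c C = (\<Union>a\<in>C. I +>\<^bsub>A\<^esub> (c \<odot>\<^bsub>A\<^esub> a))"
  by (simp_all add: quotient_algebra_def)

locale algebra_ideal = unital_algebra k A + I: ideal I A
  for k (structure) and A (structure) and I
begin

abbreviation Q where "Q \<equiv> quotient_algebra A I"

lemma quotient_carrier: "carrier Q = (\<lambda>a. I +>\<^bsub>A\<^esub> a) ` carrier A"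
  by (auto simp: quotient_algebra_simps FactRing_simps)

lemma quotient_closed: "a \<in> carrier A \<Longrightarrow> I +>\<^bsub>A\<^esub> a \<in> carrier Q"
  by (simp add: quotient_carrier)

lemma quotient_mult:
  "a \<in> carrier A \<Longrightarrow> b \<in> carrier A \<Longrightarrow> (I +>\<^bsub>A\<^esub> a) \<otimes>\<^bsub>Q\<^esub> (I +>\<^bsub>A\<^esub> b) = I +>\<^bsub>A\<^esub> (a \<otimes>\<^bsub>A\<^esub> b)"
  by (simp add: quotient_algebra_simps FactRing_def I.rcoset_mult_add)

lemma quotient_add:
  "a \<in> carrier A \<Longrightarrow> b \<in> carrier A \<Longrightarrow> (I +>\<^bsub>A\<^esub> a) \<oplus>\<^bsub>Q\<^esub> (I +>\<^bsub>A\<^esub> b) = I +>\<^bsub>A\<^esub> (a \<oplus>\<^bsub>A\<^esub> b)"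
  by (simp add: quotient_algebra_simps FactRing_def I.a_rcos_sum)

lemma quotient_one: "\<one>\<^bsub>Q\<^esub> = I +>\<^bsub>A\<^esub> \<one>\<^bsub>A\<^esub>"
  by (simp add: quotient_algebra_simps FactRing_def)

lemma quotient_zero: "\<zero>\<^bsub>Q\<^esub> = I +>\<^bsub>A\<^esub> \<zero>\<^bsub>A\<^esub>"
  by (simp add: quotient_algebra_simps FactRing_def I.is_ideal a_rcos_zero)

lemma coset_eq_iff:
  "a \<in> carrier A \<Longrightarrow> b \<in> carrier A \<Longrightarrow> I +>\<^bsub>A\<^esub> a = I +>\<^bsub>A\<^esub> b \<longleftrightarrow> a \<ominus>\<^bsub>A\<^esub> b \<in> I"
  using quotient_eq_iff_same_a_r_cos[OF I.is_ideal] by simp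

text \<open>The definition takes a union over all representatives. Two of them differ by an element
  of \<open>I\<close>, which absorbs scalars, so every set in the union is the same coset.\<close>

lemma quotient_smult:
  assumes c: "c \<in> carrier k" and a: "a \<in> carrier A"
  shows "c \<odot>\<^bsub>Q\<^esub> (I +>\<^bsub>A\<^esub> a) = I +>\<^bsub>A\<^esub> (c \<odot>\<^bsub>A\<^esub> a)"
proof -
  have "I +>\<^bsub>A\<^esub> (c \<odot>\<^bsub>A\<^esub> b) = I +>\<^bsub>A\<^esub> (c \<odot>\<^bsub>A\<^esub> a)" if b: "b \<in> I +>\<^bsub>A\<^esub> a" for b
  proof -
    obtain i where i: "i \<in> I" "b = i \<oplus>\<^bsub>A\<^esub> a" using b by (auto simp: a_r_coset_def')
    have "c \<odot>\<^bsub>A\<^esub> b = c \<odot>\<^bsub>A\<^esub> i \<oplus>\<^bsub>A\<^esub> c \<odot>\<^bsub>A\<^esub> a" using i c a I.Icarr by (simp add: smult_r_distr)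
    then have "c \<odot>\<^bsub>A\<^esub> b \<in> I +>\<^bsub>A\<^esub> (c \<odot>\<^bsub>A\<^esub> a)"
      using ideal_smult_closed[OF I.is_ideal c i(1)] by (auto simp: a_r_coset_def')
    then show ?thesis using I.a_repr_independence'[of "c \<odot>\<^bsub>A\<^esub> b" "c \<odot>\<^bsub>A\<^esub> a"] c a by simp
  qed
  moreover have "a \<in> I +>\<^bsub>A\<^esub> a" using a by (rule I.a_rcos_self)
  ultimately have "(\<Union>b\<in>I +>\<^bsub>A\<^esub> a. I +>\<^bsub>A\<^esub> (c \<odot>\<^bsub>A\<^esub> b)) = I +>\<^bsub>A\<^esub> (c \<odot>\<^bsub>A\<^esub> a)" by blast
  then show ?thesis by (simp only: quotient_algebra_simps)
qed

lemmas quotient_ops = quotient_mult quotient_add quotient_smult quotient_one quotient_zero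

lemma coset_cases:
  assumes "C \<in> carrier Q"
  obtains a where "a \<in> carrier A" "C = I +>\<^bsub>A\<^esub> a"
  using assms by (auto simp: quotient_carrier)

theorem unital_algebra_quotient: "unital_algebra k Q"
proof -
  interpret QR: ring "A Quot I" by (rule I.quotient_is_ring)
  have neg: "\<exists>y\<in>carrier (A Quot I). y \<oplus>\<^bsub>A Quot I\<^esub> x = \<zero>\<^bsub>A Quot I\<^esub>" if "x \<in> carrier (A Quot I)" for x
    using that QR.l_neg QR.a_inv_closed by blast
  have ag: "abelian_group Q"
    by (rule abelian_groupI) (simp_all add: quotient_algebra_simps QR.a_ac neg)
  have ring: "ring Q"
    by (intro ringI monoidI ag)
       (simp_all add: quotient_algebra_simps QR.m_assoc QR.l_distr QR.r_distr)
  have module: "module k Q"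
  proof (intro moduleI ag)
    show "cring k" by (rule R.is_cring)
  qed (auto elim!: coset_cases simp: quotient_ops quotient_closed
      smult_l_distr smult_r_distr smult_assoc1)
  show ?thesis
    by (rule unital_algebra.intro[OF module ring], rule unital_algebra_axioms.intro)
      (auto elim!: coset_cases simp: quotient_ops smult_mult_left smult_mult_right)
qed

lemma quotient_hom:
  assumes \<psi>: "\<psi> \<in> algebra_hom k A B" and B: "ring B" and zero: "\<And>i. i \<in> I \<Longrightarrow> \<psi> i = \<zero>\<^bsub>B\<^esub>"
  obtains \<phi> where "\<phi> \<in> algebra_hom k Q B" "\<And>a. a \<in> carrier A \<Longrightarrow> \<phi> (I +>\<^bsub>A\<^esub> a) = \<psi> a"
proof -
  interpret B: ring B by fact
  have hom: "\<psi> \<in> ring_hom A B" and smult: "\<And>c a. c \<in> carrier k \<Longrightarrow> a \<in> carrier A \<Longrightarrow> \<psi> (c \<odot>\<^bsub>A\<^esub> a) = c \<odot>\<^bsub>B\<^esub> \<psi> a"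
    using \<psi> by (auto simp: algebra_hom_def)
  \<comment> \<open>Meaningful because \<open>\<psi>\<close> kills \<open>I\<close> and is therefore
    constant on each coset, so that the image of a coset is a singleton.\<close>
  define \<phi> where "\<phi> C = the_elem (\<psi> ` C)" for C
  have \<phi>: "\<phi> (I +>\<^bsub>A\<^esub> a) = \<psi> a" if a: "a \<in> carrier A" for a
  proof -
    have "\<psi> b = \<psi> a" if "b \<in> I +>\<^bsub>A\<^esub> a" for b
    proof -
      obtain i where i: "i \<in> I" "b = i \<oplus>\<^bsub>A\<^esub> a" using \<open>b \<in> _\<close> by (auto simp: a_r_coset_def')
      then show ?thesis
        using a I.Icarr ring_hom_closed[OF hom a] by (simp add: ring_hom_add[OF hom] zero)
    qed
    moreover have "a \<in> I +>\<^bsub>A\<^esub> a" using a by (rule I.a_rcos_self)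
    ultimately have "\<psi> ` (I +>\<^bsub>A\<^esub> a) = {\<psi> a}" by blast
    then show ?thesis by (simp add: \<phi>_def)
  qed
  have "\<phi> \<in> ring_hom Q B"
    by (rule ring_hom_memI)
      (auto elim!: coset_cases simp: quotient_ops \<phi> ring_hom_mult[OF hom] ring_hom_add[OF hom]
        ring_hom_one[OF hom] ring_hom_closed[OF hom])
  then have "\<phi> \<in> algebra_hom k Q B"
    by (auto simp: algebra_hom_def quotient_ops \<phi> smult elim!: coset_cases)
  then show ?thesis using \<phi> that by blast
qed

end

section \<open>Free algebras and presented algebras\<close>

lemma monoid_free_monoid: "monoid free_monoid"
  by (rule monoidI) (auto simp: free_monoid_def)

lemma (in cring) monoid_alg_free_monoid: "monoid_alg R (free_monoid :: 'x list monoid)"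
  by (intro monoid_alg.intro is_cring monoid_free_monoid)

lemma (in cring) unital_algebra_free_algebra: "unital_algebra R (free_algebra R)"
  unfolding free_algebra_def
  by (rule monoid_alg.unital_algebra_monoid_algebra[OF monoid_alg_free_monoid])

lemma (in cring) fa_gen_closed [simp]: "fa_gen R x \<in> carrier (free_algebra R)"
  unfolding free_algebra_def fa_gen_def
  by (rule monoid_alg.basis_elt_closed[OF monoid_alg_free_monoid]) (simp add: free_monoid_def)

lemma (in cring) algebra_ideal_presented:
  assumes "Rel \<subseteq> carrier (free_algebra R)"
  shows "algebra_ideal R (free_algebra R) (Idl\<^bsub>free_algebra R\<^esub> Rel)"
proof -
  interpret F: unital_algebra R "free_algebra R" by (rule unital_algebra_free_algebra)
  show ?thesis
    by (intro algebra_ideal.intro F.unital_algebra_axioms F.genideal_ideal assms)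
qed

lemma (in cring) unital_algebra_presented:
  assumes "Rel \<subseteq> carrier (free_algebra R)"
  shows "unital_algebra R (presented_algebra R Rel)"
  unfolding presented_algebra_def
  by (rule algebra_ideal.unital_algebra_quotient[OF algebra_ideal_presented[OF assms]])

lemma (in unital_algebra) free_algebra_hom:
  fixes b :: "'x \<Rightarrow> _"
  assumes b: "\<And>x. b x \<in> carrier A"
  obtains \<psi> where "\<psi> \<in> algebra_hom k (free_algebra k) A" "\<And>x. \<psi> (fa_gen k x) = b x"
proof -
  define \<theta> where "\<theta> w = foldr (\<lambda>x z. b x \<otimes>\<^bsub>A\<^esub> z) w \<one>\<^bsub>A\<^esub>" for w
  have closed: "\<theta> w \<in> carrier A" for w
    by (induction w) (simp_all add: \<theta>_def b)
  have append: "\<theta> (v @ w) = \<theta> v \<otimes>\<^bsub>A\<^esub> \<theta> w" for v w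
  proof (induction v)
    case (Cons x v)
    have "\<theta> ((x # v) @ w) = b x \<otimes>\<^bsub>A\<^esub> \<theta> (v @ w)" "\<theta> (x # v) = b x \<otimes>\<^bsub>A\<^esub> \<theta> v"
      by (simp_all add: \<theta>_def)
    then show ?case by (simp add: Cons.IH m_assoc b closed)
  qed (use closed[of w] in \<open>simp add: \<theta>_def\<close>)
  interpret L: monoid_alg_lift k A "free_monoid :: 'x list monoid" \<theta>
    by (intro monoid_alg_lift.intro R.monoid_alg_free_monoid unital_algebra_axioms
        monoid_alg_lift_axioms.intro)
      (simp_all add: closed append, simp_all add: free_monoid_def append, simp add: \<theta>_def)
  have "L.lift (fa_gen k x) = b x" for x
    unfolding fa_gen_def by (subst L.lift_basis_elt) (simp_all add: free_monoid_def \<theta>_def b)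
  with L.lift_hom show ?thesis
    by (intro that) (simp_all add: free_algebra_def)
qed

text \<open>The hypothesis \<open>relations\<close> speaks of every ring homomorphism with the
  prescribed values on generators, so relators can be evaluated by the homomorphism laws alone,
  without naming the evaluation map.\<close>

lemma (in unital_algebra) presented_algebra_hom:
  fixes b :: "'x \<Rightarrow> _"
  assumes b: "\<And>x. b x \<in> carrier A" and Rel: "Rel \<subseteq> carrier (free_algebra k)"
    and relations: "\<And>\<psi> r. \<psi> \<in> ring_hom (free_algebra k) A \<Longrightarrow> (\<And>x. \<psi> (fa_gen k x) = b x) \<Longrightarrow>
      r \<in> Rel \<Longrightarrow> \<psi> r = \<zero>\<^bsub>A\<^esub>"
  obtains \<phi> where "\<phi> \<in> algebra_hom k (presented_algebra k Rel) A" "\<And>x. \<phi> (pa_gen k Rel x) = b x"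
proof -
  let ?F = "free_algebra k :: (_, 'x list \<Rightarrow> _) module" let ?I = "Idl\<^bsub>?F\<^esub> Rel"
  obtain \<psi> where \<psi>: "\<psi> \<in> algebra_hom k ?F A" and gen: "\<And>x. \<psi> (fa_gen k x) = b x"
    using free_algebra_hom[where b = b, OF b] by blast
  then have hom: "\<psi> \<in> ring_hom ?F A" by (simp add: algebra_hom_def)
  interpret F: unital_algebra k ?F by (rule R.unital_algebra_free_algebra)
  interpret H: ring_hom_ring ?F A \<psi> by (rule ring_hom_ringI2[OF F.ring_axioms ring_axioms hom])
  interpret I: algebra_ideal k ?F ?I by (rule R.algebra_ideal_presented[OF Rel])
  have "?I \<subseteq> a_kernel ?F A \<psi>"
    by (rule F.genideal_minimal[OF H.kernel_is_ideal])
       (use Rel relations[OF hom gen] in \<open>auto simp only: a_kernel_def' mem_Collect_eq subset_iff\<close>)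
  then have zero: "\<psi> i = \<zero>\<^bsub>A\<^esub>" if "i \<in> ?I" for i
    using that by (auto simp only: a_kernel_def')
  show ?thesis
  proof (rule I.quotient_hom[OF \<psi> ring_axioms zero])
    fix \<phi> assume "\<phi> \<in> algebra_hom k (quotient_algebra ?F ?I) A"
      and "\<And>a. a \<in> carrier ?F \<Longrightarrow> \<phi> (?I +>\<^bsub>?F\<^esub> a) = \<psi> a"
    then show thesis
      by (intro that[of \<phi>]) (simp_all add: presented_algebra_def pa_gen_def gen)
  qed
qed

lemma (in cring) pa_gen_closed:
  assumes "Rel \<subseteq> carrier (free_algebra R)"
  shows "pa_gen R Rel x \<in> carrier (presented_algebra R Rel)"
proof -
  interpret algebra_ideal R "free_algebra R" "Idl\<^bsub>free_algebra R\<^esub> Rel"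
    by (rule algebra_ideal_presented[OF assms])
  show ?thesis by (simp add: presented_algebra_def pa_gen_def quotient_closed)
qed

lemma (in cring) presented_algebra_proj:
  fixes Rel :: "('x list \<Rightarrow> 'a) set"
  assumes Rel: "Rel \<subseteq> carrier (free_algebra R)"
  obtains \<pi> where "\<pi> \<in> ring_hom (free_algebra R) (presented_algebra R Rel)"
    "\<And>x. \<pi> (fa_gen R x) = pa_gen R Rel x" "\<And>r. r \<in> Rel \<Longrightarrow> \<pi> r = \<zero>\<^bsub>presented_algebra R Rel\<^esub>"
proof -
  let ?F = "free_algebra R :: ('a, 'x list \<Rightarrow> 'a) module" let ?I = "Idl\<^bsub>?F\<^esub> Rel"
  interpret I: algebra_ideal R ?F ?I by (rule algebra_ideal_presented[OF Rel])
  have "(\<lambda>f. ?I +>\<^bsub>?F\<^esub> f) \<in> ring_hom ?F (presented_algebra R Rel)"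
    unfolding presented_algebra_def
    by (rule ring_hom_memI) (simp_all add: I.quotient_ops I.quotient_closed)
  moreover have "?I +>\<^bsub>?F\<^esub> r = \<zero>\<^bsub>presented_algebra R Rel\<^esub>" if r: "r \<in> Rel" for r
  proof -
    have "r \<in> ?I" using I.genideal_self[OF Rel] r by blast
    moreover have "r \<in> carrier ?F" using r Rel by blast
    ultimately have "?I +>\<^bsub>?F\<^esub> r = ?I +>\<^bsub>?F\<^esub> \<zero>\<^bsub>?F\<^esub>"
      by (subst I.coset_eq_iff) (simp_all add: a_minus_def I.A.minus_zero)
    then show ?thesis by (simp add: presented_algebra_def I.quotient_zero)
  qed
  ultimately show ?thesis by (intro that[of "\<lambda>f. ?I +>\<^bsub>?F\<^esub> f"]) (simp_all add: pa_gen_def)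
qed

text \<open>Classes of words span, and a word grows from the empty word by letters added on the
  left; hence closure under left multiplication by generators suffices.\<close>

lemma (in cring) presented_algebra_induct [consumes 2, case_names zero one add smult gen]:
  fixes Rel :: "('x list \<Rightarrow> 'a) set"
  assumes z: "z \<in> carrier (presented_algebra R Rel)"
    and Rel: "Rel \<subseteq> carrier (free_algebra R)"
    and zero: "P \<zero>\<^bsub>presented_algebra R Rel\<^esub>" and one: "P \<one>\<^bsub>presented_algebra R Rel\<^esub>"
    and add: "\<And>u v. u \<in> carrier (presented_algebra R Rel) \<Longrightarrow> v \<in> carrier (presented_algebra R Rel) \<Longrightarrow>
      P u \<Longrightarrow> P v \<Longrightarrow> P (u \<oplus>\<^bsub>presented_algebra R Rel\<^esub> v)"
    and smult: "\<And>c u. c \<in> carrier R \<Longrightarrow> u \<in> carrier (presented_algebra R Rel) \<Longrightarrow>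
      P u \<Longrightarrow> P (c \<odot>\<^bsub>presented_algebra R Rel\<^esub> u)"
    and gen: "\<And>x u. u \<in> carrier (presented_algebra R Rel) \<Longrightarrow>
      P u \<Longrightarrow> P (pa_gen R Rel x \<otimes>\<^bsub>presented_algebra R Rel\<^esub> u)"
  shows "P z"
proof -
  let ?F = "free_algebra R :: ('a, 'x list \<Rightarrow> 'a) module" let ?I = "Idl\<^bsub>?F\<^esub> Rel"
  interpret I: algebra_ideal R ?F ?I by (rule algebra_ideal_presented[OF Rel])
  interpret MA: monoid_alg R "free_monoid :: 'x list monoid" by (rule monoid_alg_free_monoid)
  note defs = presented_algebra_def pa_gen_def
  have basis: "basis_elt R w \<in> carrier ?F" for w :: "'x list"
    using MA.basis_elt_closed[of w] by (simp add: free_algebra_def, simp add: free_monoid_def)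
  have word: "P (?I +>\<^bsub>?F\<^esub> basis_elt R w)" for w
  proof (induction w)
    case Nil
    have "\<one>\<^bsub>?F\<^esub> = basis_elt R []"
      unfolding free_algebra_def MA.monoid_algebra_simps(1) by (simp add: free_monoid_def)
    then show ?case using one by (simp add: defs I.quotient_one)
  next
    case (Cons x w)
    have "basis_elt R (x # w) = fa_gen R x \<otimes>\<^bsub>?F\<^esub> basis_elt R w"
      unfolding free_algebra_def fa_gen_def
      by (subst MA.basis_elt_mult) (simp_all add: free_monoid_def)
    then show ?case using gen[of "?I +>\<^bsub>?F\<^esub> basis_elt R w" x] Cons.IH basis
      by (simp add: defs I.quotient_closed I.quotient_mult)
  qed
  obtain f where f: "f \<in> carrier ?F" "z = ?I +>\<^bsub>?F\<^esub> f"
    using z by (auto simp: defs elim: I.coset_cases)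
  have "f \<in> carrier (monoid_algebra R free_monoid)" using f by (simp add: free_algebra_def)
  then have "P (?I +>\<^bsub>?F\<^esub> f)"
  proof (induction f rule: MA.monoid_algebra_induct)
    case zero
    then show ?case using assms(3) by (simp add: defs I.quotient_zero, simp add: free_algebra_def)
  next
    case (add c w f)
    have f: "f \<in> carrier ?F" using add by (simp add: free_algebra_def)
    have "P ((c \<odot>\<^bsub>presented_algebra R Rel\<^esub> (?I +>\<^bsub>?F\<^esub> basis_elt R w)) \<oplus>\<^bsub>presented_algebra R Rel\<^esub> (?I +>\<^bsub>?F\<^esub> f))"
      using add.IH \<open>c \<in> _\<close> f basis word
      by (intro assms(5) smult) (auto simp: defs I.quotient_closed I.quotient_smult)
    then show ?case using add.hyps basis[of w] f
      by (simp add: defs I.quotient_closed I.quotient_smult I.quotient_add, simp add: free_algebra_def)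
  qed
  then show ?thesis using f by simp
qed

section \<open>Polynomials over the field with two elements\<close>

lemma bit_poly_add_self [simp]: "p + p = 0" for p :: "bit poly"
proof (rule poly_eqI)
  have "b + b = 0" for b :: bit by (cases b) simp_all
  then show "coeff (p + p) n = coeff 0 n" for n by (simp only: coeff_add coeff_0)
qed

text \<open>Reduces modulo two the numeral coefficients that arise when equal terms are merged, so
  that polynomial identities can be checked by expansion.\<close>

lemma bit_poly_numeral [simp]:
  "numeral (Num.Bit0 n) = (0 :: bit poly)" "numeral (Num.Bit1 n) = (1 :: bit poly)"
  by (simp_all only: numeral.simps bit_poly_add_self add_0_left)

lemma bit_poly_add_self_left [simp]: "p + (p + q) = q" for p :: "bit poly"
  by (simp flip: add.assoc)

lemma bit_poly_minus: "p - q = p + q" for p :: "bit poly"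
  by (metis add_diff_cancel_right' bit_poly_add_self_left add.commute)

lemma bit_poly_add_eq_iff: "p + q = r \<longleftrightarrow> p = q + r" for p :: "bit poly"
  by (metis bit_poly_add_self_left add.commute)

text \<open>Iterated squaring: the mixed term of a square is doubled and vanishes.\<close>

lemma one_plus_power_two_power: "(1 + p) ^ 2 ^ n = 1 + p ^ 2 ^ n" for p :: "bit poly"
proof (induction n)
  case (Suc n)
  have "(1 + p) ^ 2 ^ Suc n = (1 + p ^ 2 ^ n) * (1 + p ^ 2 ^ n)"
    by (simp add: power_mult mult.commute[of 2] Suc.IH power2_eq_square)
  also have "\<dots> = 1 + p ^ 2 ^ Suc n"
    by (simp add: algebra_simps flip: power_add mult_2)
  finally show ?case .
qed simp

text \<open>\<open>r\<close> is q/2, the number of terms in each of the two sums in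
  \<open>Y\<close>; \<open>q = 2 * r\<close> with \<open>r = 2 ^ k\<close> also encodes that q is at
  least 2.\<close>

locale sd_poly =
  fixes q r k :: nat
  assumes q: "q = 2 * r" and r: "r = 2 ^ k"
begin

text \<open>
  Here \<open>X\<close> stands for the group element \<open>g\<close>, and the substitution \<open>\<sigma>\<close> below for conjugation by \<open>h\<close>.
  Since \<open>X = 1 + u\<close>, \<open>U = u\<^sup>4 A\<close>, \<open>e = u\<^sup>2 U A\<close> and \<open>M = U\<^sup>2\<close>, the congruences modulo \<open>M\<close> reduce to
  identities between polynomials in \<open>u\<close> and \<open>A\<close> that do not involve \<open>q\<close>; the witnesses passed to
  \<open>eqM_I\<close> are the quotients by \<open>M\<close> of the expanded differences.
\<close>

definition X :: "bit poly" where "X = [:0, 1:]"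
definition u :: "bit poly" where "u = 1 + X"
definition A where "A = u ^ (2 * q - 4)"
definition U where "U = u ^ (2 * q)"
definition e where "e = u ^ (4 * q - 2)"
text \<open>The bracketed sum in \<open>Y\<close>: with i = r + 1 + j in its second half,
  \<open>4 * i - 1\<close> becomes \<open>2 * q + 3 + 4 * j\<close>, so both halves share the sum of
  the powers of \<open>X ^ 4\<close>.\<close>

definition s where "s = (X + X ^ (2 * q + 3)) * (\<Sum>i<r. X ^ (4 * i))"
definition M where "M = u ^ (4 * q)"

text \<open>As \<open>M\<close> is \<open>1 + X ^ (4 * q)\<close>, this is equality in the group
  algebra of a cyclic group of order 4q over GF(2).\<close>

definition eqM (infix "\<approx>" 50) where "a \<approx> b \<longleftrightarrow> [a = b] (mod M)"

lemma eqM_I: "a + b = M * c \<Longrightarrow> a \<approx> b"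
  by (simp add: eqM_def cong_iff_dvd_diff bit_poly_minus)

lemma eqM_E:
  assumes "a \<approx> b"
  obtains c where "a = b + M * c"
  using assms unfolding eqM_def by (metis cong_iff_dvd_diff bit_poly_minus bit_poly_add_eq_iff dvdE)

lemma eqM_refl: "a \<approx> a"
  and eqM_sym: "a \<approx> b \<Longrightarrow> b \<approx> a"
  and eqM_trans [trans]: "a \<approx> b \<Longrightarrow> b \<approx> c \<Longrightarrow> a \<approx> c"
  and eqM_add: "a \<approx> b \<Longrightarrow> c \<approx> d \<Longrightarrow> a + c \<approx> b + d"
  and eqM_mult: "a \<approx> b \<Longrightarrow> c \<approx> d \<Longrightarrow> a * c \<approx> b * d"
  and eqM_pow: "a \<approx> b \<Longrightarrow> a ^ n \<approx> b ^ n"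
  and eqM_sum: "(\<And>i. i \<in> S \<Longrightarrow> f i \<approx> g i) \<Longrightarrow> sum f S \<approx> sum g S"
  unfolding eqM_def
  by (auto intro: cong_sym cong_trans cong_add cong_mult cong_pow cong_sum)

lemma X_eq: "X = 1 + u" by (simp add: u_def)

lemma r_pos: "1 \<le> r" by (simp add: r)

lemma q_pos: "0 < q" using r_pos q by simp

lemma U_eq: "U = u * u * u * u * A"
proof -
  have "2 * q = 4 + (2 * q - 4)" using r_pos q by simp
  then have "U = u ^ 4 * A" unfolding U_def A_def by (metis power_add)
  then show ?thesis by (simp add: numeral_eq_Suc)
qed

lemma e_eq: "e = u * u * U * A"
proof -
  have "4 * q - 2 = 2 + 2 * q + (2 * q - 4)" using r_pos q by simp
  then have "e = u ^ 2 * U * A" unfolding U_def A_def e_def by (metis power_add)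
  then show ?thesis by (simp add: power2_eq_square)
qed

lemma M_eq: "M = U * U"
  unfolding M_def U_def by (simp flip: power_add)

lemma u_neq_0: "u \<noteq> 0"
  by (simp add: u_def X_def one_pCons)

lemma X_pow_2q: "X ^ (2 * q) = 1 + U"
proof -
  have "U = 1 + X ^ 2 ^ (k + 2)"
    unfolding U_def u_def by (subst one_plus_power_two_power[symmetric]) (simp add: q r)
  then show ?thesis by (simp add: q r)
qed

lemma X_pow_2q_1: "X ^ (2 * q + 1) = X * (1 + U)"
  by (simp add: X_pow_2q)

lemma X_pow_4q: "X ^ (4 * q) = 1 + M"
proof -
  have "X ^ (4 * q) = X ^ (2 * q) * X ^ (2 * q)" by (simp flip: power_add)
  also have "\<dots> = (1 + U) * (1 + U)" by (simp only: X_pow_2q)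
  also have "\<dots> = 1 + M" by (simp add: M_eq algebra_simps)
  finally show ?thesis .
qed

lemma X_pow_4q_cong: "X ^ (4 * q) \<approx> 1"
  by (rule eqM_I[where c = 1]) (simp add: X_pow_4q add.commute)

text \<open>Stands in for inverses of \<open>X\<close>: an unwanted power of \<open>X\<close> is
  completed to \<open>X ^ (4 * q)\<close> by multiplication and then removed.\<close>

lemma eqM_cancel_X_pow:
  assumes "X ^ (4 * q) * a \<approx> b"
  shows "a \<approx> b"
proof -
  have "X ^ (4 * q) * a \<approx> 1 * a" by (intro eqM_mult X_pow_4q_cong eqM_refl)
  then show ?thesis using eqM_trans[OF eqM_sym, OF _ assms] by (simp only: mult_1_left)
qed

lemma X_pow_mod:
  assumes "i = j + 4 * q * c"
  shows "X ^ i \<approx> X ^ j"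
proof -
  have "X ^ j * (X ^ (4 * q)) ^ c \<approx> X ^ j * 1 ^ c"
    by (intro eqM_mult eqM_pow X_pow_4q_cong eqM_refl)
  then show ?thesis by (simp add: assms power_add power_mult)
qed

lemma geometric_sum: "(1 + p) * (\<Sum>i<n. p ^ i) = 1 + p ^ n" for p :: "bit poly"
  using one_diff_power_eq[of p n] by (simp add: bit_poly_minus)

text \<open>A geometric sum with ratio \<open>X ^ 4\<close>. Times \<open>1 + X ^ 4 = u ^ 4\<close>
  it gives \<open>(1 + X ^ 4) ^ r\<close> by Frobenius, and one factor \<open>u ^ 4\<close>
  cancels.\<close>

lemma A_eq_sum: "(\<Sum>i<r. X ^ (4 * i)) = A"
proof -
  have "(1 + X ^ 4) * (\<Sum>i<r. X ^ (4 * i)) = 1 + (X ^ 4) ^ r"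
    using geometric_sum[of "X ^ 4" r] by (simp add: power_mult)
  also have "\<dots> = (1 + X ^ 4) ^ r" unfolding r by (rule one_plus_power_two_power[symmetric])
  also have "\<dots> = (1 + X ^ 4) * (1 + X ^ 4) ^ (r - 1)"
    using r_pos by (simp flip: power_Suc)
  finally have "u ^ 4 * (\<Sum>i<r. X ^ (4 * i)) = u ^ 4 * (u ^ 4) ^ (r - 1)"
    using one_plus_power_two_power[of X 2] by (simp add: u_def)
  then have "(\<Sum>i<r. X ^ (4 * i)) = (u ^ 4) ^ (r - 1)" using u_neq_0 by simp
  also have "4 * (r - 1) = 2 * q - 4" using q by simp
  then have "(u ^ 4) ^ (r - 1) = A" by (simp only: A_def power_mult[symmetric])
  finally show ?thesis .
qed

text \<open>Multiplication by \<open>u\<close> gives \<open>1 + X ^ (4 * q) = u ^ (4 * q)\<close>.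
  At g the left side is the sum of all powers of g, the form in which the socle element is seen to
  be nonzero.\<close>

lemma norm_eq_sum: "(\<Sum>i<4 * q. X ^ i) = u * e"
proof -
  have "u * (\<Sum>i<4 * q. X ^ i) = 1 + X ^ (4 * q)"
    unfolding u_def by (rule geometric_sum)
  also have "\<dots> = U * U" by (simp add: X_pow_4q M_eq)
  also have "\<dots> = u * (u * e)" unfolding e_eq by (simp add: U_eq algebra_simps)
  finally show ?thesis using u_neq_0 by (simp only: mult_cancel_left simp_thms)
qed

text \<open>\<open>X + X ^ (2 * q + 3)\<close> is \<open>X * (1 + X ^ 2) + X ^ 3 * U\<close>, and
  \<open>1 + X ^ 2 = u ^ 2\<close>. In particular \<open>s\<close> is divisible by
  \<open>u ^ 2\<close>.\<close>

lemma s_eq: "s = X * u * u * A + X * X * X * U * A"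
proof -
  have "X ^ (2 * q + 3) = (1 + U) * (X * X * X)" by (simp add: power_add X_pow_2q power3_eq_cube)
  then have "s = (X + (1 + U) * (X * X * X)) * A" by (simp add: s_def A_eq_sum)
  then show ?thesis by (simp add: X_eq algebra_simps)
qed

section \<open>Conjugation by h modulo \<open>M\<close>\<close>

definition \<sigma> where "\<sigma> p = pcompose p (X ^ (2 * q - 1))"

lemma \<sigma>_add: "\<sigma> (a + b) = \<sigma> a + \<sigma> b" and \<sigma>_mult: "\<sigma> (a * b) = \<sigma> a * \<sigma> b"
  and \<sigma>_1: "\<sigma> 1 = 1"
  by (simp_all add: \<sigma>_def pcompose_add pcompose_mult pcompose_1)

lemma \<sigma>_power: "\<sigma> (a ^ n) = \<sigma> a ^ n"
  by (induction n) (simp_all add: \<sigma>_1 \<sigma>_mult)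

lemma \<sigma>_X: "\<sigma> X = X ^ (2 * q - 1)"
  by (simp add: \<sigma>_def X_def pcompose_pCons)

lemma \<sigma>_X_power: "\<sigma> (X ^ n) = X ^ ((2 * q - 1) * n)"
  by (simp add: \<sigma>_power \<sigma>_X power_mult)

lemma \<sigma>_u: "\<sigma> u = 1 + X ^ (2 * q - 1)"
  by (simp add: u_def \<sigma>_add \<sigma>_1 \<sigma>_X)

text \<open>\<open>\<sigma> u = 1 + X ^ (2 * q - 1)\<close> is a multiple of \<open>1 + X\<close>.
  Therefore the powers of \<open>u\<close> generate ideals stable under conjugation by h, which
  makes them two-sided in the noncommutative ring.\<close>

lemma dvd_\<sigma>_u_power: "u ^ n dvd \<sigma> (u ^ n * c)"
proof -
  have "u * (\<Sum>i<2 * q - 1. X ^ i) = \<sigma> u"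
    unfolding \<sigma>_u unfolding u_def by (rule geometric_sum)
  then have "u dvd \<sigma> u" by (metis dvd_triv_left)
  then show ?thesis by (simp add: \<sigma>_mult \<sigma>_power dvd_power_same)
qed

lemma eqM_add_zero: "b \<approx> 0 \<Longrightarrow> a + b \<approx> a"
  using eqM_add[OF eqM_refl, of b 0 a] by simp

text \<open>The product contains \<open>U\<close> twice, and \<open>U * U\<close> is
  \<open>M\<close>. Consequently \<open>X ^ (2 * q) = 1 + U\<close> acts as 1 on multiples of
  \<open>e\<close>.\<close>

lemma Ue: "U * e \<approx> 0"
  by (rule eqM_I[where c = "u * u * A"]) (simp add: M_eq e_eq algebra_simps)

lemma one_plus_U_e: "(1 + U) * (c * e) \<approx> c * e"
proof -
  have "c * e + c * (U * e) \<approx> c * e + c * 0" by (intro eqM_add eqM_mult Ue eqM_refl)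
  then show ?thesis by (simp add: algebra_simps)
qed

text \<open>\<open>(1 + X * X) * e\<close> is \<open>u ^ 2 * e = M\<close>. A single
  \<open>X\<close> does not fix \<open>e\<close>: by \<open>norm_eq_sum\<close>,
  \<open>(1 + X) * e\<close> is the sum of the \<open>X ^ i\<close> with i < 4q.\<close>

lemma XXe: "X * X * e \<approx> e"
  by (rule eqM_I[where c = 1]) (simp add: M_eq e_eq X_eq, simp add: U_eq algebra_simps)

text \<open>Binomial expansion cut off after the linear term, because \<open>U * U\<close> is
  \<open>M\<close>. The factor \<open>a ^ n\<close> is kept visible: in the applications it makes
  the linear term vanish.\<close>

lemma power_add_U: "\<exists>c. (a + U * b) ^ Suc n \<approx> a ^ Suc n + U * (a ^ n * c)"
proof (induction n)
  case 0
  show ?case by (rule exI[of _ b]) (simp add: eqM_refl)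
next
  case (Suc n)
  then obtain c where c: "(a + U * b) ^ Suc n \<approx> a ^ Suc n + U * (a ^ n * c)" by blast
  have "(a + U * b) ^ Suc (Suc n) \<approx> (a + U * b) * (a ^ Suc n + U * (a ^ n * c))"
    unfolding power_Suc[of _ "Suc n"] by (intro eqM_mult c eqM_refl)
  also have "\<dots> \<approx> a ^ Suc (Suc n) + U * (a ^ Suc n * (b + c))"
    by (rule eqM_I[where c = "a ^ n * b * c"]) (simp add: M_eq algebra_simps)
  finally show ?case by blast
qed

text \<open>\<open>4 * q - 4\<close> is at least \<open>2 * q\<close>, so a second factor
  \<open>U\<close> is present. The bound fits the linear term in \<open>t_power\<close>; in
  \<open>\<sigma>_e\<close> there is one spare factor \<open>u\<close>.\<close>

lemma u_power_U: "i = 4 * q - 4 + j \<Longrightarrow> u ^ i * U \<approx> 0"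
proof -
  assume "i = 4 * q - 4 + j"
  also have "4 * q - 4 + j = 2 * q + (2 * q - 4) + j" using q r_pos by simp
  finally have "u ^ i = U * A * u ^ j" by (simp only: power_add U_def A_def)
  then show ?thesis by (intro eqM_I[where c = "A * u ^ j"]) (simp add: M_eq algebra_simps)
qed

text \<open>\<open>X * \<sigma> u\<close> is \<open>u + U\<close>, so up to a power of
  \<open>X\<close> the element \<open>\<sigma> e\<close> is \<open>(u + U) ^ (4 * q - 2)\<close>,
  which differs from \<open>e\<close> by a multiple of \<open>M\<close>. The power of
  \<open>X\<close> is then removed with \<open>XXe\<close>.\<close>

lemma \<sigma>_e: "\<sigma> e \<approx> e"
proof -
  have 1: "X * X ^ (2 * q - 1) = 1 + U"
    using X_pow_2q r_pos q by (simp flip: power_Suc)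
  have n: "4 * q - 2 = Suc (4 * q - 3)" using r_pos q by simp
  have "X * \<sigma> u = u + U * 1" unfolding \<sigma>_u by (simp only: distrib_left 1) (simp add: X_eq)
  then have "X ^ (4 * q - 2) * \<sigma> e = (u + U * 1) ^ Suc (4 * q - 3)"
    by (simp only: e_def \<sigma>_power power_mult_distrib[symmetric] n)
  moreover obtain c where "(u + U * 1) ^ Suc (4 * q - 3) \<approx> u ^ Suc (4 * q - 3) + U * (u ^ (4 * q - 3) * c)"
    using power_add_U by blast
  moreover have "U * (u ^ (4 * q - 3) * c) \<approx> 0"
  proof -
    have "u ^ (4 * q - 3) * U * c \<approx> 0 * c"
      using r_pos q by (intro eqM_mult u_power_U[where j = 1] eqM_refl) simp
    then show ?thesis by (simp add: mult_ac)
  qed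
  ultimately have "X ^ (4 * q - 2) * \<sigma> e \<approx> u ^ Suc (4 * q - 3) + 0"
    by (metis eqM_add_zero eqM_trans add_0_right)
  then have *: "X ^ (4 * q - 2) * \<sigma> e \<approx> e" by (simp only: e_def n add_0_right)
  have "2 + (4 * q - 2) = 4 * q" using q_pos by simp
  then have "X * X * X ^ (4 * q - 2) = X ^ (4 * q)" by (metis power_add power2_eq_square)
  then have "X * X * (X ^ (4 * q - 2) * \<sigma> e) = X ^ (4 * q) * \<sigma> e"
    by (simp only: mult.assoc[symmetric])
  then have "X ^ (4 * q) * \<sigma> e \<approx> X * X * e"
    using eqM_mult[OF eqM_refl *, of "X * X"] by (simp only:)
  then show ?thesis by (rule eqM_cancel_X_pow[OF eqM_trans[OF _ XXe]])
qed

text \<open>Modulo 4q the exponent 4i is sent to -4i, so \<open>\<sigma>\<close> reverses the sum;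
  the shift by \<open>2 * q - 4 = 4 * (r - 1)\<close> restores its range.\<close>

lemma \<sigma>_A: "X ^ (2 * q - 4) * \<sigma> A \<approx> A"
proof -
  have "X ^ (2 * q - 4) * \<sigma> A = (\<Sum>i<r. X ^ (2 * q - 4 + (2 * q - 1) * (4 * i)))"
    unfolding A_eq_sum[symmetric] \<sigma>_def pcompose_sum sum_distrib_left
    unfolding \<sigma>_def[symmetric] \<sigma>_X_power power_add ..
  also have "\<dots> \<approx> (\<Sum>i<r. X ^ (4 * (r - Suc i)))"
  proof (rule eqM_sum)
    fix i assume "i \<in> {..<r}"
    then have "2 * q - 4 + (2 * q - 1) * (4 * i) + 4 * i = 4 * (r - Suc i) + 4 * q * (2 * i) + 4 * i"
      using q r_pos by (simp add: algebra_simps)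
    then show "X ^ (2 * q - 4 + (2 * q - 1) * (4 * i)) \<approx> X ^ (4 * (r - Suc i))"
      by (intro X_pow_mod[where c = "2 * i"]) simp
  qed
  also have "(\<Sum>i<r. X ^ (4 * (r - Suc i))) = A"
    unfolding A_eq_sum[symmetric] by (rule sum.nat_diff_reindex)
  finally show ?thesis .
qed

definition s' where "s' = (X * X * X + X * (1 + U)) * A"

text \<open>\<open>X ^ (2 * q + 4)\<close> inverts \<open>X ^ (2 * q - 4)\<close> modulo
  \<open>M\<close>, so by \<open>\<sigma>_A\<close> it is the factor between \<open>A\<close> and
  \<open>\<sigma> A\<close>; the rest is a count of exponents modulo 4q.\<close>

lemma \<sigma>_s: "\<sigma> s \<approx> s'"
proof -
  have "X ^ (2 * q + 4) * (X ^ (2 * q - 4) * \<sigma> A) = X ^ (4 * q) * \<sigma> A"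
    using r_pos q by (simp flip: power_add mult.assoc)
  moreover have "X ^ (2 * q + 4) * (X ^ (2 * q - 4) * \<sigma> A) \<approx> X ^ (2 * q + 4) * A"
    by (intro eqM_mult \<sigma>_A eqM_refl)
  ultimately have A: "\<sigma> A \<approx> X ^ (2 * q + 4) * A"
    by (simp only: eqM_cancel_X_pow)
  have "\<sigma> s = (X ^ (2 * q - 1) + X ^ ((2 * q - 1) * (2 * q + 3))) * \<sigma> A"
    unfolding s_def A_eq_sum by (simp only: \<sigma>_add \<sigma>_mult \<sigma>_X \<sigma>_X_power)
  also have "\<dots> \<approx> (X ^ (2 * q - 1) + X ^ (4 * q - 3)) * (X ^ (2 * q + 4) * A)"
  proof (intro eqM_mult eqM_add eqM_refl A X_pow_mod[where c = q])
    show "(2 * q - 1) * (2 * q + 3) = 4 * q - 3 + 4 * q * q"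
      using r_pos q by (simp add: algebra_simps)
  qed
  also have "\<dots> = (X ^ (4 * q + 3) + X ^ (6 * q + 1)) * A"
  proof -
    have "2 * q - 1 + (2 * q + 4) = 4 * q + 3" "4 * q - 3 + (2 * q + 4) = 6 * q + 1"
      using r_pos q by simp_all
    then have "X ^ (2 * q - 1) * X ^ (2 * q + 4) = X ^ (4 * q + 3)"
      and "X ^ (4 * q - 3) * X ^ (2 * q + 4) = X ^ (6 * q + 1)"
      by (simp_all only: power_add[symmetric])
    then show ?thesis by (simp only: distrib_right mult.assoc[symmetric])
  qed
  also have "\<dots> \<approx> (X ^ 3 + X ^ (2 * q + 1)) * A"
    by (intro eqM_mult eqM_add eqM_refl X_pow_mod[where c = 1]) simp_all
  also have "(X ^ 3 + X ^ (2 * q + 1)) * A = s'"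
    by (simp add: s'_def X_pow_2q power3_eq_cube)
  finally show ?thesis .
qed

text \<open>The four powers of \<open>X\<close> factor as
  \<open>X * (1 + X ^ 2) * (1 + X ^ (2 * q)) = X * u ^ 2 * U\<close>. Thus \<open>s\<close> commutes
  with h up to a term in \<open>e\<close>, from which the right side of the relation arises.\<close>

lemma s_add_s': "s + s' = X * e"
  by (simp add: s_eq s'_def e_eq X_eq algebra_simps U_eq)

text \<open>With the notation of the introduction, \<open>Y = a + h b\<close> and \<open>Y X = v X\<close> in the group algebra.\<close>

definition v where "v = X ^ (2 * q) * u + X * e"
definition t where "t = X ^ (2 * q + 1) + X ^ (4 * q - 1)"
definition a where "a = s + X ^ (2 * q)"
definition b where "b = s + X ^ (4 * q - 1)"

lemma a_eq: "a = s + 1 + U"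
  by (simp add: a_def X_pow_2q add.assoc)

lemma \<sigma>_b: "\<sigma> b \<approx> s' + X ^ (2 * q + 1)"
  unfolding b_def \<sigma>_add \<sigma>_X_power
proof (intro eqM_add \<sigma>_s X_pow_mod[where c = "2 * q - 2"])
  show "(2 * q - 1) * (4 * q - 1) = 2 * q + 1 + 4 * q * (2 * q - 2)"
    using q_pos by (cases q) (simp_all add: algebra_simps)
qed

lemma \<sigma>_X_2q: "\<sigma> (X ^ (2 * q)) \<approx> X ^ (2 * q)"
  unfolding \<sigma>_X_power
proof (intro X_pow_mod[where c = "q - 1"])
  show "(2 * q - 1) * (2 * q) = 2 * q + 4 * q * (q - 1)"
    using q_pos by (cases q) (simp_all add: algebra_simps)
qed

text \<open>\<open>s\<close> and \<open>\<sigma> s\<close> combine to \<open>X * e\<close>, and the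
  two single powers to \<open>X ^ (2 * q) * (1 + X)\<close>.\<close>

lemma trace_a_b: "a + \<sigma> b \<approx> v"
proof -
  have "a + \<sigma> b \<approx> a + (s' + X ^ (2 * q + 1))" by (intro eqM_add \<sigma>_b eqM_refl)
  also have "a + (s' + X ^ (2 * q + 1)) = (s + s') + X ^ (2 * q) * (1 + X)"
    by (simp add: a_def algebra_simps)
  also have "\<dots> = v" unfolding s_add_s' v_def u_def by (simp add: add.commute)
  finally show ?thesis .
qed

text \<open>\<open>X * e\<close> is fixed by \<open>\<sigma>\<close>, hence drops out, and so does
  the central \<open>X ^ (2 * q)\<close>; only \<open>X ^ (2 * q + 1)\<close> and its conjugate
  remain.\<close>

lemma trace_v: "v + \<sigma> v \<approx> t"
proof -
  have "X ^ (2 * q - 1) * e \<approx> X ^ (2 * q - 1) * (X * X * e)"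
    by (intro eqM_mult eqM_refl eqM_sym[OF XXe])
  also have "X ^ (2 * q - 1) * (X * X * e) = (X * X ^ (2 * q - 1)) * (X * e)" by (simp add: mult_ac)
  also have "\<dots> = (1 + U) * (X * e)" using X_pow_2q r_pos q by (simp flip: power_Suc)
  also have "\<dots> \<approx> X * e" by (rule one_plus_U_e)
  finally have 1: "X ^ (2 * q - 1) * e \<approx> X * e" .
  have "X ^ (2 * q - 1) * \<sigma> e \<approx> X ^ (2 * q - 1) * e" by (intro eqM_mult \<sigma>_e eqM_refl)
  then have 2: "\<sigma> (X * e) \<approx> X * e" unfolding \<sigma>_mult \<sigma>_X using 1 by (rule eqM_trans)
  have "\<sigma> v = \<sigma> (X ^ (2 * q)) * (1 + X ^ (2 * q - 1)) + \<sigma> (X * e)"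
    unfolding v_def by (simp only: \<sigma>_add \<sigma>_mult \<sigma>_u)
  also have "\<dots> \<approx> X ^ (2 * q) * (1 + X ^ (2 * q - 1)) + X * e"
    by (intro eqM_add eqM_mult \<sigma>_X_2q 2 eqM_refl)
  finally have "v + \<sigma> v \<approx> v + (X ^ (2 * q) * (1 + X ^ (2 * q - 1)) + X * e)"
    by (intro eqM_add eqM_refl)
  also have "\<dots> = X ^ (2 * q) * X + X ^ (2 * q) * X ^ (2 * q - 1)"
    by (simp add: v_def u_def algebra_simps)
  also have "\<dots> = t"
  proof -
    have "2 * q + (2 * q - 1) = 4 * q - 1" using r_pos q by simp
    then show ?thesis unfolding t_def power_add[symmetric] by (simp add: mult.commute)
  qed
  finally show ?thesis .
qed

text \<open>\<open>X * t\<close> is \<open>u ^ 2 + U * X ^ 2\<close>, so its power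
  \<open>2 * q - 1\<close> is \<open>u ^ (4 * q - 2) = e\<close> plus a linear term that vanishes by
  \<open>u_power_U\<close>. Multiplying by \<open>X ^ (2 * q + 1)\<close> clears the powers of
  \<open>X\<close> and leaves one factor \<open>X\<close> before \<open>e\<close>.\<close>

lemma t_power: "t ^ (2 * q - 1) \<approx> X * e"
proof -
  have n: "2 * q - 1 = Suc (2 * q - 2)" using r_pos q by simp
  have "X * X ^ (4 * q - 1) \<approx> 1" using X_pow_4q_cong r_pos q by (simp flip: power_Suc)
  then have "X * t \<approx> X * X ^ (2 * q + 1) + 1"
    unfolding t_def distrib_left by (intro eqM_add eqM_refl)
  also have "X * X ^ (2 * q + 1) + 1 = u * u + U * (X * X)"
    unfolding X_pow_2q_1 by (simp add: X_eq algebra_simps)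
  finally have p1: "(X * t) ^ (2 * q - 1) \<approx> (u * u + U * (X * X)) ^ Suc (2 * q - 2)"
    unfolding n by (rule eqM_pow)
  obtain c where p2: "(u * u + U * (X * X)) ^ Suc (2 * q - 2) \<approx>
      (u * u) ^ Suc (2 * q - 2) + U * ((u * u) ^ (2 * q - 2) * c)"
    using power_add_U by blast
  have p3: "U * ((u * u) ^ (2 * q - 2) * c) \<approx> 0"
  proof -
    have "(u * u) ^ (2 * q - 2) = u ^ (4 * q - 4)"
      unfolding power2_eq_square[symmetric] power_mult[symmetric] by (simp add: algebra_simps)
    moreover have "u ^ (4 * q - 4) * U * c \<approx> 0 * c"
      by (intro eqM_mult u_power_U[where j = 0] eqM_refl) simp
    ultimately show ?thesis by (simp add: mult_ac)
  qed
  have p4: "(u * u) ^ Suc (2 * q - 2) = e"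
  proof -
    have "2 * Suc (2 * q - 2) = 4 * q - 2" using r_pos q by simp
    then show ?thesis unfolding e_def power2_eq_square[symmetric] power_mult[symmetric] by simp
  qed
  have "X ^ (2 * q - 1) * t ^ (2 * q - 1) \<approx> e"
    using eqM_trans[OF p1 eqM_trans[OF p2 eqM_add_zero[OF p3]]] unfolding p4
    by (simp only: power_mult_distrib)
  then have "X ^ (2 * q + 1) * (X ^ (2 * q - 1) * t ^ (2 * q - 1)) \<approx> X ^ (2 * q + 1) * e"
    by (rule eqM_mult[OF eqM_refl])
  also have "X ^ (2 * q + 1) * e = (1 + U) * (X * e)"
    unfolding X_pow_2q_1 by (simp add: mult_ac)
  also have "\<dots> \<approx> X * e" by (rule one_plus_U_e)
  also have "X ^ (2 * q + 1) * (X ^ (2 * q - 1) * t ^ (2 * q - 1)) = X ^ (4 * q) * t ^ (2 * q - 1)"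
  proof -
    have "2 * q + 1 + (2 * q - 1) = 4 * q" using q_pos by simp
    then show ?thesis unfolding mult.assoc[symmetric] power_add[symmetric] by (simp only:)
  qed
  finally have "X ^ (4 * q) * t ^ (2 * q - 1) \<approx> X * e" .
  then show ?thesis by (rule eqM_cancel_X_pow)
qed

text \<open>\<open>e * e\<close> and \<open>U * e\<close> vanish, and \<open>X * u * e\<close> is
  \<open>u * e\<close> since \<open>u ^ 2 * e = M\<close>.\<close>

lemma v_t_power: "v * t ^ (2 * q - 1) \<approx> u * e"
proof -
  have "v * t ^ (2 * q - 1) \<approx> v * (X * e)" by (intro eqM_mult t_power eqM_refl)
  also have "v * (X * e) = ((1 + U) * u + X * e) * X * e" by (simp add: v_def X_pow_2q mult.assoc)
  also have "\<dots> \<approx> u * e"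
    by (rule eqM_I[where c = "1 + u*u*u*A + u*u*u*u*A + u*u*u*u*A*A + u*u*u*u*u*u*A*A"])
      (simp add: M_eq e_eq X_eq, simp add: U_eq algebra_simps)
  finally show ?thesis .
qed

section \<open>The square of Y, and the first-order terms of its two components\<close>

lemma X_mult_X_power: "X * X ^ (4 * q - 1) \<approx> 1"
  using X_pow_4q_cong r_pos q by (simp flip: power_Suc)

text \<open>With \<open>Y = a + h b\<close>, this is the component of \<open>Y * Y\<close> without
  h; \<open>Y_square_2\<close> gives the one with h. As \<open>\<sigma> e\<close> is
  \<open>e\<close>, both being \<open>e\<close> makes the square \<open>e * (1 + h)\<close>.\<close>

lemma Y_square_1: "a * a + \<sigma> b * b \<approx> e"
proof -
  let ?y = "X ^ (4 * q - 1)"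
  have "\<sigma> b * b \<approx> (s' + X ^ (2 * q + 1)) * b" by (intro eqM_mult \<sigma>_b eqM_refl)
  \<comment> \<open>\<open>?y\<close> acts as the inverse of \<open>X\<close>. Instead of being
    expanded it is paired with a factor \<open>X\<close>, so that only an identity in
    \<open>u\<close> and \<open>A\<close> is left.\<close>
  also have "(s' + X ^ (2 * q + 1)) * b =
      (s' + X * (1 + U)) * s + ((X * X + 1 + U) * A + (1 + U)) * (X * ?y)"
    unfolding X_pow_2q_1 b_def s'_def by (simp add: algebra_simps)
  also have "\<dots> \<approx> (s' + X * (1 + U)) * s + ((X * X + 1 + U) * A + (1 + U)) * 1"
    by (intro eqM_add eqM_mult X_mult_X_power eqM_refl)
  finally have "a * a + \<sigma> b * b \<approx> a * a + ((s' + X * (1 + U)) * s + ((X * X + 1 + U) * A + (1 + U)) * 1)"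
    by (intro eqM_add eqM_refl)
  also have "\<dots> \<approx> e"
    by (rule eqM_I[where c = "1 + u*u*A + u*u*A*A + u*u*u*u*A + u*u*u*u*u*u*A*A"])
      (simp add: M_eq e_eq a_eq s_eq s'_def X_eq, simp add: U_eq algebra_simps)
  finally show ?thesis .
qed

text \<open>Since \<open>a\<close> and \<open>\<sigma> a\<close> differ by
  \<open>s + s' = X * e\<close>, the component is \<open>X * e * b\<close>. The part with
  \<open>s\<close> vanishes, as \<open>s\<close> is a multiple of \<open>u ^ 2\<close>, and
  \<open>X ^ (4 * q - 1)\<close> cancels the \<open>X\<close>.\<close>

lemma Y_square_2: "\<sigma> a * b + b * a \<approx> e"
proof -
  let ?y = "X ^ (4 * q - 1)"
  have "\<sigma> a \<approx> s' + X ^ (2 * q)"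
    unfolding a_def \<sigma>_add by (intro eqM_add \<sigma>_s \<sigma>_X_2q)
  then have "\<sigma> a * b + b * a \<approx> (s' + X ^ (2 * q)) * b + b * a"
    by (intro eqM_add eqM_mult eqM_refl)
  also have "(s' + X ^ (2 * q)) * b + b * a = (s + s') * b"
    by (simp add: a_def algebra_simps)
  also have "\<dots> = s * X * e + (X * ?y) * e"
    unfolding s_add_s' b_def by (simp add: algebra_simps)
  also have "\<dots> \<approx> 0 + 1 * e"
  proof (intro eqM_add eqM_mult X_mult_X_power eqM_refl)
    show "s * X * e \<approx> 0"
      by (rule eqM_I[where c = "A + u*u*A + u*u*A*A + u*u*u*u*u*u*A*A"])
        (simp add: M_eq e_eq s_eq X_eq, simp add: U_eq algebra_simps)
  qed
  finally show ?thesis by simp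
qed

lemma a_plus_1: "\<exists>c. a + 1 = u ^ 2 * c"
  by (rule exI[of _ "X * A + X * X * X * u * u * A * A + u * u * A"])
    (simp add: a_def X_pow_2q s_eq, simp add: U_eq power2_eq_square algebra_simps)

text \<open>As \<open>X ^ (4 * q - 1)\<close> inverts \<open>X\<close>, adding 1 to it gives
  \<open>u\<close> times a unit congruent to 1 modulo \<open>u\<close>, and \<open>s\<close> is a
  multiple of \<open>u ^ 2\<close>. With \<open>a_plus_1\<close> this makes hY + X equal to
  \<open>u\<close> to first order.\<close>

lemma b_plus_1: "\<exists>c. b + 1 \<approx> u + u ^ 2 * c"
proof -
  obtain d where "1 + X ^ (4 * q - 1) = u * d"
    unfolding u_def by (metis geometric_sum)
  then have d: "X ^ (4 * q - 1) + 1 = u * d" by (simp add: add.commute)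
  have "X ^ (4 * q - 1) + 1 \<approx> X ^ (4 * q - 1) + X * X ^ (4 * q - 1)"
    by (intro eqM_add eqM_refl eqM_sym[OF X_mult_X_power])
  also have "X ^ (4 * q - 1) + X * X ^ (4 * q - 1) = u + u * (X ^ (4 * q - 1) + 1)"
    by (simp add: u_def algebra_simps)
  finally have "X ^ (4 * q - 1) + 1 \<approx> u + u * (u * d)" by (simp only: d)
  then have "s + (X ^ (4 * q - 1) + 1) \<approx> s + (u + u * (u * d))"
    by (rule eqM_add[OF eqM_refl])
  moreover have "s + (u + u * (u * d)) = u + u ^ 2 * (X * A + X * X * X * u * u * A * A + d)"
    by (simp add: s_eq) (simp add: U_eq power2_eq_square algebra_simps)
  ultimately show ?thesis unfolding b_def by (metis add.assoc)
qed

end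

lemma (in sd_poly) s_eq_sum:
  "s = (\<Sum>i\<in>{0..q div 2 - 1}. X ^ (4 * i + 1)) + (\<Sum>i\<in>{q div 2 + 1..q}. X ^ (4 * i - 1))"
proof -
  have "{0..q div 2 - 1} = {..<r}" using r_pos q by auto
  then have 1: "(\<Sum>i\<in>{0..q div 2 - 1}. X ^ (4 * i + 1)) = X * (\<Sum>i<r. X ^ (4 * i))"
    by (simp add: sum_distrib_left)
  have "(\<Sum>i\<in>{q div 2 + 1..q}. X ^ (4 * i - 1)) = (\<Sum>i<r. X ^ (2 * q + 3 + 4 * i))"
  proof (rule sum.reindex_bij_witness[where i = "\<lambda>i. i + r + 1" and j = "\<lambda>i. i - r - 1"])
    fix i assume i: "i \<in> {q div 2 + 1..q}"
    then have "2 * q + 3 + 4 * (i - r - 1) = 4 * i - 1" using q by auto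
    then show "X ^ (2 * q + 3 + 4 * (i - r - 1)) = X ^ (4 * i - 1)" by (simp only:)
  qed (use q in auto)
  then have 2: "(\<Sum>i\<in>{q div 2 + 1..q}. X ^ (4 * i - 1)) = X ^ (2 * q + 3) * (\<Sum>i<r. X ^ (4 * i))"
    by (simp only: power_add sum_distrib_left)
  show ?thesis unfolding 1 2 s_def by (rule distrib_right)
qed

section \<open>The relations in the group algebra\<close>

locale bit_poly_eval = ring R for R (structure) +
  fixes g :: 'a
  assumes g_closed [simp]: "g \<in> carrier R" and one_add_one_eq: "\<one> \<oplus> \<one> = \<zero>"
begin

definition of_bit :: "bit \<Rightarrow> 'a" where "of_bit b = (if b = 0 then \<zero> else \<one>)"

text \<open>Horner evaluation at \<open>g\<close>. Its image is commutative although the ring need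
  not be, so polynomial congruences transfer.\<close>

definition \<Gamma> :: "bit poly \<Rightarrow> 'a" where
  "\<Gamma> p = fold_coeffs (\<lambda>b z. of_bit b \<oplus> g \<otimes> z) p \<zero>"

lemma of_bit_closed [simp]: "of_bit b \<in> carrier R"
  by (simp add: of_bit_def)

lemma add_self [simp]: "z \<in> carrier R \<Longrightarrow> z \<oplus> z = \<zero>"
  using one_add_one_eq l_distr[of \<one> \<one> z] by simp

lemma add_self_left [simp]: "z \<in> carrier R \<Longrightarrow> w \<in> carrier R \<Longrightarrow> z \<oplus> (z \<oplus> w) = w"
  by (simp flip: a_assoc)

lemma \<Gamma>_0 [simp]: "\<Gamma> 0 = \<zero>"
  by (simp add: \<Gamma>_def)

lemma \<Gamma>_pCons: "\<Gamma> (pCons b p) = of_bit b \<oplus> g \<otimes> \<Gamma> p"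
proof (cases "b = 0 \<and> p = 0")
  case True
  then show ?thesis by (simp add: of_bit_def)
next
  case False
  then show ?thesis
    by (cases "p = 0") (simp_all add: \<Gamma>_def)
qed

lemma \<Gamma>_closed [simp]: "\<Gamma> p \<in> carrier R"
  by (induction p) (simp_all add: \<Gamma>_pCons)

lemma of_bit_add: "of_bit (b + c) = of_bit b \<oplus> of_bit c"
  by (cases b; cases c) (simp_all add: of_bit_def)

lemma \<Gamma>_add: "\<Gamma> (p + p') = \<Gamma> p \<oplus> \<Gamma> p'"
proof (induction p arbitrary: p')
  case (pCons b p)
  obtain c p'' where p': "p' = pCons c p''" by (cases p')
  show ?case
    unfolding p' add_pCons \<Gamma>_pCons of_bit_add pCons.IH by (simp add: r_distr a_ac)
qed simp

lemma \<Gamma>_smult: "\<Gamma> (Polynomial.smult b p) = of_bit b \<otimes> \<Gamma> p"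
  by (cases b) (simp_all add: of_bit_def)

lemma \<Gamma>_mult: "\<Gamma> (p * p') = \<Gamma> p \<otimes> \<Gamma> p'"
proof (induction p)
  case (pCons b p)
  have "of_bit 0 = \<zero>" by (simp add: of_bit_def)
  then show ?case
    by (simp add: mult_pCons_left \<Gamma>_add \<Gamma>_smult \<Gamma>_pCons pCons.IH l_distr m_assoc)
qed simp

lemma \<Gamma>_1 [simp]: "\<Gamma> 1 = \<one>"
  by (simp add: one_pCons \<Gamma>_pCons of_bit_def)

lemma \<Gamma>_power: "\<Gamma> (p ^ n) = \<Gamma> p [^] n"
  by (induction n) (simp_all add: \<Gamma>_mult power_commutes[symmetric] power_Suc2 del: power_Suc)

lemma \<Gamma>_comm: "\<Gamma> p \<otimes> \<Gamma> p' = \<Gamma> p' \<otimes> \<Gamma> p"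
  by (simp add: mult.commute flip: \<Gamma>_mult)

lemma \<Gamma>_sum: "finite S \<Longrightarrow> \<Gamma> (\<Sum>i\<in>S. f i) = (\<Oplus>i\<in>S. \<Gamma> (f i))"
  by (induction S rule: finite_induct) (simp_all add: \<Gamma>_add Pi_def)

end

text \<open>Any ring with 1 + 1 = 0 and elements obeying the relations of SD; the distinctness of
  group elements enters only with \<open>socle_neq_zero\<close>.\<close>

locale sd_ring = bit_poly_eval R g + P: sd_poly q r k for R (structure) and g q r k +
  fixes h :: 'a
  assumes h_closed [simp]: "h \<in> carrier R" and h_square: "h \<otimes> h = \<one>"
    and g_power: "g [^] (4 * q) = \<one>" and h_g: "h \<otimes> g = g [^] (2 * q - 1) \<otimes> h"
begin

lemma \<Gamma>_X [simp]: "\<Gamma> P.X = g"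
  by (simp add: P.X_def \<Gamma>_pCons of_bit_def)

lemma \<Gamma>_M: "\<Gamma> P.M = \<zero>"
proof -
  have "\<Gamma> (1 + P.M) = \<one>" unfolding P.X_pow_4q[symmetric] by (simp add: \<Gamma>_power g_power)
  then have "\<one> \<oplus> (\<one> \<oplus> \<Gamma> P.M) = \<one> \<oplus> \<one>" by (simp only: \<Gamma>_add \<Gamma>_1)
  then show ?thesis by simp
qed

lemma \<Gamma>_cong: "P.eqM p p' \<Longrightarrow> \<Gamma> p = \<Gamma> p'"
  by (elim P.eqM_E) (simp add: \<Gamma>_add \<Gamma>_mult \<Gamma>_M)

lemma h_\<Gamma>: "h \<otimes> \<Gamma> p = \<Gamma> (P.\<sigma> p) \<otimes> h"
proof (induction p)
  case (pCons b p)
  have b: "h \<otimes> of_bit b = of_bit b \<otimes> h" by (simp add: of_bit_def)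
  have "P.\<sigma> (pCons b p) = [:b:] + P.X ^ (2 * q - 1) * P.\<sigma> p"
    by (simp add: P.\<sigma>_def pcompose_pCons)
  then have "\<Gamma> (P.\<sigma> (pCons b p)) = of_bit b \<oplus> g [^] (2 * q - 1) \<otimes> \<Gamma> (P.\<sigma> p)"
    by (simp add: \<Gamma>_add \<Gamma>_mult \<Gamma>_power \<Gamma>_pCons)
  moreover have "h \<otimes> (g \<otimes> \<Gamma> p) = g [^] (2 * q - 1) \<otimes> (\<Gamma> (P.\<sigma> p) \<otimes> h)"
  proof -
    have "h \<otimes> (g \<otimes> \<Gamma> p) = (h \<otimes> g) \<otimes> \<Gamma> p" by (simp add: m_assoc)
    also have "\<dots> = g [^] (2 * q - 1) \<otimes> (h \<otimes> \<Gamma> p)" by (simp only: h_g) (simp add: m_assoc)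
    finally show ?thesis by (simp only: pCons.IH)
  qed
  ultimately show ?case by (simp add: \<Gamma>_pCons r_distr l_distr b m_assoc)
qed (simp add: P.\<sigma>_def)

lemma \<Gamma>_h: "\<Gamma> p \<otimes> h = h \<otimes> \<Gamma> (P.\<sigma> p)"
proof -
  have "\<Gamma> p \<otimes> h = (h \<otimes> h) \<otimes> (\<Gamma> p \<otimes> h)" by (simp add: h_square)
  also have "\<dots> = h \<otimes> (h \<otimes> \<Gamma> p) \<otimes> h" by (simp add: m_assoc)
  also have "\<dots> = h \<otimes> \<Gamma> (P.\<sigma> p) \<otimes> (h \<otimes> h)" by (simp only: h_\<Gamma>[of p]) (simp add: m_assoc)
  finally show ?thesis by (simp add: h_square)
qed

text \<open>Normal form for the subring generated by \<open>g\<close> and \<open>h\<close>, with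
  \<open>h\<close> moved to the left. It is not unique, as \<open>\<Gamma>\<close> has a kernel;
  hence \<open>pair_cong\<close>.\<close>

definition pair where "pair p p' = \<Gamma> p \<oplus> h \<otimes> \<Gamma> p'"

lemma pair_closed [simp]: "pair p p' \<in> carrier R"
  by (simp add: pair_def)

lemma pair_add: "pair a b \<oplus> pair c d = pair (a + c) (b + d)"
  by (simp add: pair_def \<Gamma>_add r_distr a_ac)

lemma pair_mult: "pair a b \<otimes> pair c d = pair (a * c + P.\<sigma> b * d) (P.\<sigma> a * d + b * c)"
proof -
  have 1: "\<Gamma> a \<otimes> (h \<otimes> \<Gamma> d) = h \<otimes> \<Gamma> (P.\<sigma> a * d)"
    by (simp add: \<Gamma>_mult \<Gamma>_h flip: m_assoc)
  have "h \<otimes> \<Gamma> b \<otimes> (h \<otimes> \<Gamma> d) = h \<otimes> (\<Gamma> b \<otimes> h) \<otimes> \<Gamma> d" by (simp add: m_assoc)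
  also have "\<dots> = (h \<otimes> h) \<otimes> \<Gamma> (P.\<sigma> b * d)" by (simp only: \<Gamma>_h) (simp add: m_assoc \<Gamma>_mult)
  also have "\<dots> = \<Gamma> (P.\<sigma> b * d)" by (simp add: h_square)
  finally have 2: "h \<otimes> \<Gamma> b \<otimes> (h \<otimes> \<Gamma> d) = \<Gamma> (P.\<sigma> b * d)" .
  have 3: "h \<otimes> \<Gamma> b \<otimes> \<Gamma> c = h \<otimes> \<Gamma> (b * c)" by (simp add: m_assoc \<Gamma>_mult)
  show ?thesis
    by (simp add: pair_def l_distr r_distr 1 2 3 \<Gamma>_add) (simp add: \<Gamma>_mult a_ac)
qed

lemma pair_cong: "P.eqM a c \<Longrightarrow> P.eqM b d \<Longrightarrow> pair a b = pair c d"
  by (simp add: pair_def \<Gamma>_cong)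

section \<open>The relations between x and y\<close>

definition x where "x = \<one> \<oplus> h"

definition y where "y = x \<otimes> \<Gamma> P.s \<oplus> g [^] (2 * q) \<oplus> h \<otimes> g [^] (4 * q - 1)"

lemma x_closed [simp]: "x \<in> carrier R" by (simp add: x_def)

lemma y_closed [simp]: "y \<in> carrier R" by (simp add: y_def)

lemma x_pair: "x = pair 1 1" by (simp add: x_def pair_def)

lemma y_pair: "y = pair P.a P.b"
proof -
  have "y = (\<Gamma> P.s \<oplus> h \<otimes> \<Gamma> P.s) \<oplus> \<Gamma> (P.X ^ (2 * q)) \<oplus> h \<otimes> \<Gamma> (P.X ^ (4 * q - 1))"
    by (simp add: y_def x_def l_distr \<Gamma>_power)
  also have "\<dots> = pair P.a P.b"
    by (simp add: pair_def P.a_def P.b_def \<Gamma>_add r_distr a_ac)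
  finally show ?thesis .
qed

lemma x_square: "x \<otimes> x = \<zero>"
  by (simp add: x_pair pair_mult P.\<sigma>_1) (simp add: pair_def)

lemma \<Gamma>_mult_x: "\<Gamma> p \<otimes> x = pair p (P.\<sigma> p)"
  by (simp add: x_def r_distr \<Gamma>_h pair_def)

text \<open>\<open>h \<otimes> x = x\<close>, so \<open>h\<close> is absorbed once it has been moved
  past \<open>\<Gamma> b\<close>.\<close>

lemma pair_mult_x: "pair a b \<otimes> x = \<Gamma> (a + P.\<sigma> b) \<otimes> x"
proof -
  have 1: "h \<otimes> \<Gamma> b \<otimes> h = \<Gamma> (P.\<sigma> b)"
  proof -
    have "h \<otimes> \<Gamma> b \<otimes> h = \<Gamma> (P.\<sigma> b) \<otimes> (h \<otimes> h)" by (simp only: h_\<Gamma>) (simp add: m_assoc)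
    then show ?thesis by (simp add: h_square)
  qed
  have "pair a b \<otimes> x = \<Gamma> a \<oplus> h \<otimes> \<Gamma> b \<oplus> (\<Gamma> a \<otimes> h \<oplus> h \<otimes> \<Gamma> b \<otimes> h)"
    by (simp add: pair_def x_def r_distr l_distr)
  also have "\<dots> = \<Gamma> (a + P.\<sigma> b) \<otimes> x"
    unfolding 1 by (simp add: h_\<Gamma> \<Gamma>_add x_def r_distr l_distr a_ac)
  finally show ?thesis .
qed

lemma x_\<Gamma>_x: "x \<otimes> \<Gamma> p \<otimes> x = \<Gamma> (p + P.\<sigma> p) \<otimes> x"
proof -
  have "x \<otimes> \<Gamma> p = pair p p" by (simp add: x_def l_distr pair_def)
  then show ?thesis by (simp add: pair_mult_x)
qed

lemma y_x: "y \<otimes> x = \<Gamma> P.v \<otimes> x"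
  by (simp only: y_pair pair_mult_x \<Gamma>_cong[OF P.trace_a_b])

lemma \<Gamma>_x_y_x: "\<Gamma> p \<otimes> x \<otimes> (y \<otimes> x) = \<Gamma> (p * P.t) \<otimes> x"
proof -
  have "\<Gamma> p \<otimes> x \<otimes> (y \<otimes> x) = \<Gamma> p \<otimes> (x \<otimes> \<Gamma> P.v \<otimes> x)" by (simp add: y_x m_assoc)
  also have "\<dots> = \<Gamma> p \<otimes> (\<Gamma> P.t \<otimes> x)" by (simp only: x_\<Gamma>_x \<Gamma>_cong[OF P.trace_v])
  finally show ?thesis by (simp add: \<Gamma>_mult m_assoc)
qed

lemma x_y_x_power: "x \<otimes> (y \<otimes> x) [^] n = \<Gamma> (P.t ^ n) \<otimes> x"
proof (induction n)
  case (Suc n)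
  have "x \<otimes> (y \<otimes> x) [^] Suc n = x \<otimes> (y \<otimes> x) [^] n \<otimes> (y \<otimes> x)" by (simp add: m_assoc)
  also have "\<dots> = \<Gamma> (P.t ^ Suc n) \<otimes> x"
    unfolding Suc.IH \<Gamma>_x_y_x by (simp add: mult.commute)
  finally show ?case .
qed simp

lemma y_x_power: "(y \<otimes> x) [^] Suc n = \<Gamma> (P.v * P.t ^ n) \<otimes> x"
proof (induction n)
  case 0
  show ?case by (simp add: y_x)
next
  case (Suc n)
  have "(y \<otimes> x) [^] Suc (Suc n) = (y \<otimes> x) [^] Suc n \<otimes> (y \<otimes> x)" by simp
  also have "\<dots> = \<Gamma> (P.v * P.t ^ Suc n) \<otimes> x"
    unfolding Suc.IH \<Gamma>_x_y_x by (simp add: mult_ac)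
  finally show ?case .
qed

lemma y_x_power_2q: "(y \<otimes> x) [^] (2 * q) = \<Gamma> (P.u * P.e) \<otimes> x"
proof -
  have n: "2 * q = Suc (2 * q - 1)" using P.q_pos by simp
  show ?thesis
    by (subst n) (simp only: y_x_power \<Gamma>_cong[OF P.v_t_power])
qed

lemma y_x_power_2q_eq_sum: "(y \<otimes> x) [^] (2 * q) = (\<Oplus>i\<in>{..<4 * q}. g [^] i) \<otimes> x"
  by (simp add: y_x_power_2q P.norm_eq_sum[symmetric] \<Gamma>_sum \<Gamma>_power)

theorem y_square: "y \<otimes> y = x \<otimes> (y \<otimes> x) [^] (2 * q - 1) \<oplus> (y \<otimes> x) [^] (2 * q)"
proof -
  have "y \<otimes> y = pair P.e P.e"
    unfolding y_pair pair_mult by (rule pair_cong[OF P.Y_square_1 P.Y_square_2])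
  also have "\<dots> = \<Gamma> P.e \<otimes> x"
    unfolding \<Gamma>_mult_x by (rule pair_cong[OF P.eqM_refl P.eqM_sym[OF P.\<sigma>_e]])
  \<comment> \<open>Splitting by \<open>1 = X + u\<close> separates the two terms of the
    relation.\<close>
  also have "P.e = P.X * P.e + P.u * P.e" by (simp add: P.u_def algebra_simps)
  also have "\<Gamma> (P.X * P.e + P.u * P.e) \<otimes> x = \<Gamma> (P.X * P.e) \<otimes> x \<oplus> \<Gamma> (P.u * P.e) \<otimes> x"
    by (simp add: \<Gamma>_add l_distr)
  also have "\<dots> = x \<otimes> (y \<otimes> x) [^] (2 * q - 1) \<oplus> (y \<otimes> x) [^] (2 * q)"
    by (simp only: x_y_x_power y_x_power_2q \<Gamma>_cong[OF P.t_power])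
  finally show ?thesis .
qed

text \<open>\<open>J n\<close> is the two-sided ideal generated by \<open>(1 + g)\<^sup>n\<close>.\<close>

definition J where "J n = {pair (P.u ^ n * c) (P.u ^ n * d) |c d. True}"

lemma J_closed: "z \<in> J n \<Longrightarrow> z \<in> carrier R"
  by (auto simp: J_def)

lemma J_add: "z \<in> J n \<Longrightarrow> w \<in> J n \<Longrightarrow> z \<oplus> w \<in> J n"
  by (auto simp: J_def pair_add simp flip: distrib_left) blast

lemma J_mult:
  assumes "z \<in> J m" "w \<in> J n"
  shows "z \<otimes> w \<in> J (m + n)"
proof -
  obtain a b where z: "z = pair (P.u ^ m * a) (P.u ^ m * b)" using assms(1) by (auto simp: J_def)
  obtain c d where w: "w = pair (P.u ^ n * c) (P.u ^ n * d)" using assms(2) by (auto simp: J_def)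
  obtain a' where a': "P.\<sigma> (P.u ^ m * a) = P.u ^ m * a'" using P.dvd_\<sigma>_u_power by (metis dvdE)
  obtain b' where b': "P.\<sigma> (P.u ^ m * b) = P.u ^ m * b'" using P.dvd_\<sigma>_u_power by (metis dvdE)
  have "z \<otimes> w = pair (P.u ^ (m + n) * (a * c + b' * d)) (P.u ^ (m + n) * (a' * d + b * c))"
    unfolding z w pair_mult a' b' by (simp add: power_add algebra_simps)
  then show ?thesis by (auto simp: J_def)
qed

lemma J_mono: "m \<le> n \<Longrightarrow> z \<in> J n \<Longrightarrow> z \<in> J m"
proof -
  assume "m \<le> n" and z: "z \<in> J n"
  then obtain i where "n = m + i" by (metis le_Suc_ex)
  then show "z \<in> J m" using z by (auto simp: J_def power_add mult.assoc)
qed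

lemma \<Gamma>_u_power_in_J: "\<Gamma> (P.u ^ n) \<in> J n"
proof -
  have "\<Gamma> (P.u ^ n) = pair (P.u ^ n * 1) (P.u ^ n * 0)" by (simp add: pair_def)
  then show ?thesis unfolding J_def by blast
qed

text \<open>Left multiplication by \<open>h\<close> exchanges the coordinates of \<open>y\<close>,
  and \<open>x\<close> adds 1 to both; the coordinate without \<open>h\<close> is then
  \<open>b + 1\<close>, the one with linear term \<open>u\<close>.\<close>

lemma approx_u: obtains j where "j \<in> J 2" "h \<otimes> y \<oplus> x = \<Gamma> P.u \<oplus> j"
proof -
  obtain c where c: "P.a + 1 = P.u ^ 2 * c" using P.a_plus_1 by blast
  obtain d where d: "P.eqM (P.b + 1) (P.u + P.u ^ 2 * d)" using P.b_plus_1 by blast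
  have "h \<otimes> y = pair P.b P.a"
    by (simp add: y_pair pair_def r_distr h_square a_comm flip: m_assoc)
  then have "h \<otimes> y \<oplus> x = pair (P.b + 1) (P.a + 1)" by (simp add: x_pair pair_add)
  also have "\<dots> = pair (P.u + P.u ^ 2 * d) (P.u ^ 2 * c)"
    unfolding c by (rule pair_cong[OF d P.eqM_refl])
  also have "\<dots> = \<Gamma> P.u \<oplus> pair (P.u ^ 2 * d) (P.u ^ 2 * c)"
    by (simp add: pair_def \<Gamma>_add a_assoc)
  finally show ?thesis using that[of "pair (P.u ^ 2 * d) (P.u ^ 2 * c)"] by (auto simp: J_def)
qed

text \<open>Powers of \<open>\<beta>\<close> approximate powers of \<open>u\<close> with an error
  one step deeper in the chain \<open>J\<close>, so \<open>J n\<close> falls into \<open>B\<close>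
  by descending induction from \<open>J (4 * q) = 0\<close>. Scalars do not appear, since those of
  GF(2) are 0 and 1.\<close>

theorem generated:
  assumes B: "x \<in> B" "y \<in> B" "\<one> \<in> B" "\<And>z w. z \<in> B \<Longrightarrow> w \<in> B \<Longrightarrow> z \<oplus> w \<in> B"
    "\<And>z w. z \<in> B \<Longrightarrow> w \<in> B \<Longrightarrow> z \<otimes> w \<in> B"
  shows "g \<in> B" "h \<in> B"
proof -
  have "h = \<one> \<oplus> x" by (simp add: x_def)
  then show h: "h \<in> B" using B by metis
  have "\<zero> = \<one> \<oplus> \<one>" by simp
  then have zero: "\<zero> \<in> B" using B by metis
  obtain j where j: "j \<in> J 2" and \<beta>: "h \<otimes> y \<oplus> x = \<Gamma> P.u \<oplus> j" by (rule approx_u)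
  define \<beta> where "\<beta> = h \<otimes> y \<oplus> x"
  have \<beta>_closed: "\<beta> \<in> carrier R" by (simp add: \<beta>_def)
  have \<beta>_B: "\<beta> \<in> B" using h B by (simp add: \<beta>_def)
  then have \<beta>_power: "\<beta> [^] n \<in> B" for n :: nat using B by (induction n) auto
  \<comment> \<open>Multiplying the approximations of \<open>u ^ n\<close> and \<open>u\<close>
    leaves three errors, in \<open>J (n + 2)\<close>, \<open>J (n + 2)\<close> and
    \<open>J (n + 3)\<close>.\<close>
  have approx: "\<exists>j'\<in>J (Suc n). \<Gamma> (P.u ^ n) = \<beta> [^] n \<oplus> j'" for n
  proof (induction n)
    case 0
    have "pair 0 0 = \<zero>" by (simp add: pair_def)
    then have "\<zero> \<in> J (Suc 0)" unfolding J_def by (intro CollectI exI[of _ 0]) simp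
    then show ?case by (intro bexI[of _ \<zero>]) simp_all
  next
    case (Suc n)
    then obtain j' where j': "j' \<in> J (Suc n)" "\<Gamma> (P.u ^ n) = \<beta> [^] n \<oplus> j'" by blast
    have jc: "j \<in> carrier R" "j' \<in> carrier R" using j j' J_closed by blast+
    have \<beta>n: "\<beta> [^] n = \<Gamma> (P.u ^ n) \<oplus> j'"
      using j'(2) jc \<beta>_closed by (simp add: a_assoc)
    let ?j = "\<Gamma> (P.u ^ n) \<otimes> j \<oplus> (j' \<otimes> \<Gamma> P.u \<oplus> j' \<otimes> j)"
    have u: "\<Gamma> P.u \<in> J 1" using \<Gamma>_u_power_in_J[of 1] by simp
    have "\<beta> [^] Suc n = (\<Gamma> (P.u ^ n) \<oplus> j') \<otimes> (\<Gamma> P.u \<oplus> j)"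
      by (simp only: nat_pow_Suc \<beta>n) (simp only: \<beta>_def \<beta>)
    also have "\<dots> = \<Gamma> (P.u ^ Suc n) \<oplus> ?j"
      using jc by (simp add: l_distr r_distr \<Gamma>_mult \<Gamma>_comm[of P.u] a_ac)
    finally have "\<Gamma> (P.u ^ Suc n) = \<beta> [^] Suc n \<oplus> ?j"
      using jc by (simp add: a_assoc)
    moreover have "?j \<in> J (Suc (Suc n))"
    proof (intro J_add)
      show "\<Gamma> (P.u ^ n) \<otimes> j \<in> J (Suc (Suc n))" using J_mult[OF \<Gamma>_u_power_in_J j] by simp
      show "j' \<otimes> \<Gamma> P.u \<in> J (Suc (Suc n))" using J_mult[OF j'(1) u] by simp
      show "j' \<otimes> j \<in> J (Suc (Suc n))"
        using J_mult[OF j'(1) j] J_mono[of "Suc (Suc n)" "Suc n + 2"] by simp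
    qed
    ultimately show ?case by blast
  qed
  have J_B: "J n \<subseteq> B" if "n \<le> 4 * q" for n
    using that
  proof (induction n rule: inc_induct)
    case base
    have "pair (P.u ^ (4 * q) * c) (P.u ^ (4 * q) * d) = \<zero>" for c d
      by (simp add: pair_def \<Gamma>_mult \<Gamma>_M flip: P.M_def)
    then show ?case using zero by (auto simp: J_def)
  next
    case (step n)
    have u: "\<Gamma> (P.u ^ n) \<in> B" using approx[of n] step.IH \<beta>_power B by auto
    have "\<Gamma> (P.u ^ n * c) \<in> B" for c
    proof -
      \<comment> \<open>Division by \<open>u\<close> with remainder. The remainder is 0 or 1, so up
        to the next ideal \<open>u ^ n * c\<close> is 0 or \<open>u ^ n\<close>.\<close>
      have "\<exists>b c'. c = [:b:] + P.u * c'"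
      proof (induction c)
        case 0
        show ?case by (intro exI[of _ 0]) simp
      next
        case (pCons a c)
        then obtain b c' where "c = [:b:] + P.u * c'" by blast
        moreover have "pCons a c = [:a:] + P.X * c" by (simp add: P.X_def)
        moreover have "p + P.X * (p' + P.u * c') = (p + p') + P.u * (p' + P.X * c')" for p p'
          by (simp add: P.X_eq algebra_simps)
        ultimately have "pCons a c = ([:a:] + [:b:]) + P.u * ([:b:] + P.X * c')"
          by (simp only:)
        moreover have "[:a:] + [:b:] = [:a + b:]" by simp
        ultimately have "pCons a c = [:a + b:] + P.u * ([:b:] + P.X * c')"
          by (simp only:)
        then show ?case by blast
      qed
      then obtain b c' where c: "c = [:b:] + P.u * c'" by blast
      have "\<Gamma> (P.u ^ Suc n * c') = pair (P.u ^ Suc n * c') (P.u ^ Suc n * 0)" by (simp add: pair_def)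
      then have c'_B: "\<Gamma> (P.u ^ Suc n * c') \<in> B" using step.IH unfolding J_def by blast
      have "\<Gamma> (P.u ^ n * c) = \<Gamma> (P.u ^ n * [:b:]) \<oplus> \<Gamma> (P.u ^ Suc n * c')"
        unfolding c by (simp add: algebra_simps flip: \<Gamma>_add)
      moreover have "\<Gamma> (P.u ^ n * [:b:]) \<in> B"
        using u zero by (cases b) (simp_all flip: one_pCons)
      ultimately show ?thesis using c'_B B by simp
    qed
    then show ?case using h B by (auto simp: J_def pair_def)
  qed
  have "g = pair (P.u ^ 0 * P.X) (P.u ^ 0 * 0)" by (simp add: pair_def)
  then show "g \<in> B" using J_B[of 0] unfolding J_def by blast
qed

end

section \<open>The algebra defined by the relations\<close>

lemma (in ring) minus_eq_zero_iff:
  "a \<in> carrier R \<Longrightarrow> b \<in> carrier R \<Longrightarrow> a \<ominus> b = \<zero> \<longleftrightarrow> a = b"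
  by (metis a_minus_def add.inv_closed minus_equality r_neg minus_minus)

text \<open>\<open>N\<close> plays the part of 2q; the bound \<open>2 \<le> N\<close> keeps the
  words in \<open>y \<otimes> y\<close> longer than 2, as \<open>separating_words\<close>
  requires.\<close>

locale xy_ring = ring R for R (structure) +
  fixes x y :: 'a and N :: nat
  assumes x_closed [simp]: "x \<in> carrier R" and y_closed [simp]: "y \<in> carrier R"
    and N: "2 \<le> N"
    and x_square: "x \<otimes> x = \<zero>"
    and y_square: "y \<otimes> y = x \<otimes> (y \<otimes> x) [^] (N - 1) \<oplus> (y \<otimes> x) [^] N"
begin

fun xs ys :: "nat \<Rightarrow> 'a" where
  "xs 0 = \<one>"
| "xs (Suc n) = x \<otimes> ys n"
| "ys 0 = \<one>"
| "ys (Suc n) = y \<otimes> xs n"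

lemma xs_ys_closed [simp]: "xs n \<in> carrier R" "ys n \<in> carrier R"
  by (induction n) auto

abbreviation V where "V \<equiv> (y \<otimes> x) [^] N"

lemma V_closed: "V \<in> carrier R" by simp

lemma ys_even: "ys (2 * m) = (y \<otimes> x) [^] m"
proof (induction m)
  case (Suc m)
  have "ys (2 * Suc m) = (y \<otimes> x) \<otimes> ys (2 * m)" by (simp add: m_assoc)
  also have "\<dots> = (y \<otimes> x) [^] Suc m" by (simp only: Suc.IH) (rule nat_pow_Suc2[symmetric], simp)
  finally show ?case .
qed simp

lemma xs_odd: "xs (Suc (2 * m)) = x \<otimes> (y \<otimes> x) [^] m"
  by (simp add: ys_even)

lemma yx_pow_mult_x: "0 < m \<Longrightarrow> (y \<otimes> x) [^] m \<otimes> x = \<zero>" for m :: nat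
  by (cases m) (simp_all add: m_assoc x_square)

lemma y_square': "y \<otimes> y = xs (2 * N - 1) \<oplus> ys (2 * N)"
proof -
  have "2 * N - 1 = Suc (2 * (N - 1))" using N by simp
  then show ?thesis by (simp only: y_square xs_odd ys_even)
qed

text \<open>Both terms of \<open>y \<otimes> y\<close> end in \<open>x\<close>, so a further
  \<open>x\<close> produces \<open>x \<otimes> x\<close>.\<close>

lemma yyx: "y \<otimes> (y \<otimes> x) = \<zero>"
proof -
  have "y \<otimes> (y \<otimes> x) = (y \<otimes> y) \<otimes> x" by (simp add: m_assoc)
  also have "\<dots> = x \<otimes> ((y \<otimes> x) [^] (N - 1) \<otimes> x) \<oplus> V \<otimes> x"
    unfolding y_square by (simp add: l_distr m_assoc)
  also have "\<dots> = \<zero>" using N by (simp add: yx_pow_mult_x)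
  finally show ?thesis .
qed

lemma V_eq: "V = (y \<otimes> x) [^] (N - 1) \<otimes> (y \<otimes> x)" "V = (y \<otimes> x) \<otimes> (y \<otimes> x) [^] (N - 1)"
  using N nat_pow_Suc[of "y \<otimes> x" "N - 1"] nat_pow_Suc2[of "y \<otimes> x" "N - 1"] by simp_all

lemma V_fold: "(y \<otimes> x) [^] (N - Suc 0) \<otimes> (y \<otimes> x) = V" "(y \<otimes> x) \<otimes> (y \<otimes> x) [^] (N - Suc 0) = V"
  using V_eq by simp_all

lemma Vx: "V \<otimes> x = \<zero>" using N by (simp add: yx_pow_mult_x)

lemma yV: "y \<otimes> V = \<zero>"
proof -
  have "y \<otimes> V = (y \<otimes> (y \<otimes> x)) \<otimes> (y \<otimes> x) [^] (N - 1)"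
    unfolding V_eq(2) by (simp add: m_assoc)
  then show ?thesis by (simp add: yyx)
qed

lemma xy_pow: "x \<otimes> (y \<otimes> x) [^] m \<otimes> y = xs (2 * Suc m)" for m :: nat
proof -
  have "xs (2 * Suc m) = (x \<otimes> y) [^] Suc m"
  proof (induction m)
    case 0
    then show ?case by (simp add: numeral_2_eq_2)
  next
    case (Suc m)
    have "xs (2 * Suc (Suc m)) = (x \<otimes> y) \<otimes> xs (2 * Suc m)" by (simp add: m_assoc)
    also have "\<dots> = (x \<otimes> y) [^] Suc (Suc m)" by (simp only: Suc.IH) (rule nat_pow_Suc2[symmetric], simp)
    finally show ?case .
  qed
  moreover have "x \<otimes> (y \<otimes> x) [^] m \<otimes> y = (x \<otimes> y) [^] Suc m"
  proof (induction m)
    case (Suc m)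
    have "x \<otimes> (y \<otimes> x) [^] Suc m \<otimes> y = (x \<otimes> (y \<otimes> x) [^] m \<otimes> y) \<otimes> (x \<otimes> y)"
      by (simp add: m_assoc)
    also have "\<dots> = (x \<otimes> y) [^] Suc (Suc m)" by (simp only: Suc.IH nat_pow_Suc)
    finally show ?case .
  qed simp
  ultimately show ?thesis by simp
qed

text \<open>The two sides are the expansions of \<open>y \<otimes> y \<otimes> y\<close> by its
  first and by its last pair, the term \<open>y \<otimes> V\<close> being zero.\<close>

lemma xs_add_Vy: "xs (2 * N) \<oplus> V \<otimes> y = V"
proof -
  have "(y \<otimes> y) \<otimes> y = y \<otimes> (y \<otimes> y)" by (simp add: m_assoc)
  moreover have "(y \<otimes> y) \<otimes> y = x \<otimes> (y \<otimes> x) [^] (N - 1) \<otimes> y \<oplus> V \<otimes> y"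
    by (simp add: y_square l_distr)
  moreover have "y \<otimes> (y \<otimes> y) = (y \<otimes> x) \<otimes> (y \<otimes> x) [^] (N - 1) \<oplus> y \<otimes> V"
    by (simp add: y_square r_distr m_assoc)
  ultimately show ?thesis using xy_pow[of "N - 1"] N by (simp add: yV V_fold)
qed

lemma xxs: "x \<otimes> xs (Suc n) = \<zero>"
  by (simp add: x_square flip: m_assoc)

text \<open>Multiplying \<open>xs_add_Vy\<close> by \<open>x\<close> shows that
  \<open>x \<otimes> V\<close> is unchanged by \<open>y\<close> on the right, hence by
  \<open>y \<otimes> y\<close>. Expanding that square kills it, since \<open>V \<otimes> x\<close>
  and \<open>x \<otimes> V \<otimes> (y \<otimes> x)\<close> vanish.\<close>

lemma xV: "x \<otimes> V = \<zero>"
proof -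
  have W: "x \<otimes> xs (2 * N) = \<zero>" using xxs[of "2 * N - 1"] N by simp
  have "x \<otimes> V = x \<otimes> (xs (2 * N) \<oplus> V \<otimes> y)" by (simp only: xs_add_Vy)
  also have "\<dots> = x \<otimes> V \<otimes> y" by (simp add: r_distr W m_assoc)
  finally have 1: "x \<otimes> V = x \<otimes> V \<otimes> y" .
  have 2: "x \<otimes> V \<otimes> (y \<otimes> x) = \<zero>"
    using 1 Vx by (metis V_closed m_assoc r_null x_closed y_closed m_closed)
  have "x \<otimes> V = x \<otimes> V \<otimes> (y \<otimes> y)" 
  proof -
    have "x \<otimes> V \<otimes> (y \<otimes> y) = x \<otimes> V \<otimes> y \<otimes> y" by (simp add: m_assoc)
    then show ?thesis by (simp only: 1[symmetric])
  qed
  also have "\<dots> = x \<otimes> (V \<otimes> x) \<otimes> (y \<otimes> x) [^] (N - 1) \<oplus> (x \<otimes> V) \<otimes> V"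
    unfolding y_square by (simp add: r_distr m_assoc)
  also have "(x \<otimes> V) \<otimes> V = (x \<otimes> V \<otimes> (y \<otimes> x)) \<otimes> (y \<otimes> x) [^] (N - 1)"
    using V_eq(2) by (simp add: m_assoc)
  finally show ?thesis by (simp add: 2 Vx)
qed

text \<open>What is left to show is \<open>V \<otimes> y = 0\<close>. By \<open>xs_add_Vy\<close>
  times \<open>y\<close> it is \<open>xs (2 * N) \<otimes> y\<close> plus
  \<open>V \<otimes> y \<otimes> y\<close>, and both vanish when \<open>y \<otimes> y\<close> is
  expanded.\<close>

lemma xs_eq_V: "xs (2 * N) = V"
proof -
  let ?W = "x \<otimes> (y \<otimes> x) [^] (N - 1)"
  have W: "xs (2 * N) = ?W \<otimes> y" using xy_pow[of "N - 1"] N by simp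
  have Wx: "?W \<otimes> x = \<zero>" using N by (simp add: m_assoc yx_pow_mult_x)
  have WV: "?W \<otimes> V = \<zero>"
  proof -
    have "?W \<otimes> V = x \<otimes> ((y \<otimes> x) [^] (N - 1) \<otimes> (y \<otimes> x)) \<otimes> (y \<otimes> x) [^] (N - 1)"
      using V_eq(2) by (simp add: m_assoc)
    also have "\<dots> = \<zero>" by (simp add: xV V_fold)
    finally show ?thesis .
  qed
  have VV: "V \<otimes> V = \<zero>"
  proof -
    have "V \<otimes> V = (y \<otimes> x) [^] (N - 1) \<otimes> y \<otimes> (x \<otimes> V)"
      by (subst V_eq(1)) (simp add: m_assoc)
    then show ?thesis by (simp add: xV)
  qed
  have "xs (2 * N) \<otimes> y = ?W \<otimes> (y \<otimes> y)" by (simp add: W m_assoc)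
  also have "\<dots> = (?W \<otimes> x) \<otimes> (y \<otimes> x) [^] (N - 1) \<oplus> ?W \<otimes> V"
    unfolding y_square by (simp add: r_distr m_assoc)
  also have "\<dots> = \<zero>" by (simp only: Wx WV) simp
  finally have Wy: "xs (2 * N) \<otimes> y = \<zero>" .
  have "V \<otimes> y \<otimes> y = V \<otimes> (y \<otimes> y)" by (simp add: m_assoc)
  also have "\<dots> = (V \<otimes> x) \<otimes> (y \<otimes> x) [^] (N - 1) \<oplus> V \<otimes> V"
    unfolding y_square by (simp add: r_distr m_assoc)
  also have "\<dots> = \<zero>" by (simp only: Vx VV) simp
  finally have Vyy: "V \<otimes> y \<otimes> y = \<zero>" .
  have "V \<otimes> y = (xs (2 * N) \<oplus> V \<otimes> y) \<otimes> y" by (simp only: xs_add_Vy)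
  also have "\<dots> = \<zero>" by (simp add: l_distr Wy Vyy)
  finally show ?thesis using xs_add_Vy by simp
qed

lemma ys_eq_V: "ys (2 * N) = V"
  by (rule ys_even)

lemma long_words: "2 * N < n \<Longrightarrow> xs n = \<zero> \<and> ys n = \<zero>"
proof (induction n)
  case (Suc n)
  then show ?case
    by (cases "n = 2 * N") (auto simp: xs_eq_V ys_eq_V xV yV)
qed simp

lemma y_ys: "y \<otimes> ys (Suc (Suc n)) = \<zero>"
proof -
  have "y \<otimes> ys (Suc (Suc n)) = (y \<otimes> (y \<otimes> x)) \<otimes> ys n" by (simp add: m_assoc)
  then show ?thesis by (simp add: yyx)
qed

text \<open>The multiplier is the word that completes the given one to \<open>V\<close>, built from
  the next length by appending \<open>y\<close> or \<open>x\<close>. At lengths 0 and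
  \<open>2 * N\<close> the words \<open>xs n\<close> and \<open>ys n\<close> coincide, which is why
  the last clauses exclude these lengths.\<close>

lemma separating_words:
  assumes "n \<le> 2 * N"
  shows "(\<exists>u\<in>carrier R. u \<otimes> xs n = V \<and> (\<forall>j>n. u \<otimes> xs j = \<zero> \<and> u \<otimes> ys j = \<zero>) \<and>
            (0 < n \<and> n < 2 * N \<longrightarrow> u \<otimes> ys n = \<zero>)) \<and>
         (0 < n \<longrightarrow> (\<exists>v\<in>carrier R. v \<otimes> ys n = V \<and> (\<forall>j>n. v \<otimes> xs j = \<zero> \<and> v \<otimes> ys j = \<zero>) \<and>
            (n < 2 * N \<longrightarrow> v \<otimes> xs n = \<zero>)))"
  using assms
proof (induction n rule: inc_induct)
  case base
  then show ?case using N
    by (auto intro!: bexI[of _ \<one>] simp: xs_eq_V ys_eq_V long_words)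
next
  case (step n)
  then obtain u v where u: "u \<in> carrier R" "u \<otimes> xs (Suc n) = V" "\<And>j. j > Suc n \<Longrightarrow> u \<otimes> xs j = \<zero>"
    and v: "v \<in> carrier R" "v \<otimes> ys (Suc n) = V" "\<And>j. j > Suc n \<Longrightarrow> v \<otimes> ys j = \<zero>"
      "\<And>j. j > Suc n \<Longrightarrow> v \<otimes> xs j = \<zero>"
    by blast
  \<comment> \<open>For \<open>j = 1\<close> the product \<open>y \<otimes> y\<close> need not be
    zero, but its words have length at least \<open>2 * N - 1\<close>, beyond \<open>Suc n\<close>,
    and are killed by \<open>v\<close>. Larger \<open>j\<close> are covered by
    \<open>y_ys\<close>.\<close>
  have vy: "v \<otimes> y \<otimes> ys j = \<zero>" if j: "0 < j" "n \<le> j" for j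
  proof (cases "j = 1")
    case True
    then have "v \<otimes> y \<otimes> ys j = v \<otimes> xs (2 * N - 1) \<oplus> v \<otimes> ys (2 * N)"
      using v(1) by (simp add: m_assoc r_distr y_square')
    also have "\<dots> = \<zero>" using True j N by (simp add: v)
    finally show ?thesis .
  next
    case False
    then have i: "j = Suc (Suc (j - 2))" using j by simp
    have "v \<otimes> y \<otimes> ys j = v \<otimes> (y \<otimes> ys j)" using v(1) by (simp add: m_assoc)
    also have "\<dots> = \<zero>" by (subst i) (use v(1) in \<open>simp only: y_ys r_null\<close>)
    finally show ?thesis .
  qed
  have ux: "u \<otimes> x \<otimes> xs j = \<zero>" if j: "0 < j" for j
  proof -
    have i: "j = Suc (j - 1)" using j by simp
    have "u \<otimes> x \<otimes> xs j = u \<otimes> (x \<otimes> xs j)" using u(1) by (simp add: m_assoc)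
    also have "\<dots> = \<zero>" by (subst i) (use u(1) in \<open>simp only: xxs r_null\<close>)
    finally show ?thesis .
  qed
  have vyx: "v \<otimes> y \<otimes> xs j = v \<otimes> ys (Suc j)" and uxy: "u \<otimes> x \<otimes> ys j = u \<otimes> xs (Suc j)" for j
    using u(1) v(1) by (simp_all add: m_assoc)
  show ?case
  proof (intro conjI impI)
    show "\<exists>w\<in>carrier R. w \<otimes> xs n = V \<and> (\<forall>j>n. w \<otimes> xs j = \<zero> \<and> w \<otimes> ys j = \<zero>) \<and>
            (0 < n \<and> n < 2 * N \<longrightarrow> w \<otimes> ys n = \<zero>)"
    proof (intro bexI conjI allI impI)
      show "v \<otimes> y \<in> carrier R" using v(1) by simp
      show "v \<otimes> y \<otimes> xs n = V" by (simp only: vyx v(2))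
      show "v \<otimes> y \<otimes> xs j = \<zero>" "v \<otimes> y \<otimes> ys j = \<zero>" if "n < j" for j
        using that vy[of j] by (simp_all only: vyx v Suc_less_eq)
      show "v \<otimes> y \<otimes> ys n = \<zero>" if "0 < n \<and> n < 2 * N" using that vy[of n] by simp
    qed
    show "\<exists>w\<in>carrier R. w \<otimes> ys n = V \<and> (\<forall>j>n. w \<otimes> xs j = \<zero> \<and> w \<otimes> ys j = \<zero>) \<and>
            (n < 2 * N \<longrightarrow> w \<otimes> xs n = \<zero>)" if "0 < n"
    proof (intro bexI conjI allI impI)
      show "u \<otimes> x \<in> carrier R" using u(1) by simp
      show "u \<otimes> x \<otimes> ys n = V" by (simp only: uxy u(2))
      show "u \<otimes> x \<otimes> xs j = \<zero>" "u \<otimes> x \<otimes> ys j = \<zero>" if "n < j" for j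
        using that ux[of j] by (simp_all only: uxy u Suc_less_eq)
      show "u \<otimes> x \<otimes> xs n = \<zero>" using that ux[of n] by simp
    qed
  qed
qed

end

section \<open>Filtration by word length and injectivity\<close>

inductive_set lin_span for k :: "('a, 'c) ring_scheme" and A :: "('a, 'b, 'd) module_scheme" and W where
  zero: "\<zero>\<^bsub>A\<^esub> \<in> lin_span k A W"
| gen: "w \<in> W \<Longrightarrow> w \<in> lin_span k A W"
| add: "u \<in> lin_span k A W \<Longrightarrow> v \<in> lin_span k A W \<Longrightarrow> u \<oplus>\<^bsub>A\<^esub> v \<in> lin_span k A W"
| smult: "c \<in> carrier k \<Longrightarrow> u \<in> lin_span k A W \<Longrightarrow> c \<odot>\<^bsub>A\<^esub> u \<in> lin_span k A W"

locale xy_algebra = unital_algebra k A + xy_ring A x y N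
  for k (structure) and A (structure) and x y N
begin

text \<open>The spans \<open>L n\<close> form a descending filtration, which is zero from
  \<open>2 * N + 1\<close> on.\<close>

definition words where "words n = (xs ` {n..} \<union> ys ` {n..})"

abbreviation L where "L n \<equiv> lin_span k A (words n)"

lemma L_closed: "z \<in> L n \<Longrightarrow> z \<in> carrier A"
  by (induction rule: lin_span.induct) (auto simp: words_def)

lemma words_in_L: "n \<le> m \<Longrightarrow> xs m \<in> L n" "n \<le> m \<Longrightarrow> ys m \<in> L n"
  by (auto simp: words_def intro!: lin_span.gen)

lemma x_L: "z \<in> L 0 \<Longrightarrow> x \<otimes>\<^bsub>A\<^esub> z \<in> L 0"
proof (induction rule: lin_span.induct)
  case (gen w)
  have "x \<otimes>\<^bsub>A\<^esub> xs m \<in> L 0" for m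
    using words_in_L(1)[of 0 1] xxs by (cases m) (auto intro: lin_span.zero)
  moreover have "x \<otimes>\<^bsub>A\<^esub> ys m \<in> L 0" for m using words_in_L(1)[of 0 "Suc m"] by simp
  ultimately show ?case using gen by (auto simp: words_def)
qed (auto simp: r_distr smult_mult_right L_closed intro: lin_span.intros)

lemma y_L: "z \<in> L 0 \<Longrightarrow> y \<otimes>\<^bsub>A\<^esub> z \<in> L 0"
proof (induction rule: lin_span.induct)
  case (gen w)
  have "y \<otimes>\<^bsub>A\<^esub> ys m \<in> L 0" for m
  proof (cases m)
    case 0
    then show ?thesis using words_in_L(2)[of 0 1] by simp
  next
    case (Suc n)
    show ?thesis
    proof (cases n)
      case 0
      then have "y \<otimes>\<^bsub>A\<^esub> ys m = xs (2 * N - 1) \<oplus>\<^bsub>A\<^esub> ys (2 * N)"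
        using Suc y_square' by simp
      then show ?thesis by (simp only:) (intro lin_span.add words_in_L; simp)
    next
      case (Suc i)
      then show ?thesis using \<open>m = Suc n\<close> y_ys[of i] by (simp only:) (rule lin_span.zero)
    qed
  qed
  moreover have "y \<otimes>\<^bsub>A\<^esub> xs m \<in> L 0" for m using words_in_L(2)[of 0 "Suc m"] by simp
  ultimately show ?case using gen by (auto simp: words_def)
qed (auto simp: r_distr smult_mult_right L_closed intro: lin_span.intros)

lemma L_top: "z \<in> L (Suc (2 * N)) \<Longrightarrow> z = \<zero>\<^bsub>A\<^esub>"
  by (induction rule: lin_span.induct) (auto simp: words_def long_words)

lemma mult_L_eq_zero:
  assumes "z \<in> L (Suc n)" "u \<in> carrier A" "\<And>j. j > n \<Longrightarrow> u \<otimes>\<^bsub>A\<^esub> xs j = \<zero>\<^bsub>A\<^esub> \<and> u \<otimes>\<^bsub>A\<^esub> ys j = \<zero>\<^bsub>A\<^esub>"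
  shows "u \<otimes>\<^bsub>A\<^esub> z = \<zero>\<^bsub>A\<^esub>"
  using assms(1)
proof (induction rule: lin_span.induct)
  case (gen w)
  then show ?case using assms(3) by (auto simp: words_def)
qed (use assms(2) in \<open>auto simp: r_distr smult_mult_right L_closed\<close>)

lemma L_decomp:
  assumes "z \<in> L n"
  obtains a b z' where "a \<in> carrier k" "b \<in> carrier k" "z' \<in> L (Suc n)"
    "z = (a \<odot>\<^bsub>A\<^esub> xs n \<oplus>\<^bsub>A\<^esub> b \<odot>\<^bsub>A\<^esub> ys n) \<oplus>\<^bsub>A\<^esub> z'"
proof -
  have "\<exists>a\<in>carrier k. \<exists>b\<in>carrier k. \<exists>z'\<in>L (Suc n).
      z = (a \<odot>\<^bsub>A\<^esub> xs n \<oplus>\<^bsub>A\<^esub> b \<odot>\<^bsub>A\<^esub> ys n) \<oplus>\<^bsub>A\<^esub> z'"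
    using assms
  proof (induction rule: lin_span.induct)
    case zero
    show ?case
      by (intro bexI[of _ "\<zero>\<^bsub>k\<^esub>"] bexI[of _ "\<zero>\<^bsub>A\<^esub>"]) (auto intro: lin_span.zero)
  next
    case (gen w)
    then obtain m where m: "n \<le> m" "w = xs m \<or> w = ys m" by (auto simp: words_def)
    consider "w = xs n" | "w = ys n" | "w \<in> L (Suc n)"
      using m words_in_L[of "Suc n" m] by (cases "m = n") auto
    then show ?case
    proof cases
      case 1
      then show ?thesis
        by (intro bexI[of _ "\<zero>\<^bsub>k\<^esub>"] bexI[of _ "\<one>\<^bsub>k\<^esub>"] bexI[of _ "\<zero>\<^bsub>A\<^esub>"]) (auto intro: lin_span.zero)
    next
      case 2
      then show ?thesis
        by (intro bexI[of _ "\<zero>\<^bsub>k\<^esub>"] bexI[of _ "\<one>\<^bsub>k\<^esub>"] bexI[of _ "\<zero>\<^bsub>A\<^esub>"]) (auto intro: lin_span.zero)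
    next
      case 3
      then show ?thesis
        by (intro bexI[of _ "\<zero>\<^bsub>k\<^esub>"] bexI[of _ w]) (auto simp: L_closed)
    qed
  next
    case (add u v)
    then obtain a b u' c d v' where *: "a \<in> carrier k" "b \<in> carrier k" "u' \<in> L (Suc n)"
      "u = (a \<odot>\<^bsub>A\<^esub> xs n \<oplus>\<^bsub>A\<^esub> b \<odot>\<^bsub>A\<^esub> ys n) \<oplus>\<^bsub>A\<^esub> u'"
      "c \<in> carrier k" "d \<in> carrier k" "v' \<in> L (Suc n)"
      "v = (c \<odot>\<^bsub>A\<^esub> xs n \<oplus>\<^bsub>A\<^esub> d \<odot>\<^bsub>A\<^esub> ys n) \<oplus>\<^bsub>A\<^esub> v'"
      by blast
    show ?case
      using * by (intro bexI[of _ "a \<oplus>\<^bsub>k\<^esub> c"] bexI[of _ "b \<oplus>\<^bsub>k\<^esub> d"] bexI[of _ "u' \<oplus>\<^bsub>A\<^esub> v'"] lin_span.add)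
        (auto simp: smult_l_distr L_closed a_ac)
  next
    case (smult c u)
    then obtain a b u' where *: "a \<in> carrier k" "b \<in> carrier k" "u' \<in> L (Suc n)"
      "u = (a \<odot>\<^bsub>A\<^esub> xs n \<oplus>\<^bsub>A\<^esub> b \<odot>\<^bsub>A\<^esub> ys n) \<oplus>\<^bsub>A\<^esub> u'"
      by blast
    with \<open>c \<in> carrier k\<close> show ?case
      by (intro bexI[of _ "c \<otimes>\<^bsub>k\<^esub> a"] bexI[of _ "c \<otimes>\<^bsub>k\<^esub> b"] bexI[of _ "c \<odot>\<^bsub>A\<^esub> u'"] lin_span.smult)
        (auto simp: smult_r_distr smult_assoc1 L_closed)
  qed
  then show ?thesis using that by blast
qed

text \<open>By induction on n, \<open>z\<close> lies in every \<open>L n\<close> up to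
  \<open>2 * N + 1\<close>, where the filtration is zero.\<close>

lemma hom_eq_zero:
  assumes "field k" "unital_algebra k B" and \<phi>: "\<phi> \<in> algebra_hom k A B" and V: "\<phi> V \<noteq> \<zero>\<^bsub>B\<^esub>"
    and z: "z \<in> L 0" "\<phi> z = \<zero>\<^bsub>B\<^esub>"
  shows "z = \<zero>\<^bsub>A\<^esub>"
proof -
  interpret k: field k by fact
  interpret B: unital_algebra k B by fact
  have hom: "\<phi> \<in> ring_hom A B" and smult: "\<And>c w. c \<in> carrier k \<Longrightarrow> w \<in> carrier A \<Longrightarrow> \<phi> (c \<odot>\<^bsub>A\<^esub> w) = c \<odot>\<^bsub>B\<^esub> \<phi> w"
    using \<phi> by (auto simp: algebra_hom_def)
  interpret H: ring_hom_ring A B \<phi>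
    by (rule ring_hom_ringI2[OF ring_axioms B.ring_axioms hom])
  have coeff: "c = \<zero>\<^bsub>k\<^esub>" if c: "c \<in> carrier k" "\<phi> (c \<odot>\<^bsub>A\<^esub> V) = \<zero>\<^bsub>B\<^esub>" for c
  proof (rule ccontr)
    assume "c \<noteq> \<zero>\<^bsub>k\<^esub>"
    then have u: "c \<in> Units k" using c by (simp add: k.field_Units)
    have "\<phi> V = (inv\<^bsub>k\<^esub> c \<otimes>\<^bsub>k\<^esub> c) \<odot>\<^bsub>B\<^esub> \<phi> V" using u by simp
    also have "\<dots> = inv\<^bsub>k\<^esub> c \<odot>\<^bsub>B\<^esub> (c \<odot>\<^bsub>B\<^esub> \<phi> V)"
      using u c by (intro B.smult_assoc1) simp_all
    also have "\<dots> = \<zero>\<^bsub>B\<^esub>" using c u by (simp add: smult)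
    finally show False using V by simp
  qed
  have step: "z \<in> L (Suc n)" if n: "n \<le> 2 * N" and zn: "z \<in> L n" for n
  proof -
    obtain a b z' where ab: "a \<in> carrier k" "b \<in> carrier k" and z': "z' \<in> L (Suc n)"
      and z_eq: "z = (a \<odot>\<^bsub>A\<^esub> xs n \<oplus>\<^bsub>A\<^esub> b \<odot>\<^bsub>A\<^esub> ys n) \<oplus>\<^bsub>A\<^esub> z'"
      using L_decomp[OF zn] .
    have z'c: "z' \<in> carrier A" using z' by (rule L_closed)
    have mult: "u \<otimes>\<^bsub>A\<^esub> z = a \<odot>\<^bsub>A\<^esub> (u \<otimes>\<^bsub>A\<^esub> xs n) \<oplus>\<^bsub>A\<^esub> b \<odot>\<^bsub>A\<^esub> (u \<otimes>\<^bsub>A\<^esub> ys n)"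
      if u: "u \<in> carrier A" "\<forall>j>n. u \<otimes>\<^bsub>A\<^esub> xs j = \<zero>\<^bsub>A\<^esub> \<and> u \<otimes>\<^bsub>A\<^esub> ys j = \<zero>\<^bsub>A\<^esub>" for u
    proof -
      have "u \<otimes>\<^bsub>A\<^esub> z' = \<zero>\<^bsub>A\<^esub>" using mult_L_eq_zero[OF z' u(1)] u(2) by blast
      then show ?thesis unfolding z_eq using ab u(1) z'c by (simp add: r_distr smult_mult_right)
    qed
    have \<phi>z: "\<phi> (u \<otimes>\<^bsub>A\<^esub> z) = \<zero>\<^bsub>B\<^esub>" if "u \<in> carrier A" for u
      using that z L_closed[OF zn] by simp
    obtain u where u: "u \<in> carrier A" "u \<otimes>\<^bsub>A\<^esub> xs n = V" "\<forall>j>n. u \<otimes>\<^bsub>A\<^esub> xs j = \<zero>\<^bsub>A\<^esub> \<and> u \<otimes>\<^bsub>A\<^esub> ys j = \<zero>\<^bsub>A\<^esub>"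
      "0 < n \<and> n < 2 * N \<longrightarrow> u \<otimes>\<^bsub>A\<^esub> ys n = \<zero>\<^bsub>A\<^esub>"
      using separating_words[OF n] by blast
    show ?thesis
    proof (cases "0 < n \<and> n < 2 * N")
      case True
      then obtain v where v: "v \<in> carrier A" "v \<otimes>\<^bsub>A\<^esub> ys n = V" "v \<otimes>\<^bsub>A\<^esub> xs n = \<zero>\<^bsub>A\<^esub>"
        "\<forall>j>n. v \<otimes>\<^bsub>A\<^esub> xs j = \<zero>\<^bsub>A\<^esub> \<and> v \<otimes>\<^bsub>A\<^esub> ys j = \<zero>\<^bsub>A\<^esub>"
        using separating_words[OF n] by blast
      have "u \<otimes>\<^bsub>A\<^esub> z = a \<odot>\<^bsub>A\<^esub> V" using mult[OF u(1,3)] u True ab by simp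
      then have "a = \<zero>\<^bsub>k\<^esub>" using coeff[OF ab(1)] \<phi>z[OF u(1)] by simp
      moreover have "v \<otimes>\<^bsub>A\<^esub> z = b \<odot>\<^bsub>A\<^esub> V" using mult[OF v(1,4)] v ab by simp
      then have "b = \<zero>\<^bsub>k\<^esub>" using coeff[OF ab(2)] \<phi>z[OF v(1)] by simp
      ultimately show ?thesis using z' z'c by (simp add: z_eq)
    next
      case False
      \<comment> \<open>At both ends the two words agree, so only the sum of the coefficients is
        determined; it is also all that occurs in \<open>z\<close>.\<close>
      then have xy: "ys n = xs n" using n by (cases "n = 0") (simp_all add: xs_eq_V ys_eq_V)
      have "u \<otimes>\<^bsub>A\<^esub> z = (a \<oplus>\<^bsub>k\<^esub> b) \<odot>\<^bsub>A\<^esub> V" using mult[OF u(1,3)] u ab by (simp add: xy smult_l_distr)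
      then have "a \<oplus>\<^bsub>k\<^esub> b = \<zero>\<^bsub>k\<^esub>" using coeff[of "a \<oplus>\<^bsub>k\<^esub> b"] ab \<phi>z[OF u(1)] by simp
      moreover have "z = (a \<oplus>\<^bsub>k\<^esub> b) \<odot>\<^bsub>A\<^esub> xs n \<oplus>\<^bsub>A\<^esub> z'"
        using z_eq ab by (simp add: xy smult_l_distr)
      ultimately show ?thesis using z' z'c by simp
    qed
  qed
  have "z \<in> L n" if "n \<le> Suc (2 * N)" for n
    using that by (induction n) (use z step in auto)
  then show ?thesis using L_top by blast
qed

end

section \<open>The semidihedral group\<close>

lemma equiv_word_rel: "equiv UNIV word_rel"
  by (rule equivI)
    (auto simp: word_rel_def refl_on_def intro!: symI transI intro: equivclp_sym equivclp_trans)

lemma word_rel_append: "(u, u') \<in> word_rel \<Longrightarrow> (v @ u @ w, v @ u' @ w) \<in> word_rel"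
  unfolding word_rel_def mem_Collect_eq case_prod_conv
proof (induction rule: equivclp_induct)
  case (step y z)
  have "cancel_step (v @ y @ w) (v @ z @ w)" if "cancel_step y z" for y z
    using that
  proof cases
    case (1 a x b c)
    then show ?thesis using cancel_step.intros[of "v @ a" x b "c @ w"] by simp
  qed
  then show ?case using step by (meson equivclp_into_equivclp)
qed simp

lemma word_rel_cancel: "(u @ [(x, b), (x, \<not> b)] @ v, u @ v) \<in> word_rel"
  by (simp add: word_rel_def r_into_equivclp cancel_step.intros del: append_Cons)

definition word_class :: "'x group_word \<Rightarrow> 'x group_word set" where
  "word_class w = word_rel `` {w}"

lemma word_class_eq_iff: "word_class u = word_class v \<longleftrightarrow> (u, v) \<in> word_rel"
  unfolding word_class_def by (rule eq_equiv_class_iff[OF equiv_word_rel]) auto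

lemma word_class_mult:
  fixes u v :: "'x group_word"
  shows "word_class u \<otimes>\<^bsub>free_group\<^esub> word_class v = word_class (u @ v)"
proof -
  have "congruent2 (word_rel :: ('x group_word \<times> 'x group_word) set) word_rel (\<lambda>a b. word_rel `` {a @ b})"
  proof (rule congruent2I')
    fix a a' b b' :: "'x group_word" assume "(a, a') \<in> word_rel" "(b, b') \<in> word_rel"
    then have "(a @ b, a' @ b) \<in> word_rel" "(a' @ b, a' @ b') \<in> word_rel"
      using word_rel_append[of a a' "[]" b] word_rel_append[of b b' a' "[]"] by simp_all
    then have "(a @ b, a' @ b') \<in> word_rel"
      using equiv_word_rel by (meson equivE transE)
    then show "word_rel `` {a @ b} = word_rel `` {a' @ b'}"
      by (simp flip: word_class_def add: word_class_eq_iff)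
  qed
  then show ?thesis
    by (simp add: free_group_def word_class_def UN_equiv_class2[OF equiv_word_rel equiv_word_rel])
qed

lemma free_group_carrier: "carrier free_group = range word_class"
  by (auto simp: free_group_def word_class_def quotient_def)

lemma free_group_one: "\<one>\<^bsub>free_group\<^esub> = word_class []"
  by (simp add: free_group_def word_class_def)

lemma word_class_closed [simp]: "word_class w \<in> carrier free_group"
  by (simp add: free_group_carrier)

lemma fg_gen_eq: "fg_gen x = word_class [(x, True)]"
  by (simp add: fg_gen_def word_class_def)

lemma fg_gen_closed [simp]: "fg_gen x \<in> carrier free_group"
  by (simp add: fg_gen_eq)

lemma word_class_inverse: "word_class (rev (map (\<lambda>(x, b). (x, \<not> b)) w) @ w) = word_class []"
proof (induction w)
  case (Cons l w)
  obtain x b where l: "l = (x, b)" by (cases l)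
  show ?case
    using word_rel_cancel[of "rev (map (\<lambda>(x, b). (x, \<not> b)) w)" x "\<not> b" w] Cons.IH
    by (simp add: l flip: word_class_eq_iff)
qed simp

lemma group_free_group: "group free_group"
proof (rule groupI)
  fix A assume "A \<in> carrier free_group"
  then obtain w where "A = word_class w" by (auto simp: free_group_carrier)
  then show "\<exists>B\<in>carrier free_group. B \<otimes>\<^bsub>free_group\<^esub> A = \<one>\<^bsub>free_group\<^esub>"
    using word_class_inverse[of w]
    by (intro bexI[of _ "word_class (rev (map (\<lambda>(x, b). (x, \<not> b)) w))"])
      (simp_all add: word_class_mult free_group_one)
qed (auto simp: free_group_carrier free_group_one word_class_mult)

lemma inv_fg_gen: "inv\<^bsub>free_group\<^esub> fg_gen x = word_class [(x, False)]"
proof -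
  interpret group free_group by (rule group_free_group)
  have "word_class [(x, False)] \<otimes>\<^bsub>free_group\<^esub> fg_gen x = \<one>\<^bsub>free_group\<^esub>"
    using word_rel_cancel[of "[]" x False "[]"]
    by (simp add: fg_gen_eq word_class_mult free_group_one word_class_eq_iff)
  then show ?thesis by (rule inv_equality) simp_all
qed

lemma free_group_induct [consumes 1, case_names one gen inv_gen]:
  assumes "A \<in> carrier free_group" and "P \<one>\<^bsub>free_group\<^esub>"
    and "\<And>x B. B \<in> carrier free_group \<Longrightarrow> P B \<Longrightarrow> P (fg_gen x \<otimes>\<^bsub>free_group\<^esub> B)"
    and "\<And>x B. B \<in> carrier free_group \<Longrightarrow> P B \<Longrightarrow> P (inv\<^bsub>free_group\<^esub> fg_gen x \<otimes>\<^bsub>free_group\<^esub> B)"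
  shows "P A"
proof -
  have "P (word_class w)" for w
  proof (induction w)
    case (Cons l w)
    obtain x b where l: "l = (x, b)" by (cases l)
    show ?case
      using assms(3,4)[OF word_class_closed Cons.IH, of x]
      by (cases b) (simp_all add: l inv_fg_gen, simp_all add: fg_gen_eq word_class_mult)
  qed (use assms(2) in \<open>simp add: free_group_one\<close>)
  then show ?thesis using assms(1) by (auto simp: free_group_carrier)
qed

lemma (in group) free_group_hom:
  assumes f: "\<And>x. f x \<in> carrier G"
  obtains \<phi> where "\<phi> \<in> hom free_group G" "\<And>x. \<phi> (fg_gen x) = f x"
proof -
  define ev where "ev w = foldr (\<lambda>(x, b) z. (if b then f x else inv f x) \<otimes> z) w \<one>" for w
  have ev_Cons: "ev ((x, b) # w) = (if b then f x else inv f x) \<otimes> ev w" for x b w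
    by (simp add: ev_def)
  have closed: "ev w \<in> carrier G" for w
    by (induction w) (auto simp: ev_def f)
  have append: "ev (v @ w) = ev v \<otimes> ev w" for v w
  proof (induction v)
    case (Cons l v)
    then show ?case by (cases l) (simp add: ev_Cons f closed m_assoc)
  qed (simp add: closed, simp add: ev_def closed[unfolded ev_def])
  have cancel: "ev u = ev v" if "cancel_step u v" for u v
    using that
  proof cases
    case (1 a x b c)
    have "ev [(x, b), (x, \<not> b)] = \<one>" by (cases b) (simp_all add: ev_def f)
    then show ?thesis unfolding 1 append by (simp add: closed)
  qed
  have ev_eq: "ev u = ev v" if "(u, v) \<in> word_rel" for u v
  proof -
    have "equivclp cancel_step u v" using that by (simp add: word_rel_def)
    then show ?thesis by (induction rule: equivclp_induct) (auto dest: cancel)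
  qed
  \<comment> \<open>The chosen representative is immaterial, because \<open>ev\<close> is invariant
    under cancellation steps.\<close>
  define \<phi> where "\<phi> A = ev (SOME w. A = word_class w)" for A
  have \<phi>: "\<phi> (word_class w) = ev w" for w
  proof -
    have "word_class w = word_class (SOME v. word_class w = word_class v)" by (rule someI) (rule refl)
    then show ?thesis unfolding \<phi>_def by (metis ev_eq word_class_eq_iff)
  qed
  have "\<phi> \<in> hom free_group G"
    by (rule homI) (auto simp: free_group_carrier \<phi> closed word_class_mult append)
  moreover have "\<phi> (fg_gen x) = f x" for x
    by (simp add: fg_gen_eq \<phi> ev_def f)
  ultimately show ?thesis by (rule that)
qed

section \<open>Normal closures and group presentations\<close>

lemma (in group) normal_closure_normal:
  assumes "S \<subseteq> carrier G"
  shows "normal_closure G S \<lhd> G"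
proof -
  \<comment> \<open>Makes the intersected family nonempty.\<close>
  have carrier: "carrier G \<lhd> G"
    by (simp add: normal_inv_iff subgroup_self)
  have "subgroup (normal_closure G S) G"
    unfolding normal_closure_def
    by (rule subgroups_Inter) (use carrier assms in \<open>auto dest: normal_imp_subgroup\<close>)
  then show ?thesis
    by (auto simp: normal_inv_iff normal_closure_def)
qed

lemma normal_closure_superset: "S \<subseteq> normal_closure G S"
  by (auto simp: normal_closure_def)

lemma normal_closure_minimal: "K \<lhd> G \<Longrightarrow> S \<subseteq> K \<Longrightarrow> normal_closure G S \<subseteq> K"
  by (auto simp: normal_closure_def)

locale group_presentation =
  fixes S :: "'x group_word set set"
  assumes relators_closed: "S \<subseteq> carrier free_group"
begin

abbreviation N where "N \<equiv> normal_closure free_group S"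

definition \<pi> where "\<pi> A = N #>\<^bsub>free_group\<^esub> A"

lemma N_normal: "N \<lhd> free_group"
  by (rule group.normal_closure_normal[OF group_free_group relators_closed])

lemma group_presented_group: "group (presented_group S)"
  unfolding presented_group_def by (rule normal.factorgroup_is_group[OF N_normal])

sublocale \<pi>: group_hom free_group "presented_group S" \<pi>
proof (intro group_hom.intro group_hom_axioms.intro group_free_group group_presented_group)
  show "\<pi> \<in> hom free_group (presented_group S)"
    using normal.r_coset_hom_Mod[OF N_normal] unfolding \<pi>_def presented_group_def by simp
qed

lemma pg_gen_eq: "pg_gen S x = \<pi> (fg_gen x)"
  by (simp add: pg_gen_def \<pi>_def)

lemma presented_group_carrier: "carrier (presented_group S) = \<pi> ` carrier free_group"
  by (auto simp: presented_group_def FactGroup_def RCOSETS_def \<pi>_def)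

lemma \<pi>_eq_one_iff: "A \<in> carrier free_group \<Longrightarrow> \<pi> A = \<one>\<^bsub>presented_group S\<^esub> \<longleftrightarrow> A \<in> N"
proof -
  assume A: "A \<in> carrier free_group"
  interpret F: group free_group by (rule group_free_group)
  have N: "subgroup N free_group" using N_normal by (rule normal_imp_subgroup)
  have "\<pi> A = \<one>\<^bsub>presented_group S\<^esub> \<longleftrightarrow> N #>\<^bsub>free_group\<^esub> A = N"
    by (simp add: \<pi>_def presented_group_def FactGroup_def)
  also have "\<dots> \<longleftrightarrow> A \<in> N"
    using A N F.coset_join1 F.coset_join2 by blast
  finally show ?thesis .
qed

lemma \<pi>_relator: "A \<in> S \<Longrightarrow> \<pi> A = \<one>\<^bsub>presented_group S\<^esub>"
  using relators_closed normal_closure_superset[of S free_group]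
  by (subst \<pi>_eq_one_iff) (auto simp only: subset_iff)

text \<open>Read contrapositively this is a test for nontriviality: an element is nontrivial if some
  homomorphism from the free group kills the relators but not a representative. No map on the
  quotient has to be constructed.\<close>

lemma hom_eq_one:
  assumes G: "group G" and \<phi>: "\<phi> \<in> hom free_group G" and S: "\<And>r. r \<in> S \<Longrightarrow> \<phi> r = \<one>\<^bsub>G\<^esub>"
    and A: "A \<in> carrier free_group" "\<pi> A = \<one>\<^bsub>presented_group S\<^esub>"
  shows "\<phi> A = \<one>\<^bsub>G\<^esub>"
proof -
  interpret \<phi>: group_hom free_group G \<phi>
    by (intro group_hom.intro group_hom_axioms.intro group_free_group G \<phi>)
  have "N \<subseteq> kernel free_group G \<phi>"
    by (rule normal_closure_minimal[OF \<phi>.normal_kernel])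
      (use S relators_closed in \<open>auto simp: kernel_def\<close>)
  moreover have "A \<in> N" using A \<pi>_eq_one_iff by simp
  ultimately show ?thesis by (auto simp: kernel_def)
qed

lemma presented_group_induct [consumes 1, case_names one gen inv_gen]:
  assumes z: "z \<in> carrier (presented_group S)" and one: "P \<one>\<^bsub>presented_group S\<^esub>"
    and gen: "\<And>x w. w \<in> carrier (presented_group S) \<Longrightarrow> P w \<Longrightarrow>
      P (pg_gen S x \<otimes>\<^bsub>presented_group S\<^esub> w)"
    and inv_gen: "\<And>x w. w \<in> carrier (presented_group S) \<Longrightarrow> P w \<Longrightarrow>
      P (inv\<^bsub>presented_group S\<^esub> pg_gen S x \<otimes>\<^bsub>presented_group S\<^esub> w)"
  shows "P z"
proof -
  obtain A where A: "A \<in> carrier free_group" "z = \<pi> A" using z by (auto simp: presented_group_carrier)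
  from A(1) have "P (\<pi> A)"
  proof (induction A rule: free_group_induct)
    case one
    then show ?case using assms(2) by simp
  next
    case (gen x B)
    then show ?case using assms(3)[of "\<pi> B" x] by (simp add: pg_gen_eq)
  next
    case (inv_gen x B)
    then show ?case using assms(4)[of "\<pi> B" x] by (simp add: pg_gen_eq)
  qed
  then show ?thesis using A by simp
qed

end

section \<open>The group SD and its action on Z/4q\<close>

lemma sd_relators_closed: "sd_relators q \<subseteq> carrier free_group"
proof -
  interpret group free_group by (rule group_free_group)
  show ?thesis by (auto simp: sd_relators_def Let_def)
qed

interpretation SD: group_presentation "sd_relators q" for q
  by unfold_locales (rule sd_relators_closed)

lemma group_SD: "group (SD q)"
  unfolding SD_def by (rule SD.group_presented_group)

lemma SD_gens_closed [simp]: "SD_g q \<in> carrier (SD q)" "SD_h q \<in> carrier (SD q)"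
  by (simp_all add: SD_g_def SD_h_def SD_def SD.pg_gen_eq)

lemma SD_relations:
  "SD_g q [^]\<^bsub>SD q\<^esub> (4 * q) = \<one>\<^bsub>SD q\<^esub>"
  "SD_h q \<otimes>\<^bsub>SD q\<^esub> SD_h q = \<one>\<^bsub>SD q\<^esub>"
  "SD_h q \<otimes>\<^bsub>SD q\<^esub> SD_g q = SD_g q [^]\<^bsub>SD q\<^esub> (2 * q - 1) \<otimes>\<^bsub>SD q\<^esub> SD_h q"
proof -
  interpret F: group free_group by (rule group_free_group)
  interpret S: group "SD q" by (rule group_SD)
  let ?g = "fg_gen Gen_g" and ?h = "fg_gen Gen_h"
  note gen = SD_g_def SD_h_def SD_def SD.pg_gen_eq
  have rel: "SD.\<pi> q r = \<one>\<^bsub>SD q\<^esub>" if "r \<in> sd_relators q" for r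
    using SD.\<pi>_relator[OF that] by (simp add: SD_def)
  have mem: "?g [^]\<^bsub>free_group\<^esub> (4 * q) \<in> sd_relators q"
    "?h [^]\<^bsub>free_group\<^esub> (2::nat) \<in> sd_relators q"
    "(?h \<otimes>\<^bsub>free_group\<^esub> ?g \<otimes>\<^bsub>free_group\<^esub> inv\<^bsub>free_group\<^esub> ?h) \<otimes>\<^bsub>free_group\<^esub>
      inv\<^bsub>free_group\<^esub> (?g [^]\<^bsub>free_group\<^esub> (2 * q - 1)) \<in> sd_relators q"
    by (simp_all add: sd_relators_def Let_def)
  show "SD_g q [^]\<^bsub>SD q\<^esub> (4 * q) = \<one>\<^bsub>SD q\<^esub>"
    using rel[OF mem(1)] by (simp add: gen SD.\<pi>.hom_nat_pow)
  have "SD_h q [^]\<^bsub>SD q\<^esub> (2::nat) = \<one>\<^bsub>SD q\<^esub>"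
    using rel[OF mem(2)] by (simp add: gen SD.\<pi>.hom_nat_pow)
  then show "SD_h q \<otimes>\<^bsub>SD q\<^esub> SD_h q = \<one>\<^bsub>SD q\<^esub>"
    by (simp add: numeral_2_eq_2)
  let ?k = "SD_h q \<otimes>\<^bsub>SD q\<^esub> SD_g q \<otimes>\<^bsub>SD q\<^esub> inv\<^bsub>SD q\<^esub> SD_h q" and ?l = "SD_g q [^]\<^bsub>SD q\<^esub> (2 * q - 1)"
  have "?k \<otimes>\<^bsub>SD q\<^esub> inv\<^bsub>SD q\<^esub> ?l = \<one>\<^bsub>SD q\<^esub>"
    using rel[OF mem(3)] by (simp add: gen SD.\<pi>.hom_nat_pow)
  then have "?k = ?l"
    using S.inv_solve_right'[of "\<one>\<^bsub>SD q\<^esub>" ?k ?l] by simp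
  then show "SD_h q \<otimes>\<^bsub>SD q\<^esub> SD_g q = ?l \<otimes>\<^bsub>SD q\<^esub> SD_h q"
    using S.inv_solve_right'[of ?l "SD_h q \<otimes>\<^bsub>SD q\<^esub> SD_g q" "SD_h q"] by simp
qed

text \<open>g translates by 1 and h multiplies by 2q-1, an involution because
  \<open>(2 * q - 1) ^ 2 = 1 + 4 * q * (q - 1)\<close>. Over the integers the translation by -i and
  the factor 2q-1 involve no truncated subtraction.\<close>

lemma SD_affine_action:
  assumes q: "2 \<le> q"
  obtains \<phi> where "\<phi> \<in> hom free_group (BijGroup {0..<4 * int q})"
    "\<And>r. r \<in> sd_relators q \<Longrightarrow> \<phi> r = \<one>\<^bsub>BijGroup {0..<4 * int q}\<^esub>"
    "\<And>i. \<phi> (fg_gen Gen_g) [^]\<^bsub>BijGroup {0..<4 * int q}\<^esub> i = (\<lambda>n\<in>{0..<4 * int q}. (n + int i) mod (4 * int q))"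
    "\<phi> (fg_gen Gen_h) = (\<lambda>n\<in>{0..<4 * int q}. (2 * int q - 1) * n mod (4 * int q))"
proof -
  define m where "m = 4 * int q"
  have m: "0 < m" using q by (simp add: m_def)
  let ?Z = "{0..<m}" let ?B = "BijGroup ?Z"
  interpret B: group ?B by (rule group_BijGroup)
  define tr where "tr i = (\<lambda>n\<in>?Z. (n + i) mod m)" for i
  define h where "h = (\<lambda>n\<in>?Z. (2 * int q - 1) * n mod m)"
  have sq: "(2 * int q - 1) * (2 * int q - 1) = 1 + m * (int q - 1)"
    by (simp add: m_def algebra_simps)
  have hh_aux: "(2 * int q - 1) * ((2 * int q - 1) * n mod m) mod m = n" if "n \<in> ?Z" for n
  proof -
    have "(2 * int q - 1) * ((2 * int q - 1) * n mod m) mod m = ((2 * int q - 1) * (2 * int q - 1) * n) mod m"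
      by (simp add: mod_mult_right_eq mult.assoc)
    also have "\<dots> = (n + m * ((int q - 1) * n)) mod m" unfolding sq by (simp add: algebra_simps)
    also have "\<dots> = n" using that by simp
    finally show ?thesis .
  qed
  have tr_Bij: "tr i \<in> Bij ?Z" for i
  proof -
    have "bij_betw (tr i) ?Z ?Z"
      by (rule bij_betw_byWitness[where f' = "tr (- i)"])
        (use m in \<open>auto simp: tr_def mod_simps\<close>)
    then show ?thesis by (simp add: Bij_def tr_def)
  qed
  have h_Bij: "h \<in> Bij ?Z"
  proof -
    have "bij_betw h ?Z ?Z"
      by (rule bij_betw_byWitness[where f' = h]) (use m hh_aux in \<open>auto simp: h_def\<close>)
    then show ?thesis by (simp add: Bij_def h_def)
  qed
  have mult: "f \<otimes>\<^bsub>?B\<^esub> f' = compose ?Z f f'" if "f \<in> Bij ?Z" "f' \<in> Bij ?Z" for f f'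
    using that by (simp add: BijGroup_def)
  have one: "\<one>\<^bsub>?B\<^esub> = (\<lambda>n\<in>?Z. n)" and carrier: "carrier ?B = Bij ?Z"
    by (simp_all add: BijGroup_def)
  have tr_mult: "tr i \<otimes>\<^bsub>?B\<^esub> tr j = tr (j + i)" for i j
    unfolding mult[OF tr_Bij tr_Bij]
    using m by (auto simp: compose_def tr_def mod_simps add.assoc intro!: restrict_ext)
  have tr_0: "tr 0 = \<one>\<^bsub>?B\<^esub>"
    by (auto simp: tr_def one intro!: restrict_ext)
  have tr_pow: "tr 1 [^]\<^bsub>?B\<^esub> i = tr (int i)" for i :: nat
    by (induction i) (simp_all add: tr_0 tr_mult)
  have hh: "h \<otimes>\<^bsub>?B\<^esub> h = \<one>\<^bsub>?B\<^esub>"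
    unfolding mult[OF h_Bij h_Bij]
    using m hh_aux by (auto simp: compose_def h_def one intro!: restrict_ext)
  have aux: "(2 * int q - 1) * ((n + 1) mod m) mod m =
      ((2 * int q - 1) * n mod m + (2 * int q - 1)) mod m" for n
    by (simp only: mod_mult_right_eq mod_add_left_eq distrib_left mult_1_right)
  have hg: "h \<otimes>\<^bsub>?B\<^esub> tr 1 = tr (2 * int q - 1) \<otimes>\<^bsub>?B\<^esub> h"
    unfolding mult[OF h_Bij tr_Bij] mult[OF tr_Bij h_Bij]
    using m aux by (auto simp: compose_def h_def tr_def intro!: restrict_ext)
  have tr_m: "tr m = \<one>\<^bsub>?B\<^esub>"
    by (auto simp: tr_def one intro!: restrict_ext)
  obtain \<phi> where \<phi>: "\<phi> \<in> hom free_group ?B"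
    and gen: "\<And>x. \<phi> (fg_gen x) = (case x of Gen_g \<Rightarrow> tr 1 | Gen_h \<Rightarrow> h)"
  proof -
    have "(case x of Gen_g \<Rightarrow> tr 1 | Gen_h \<Rightarrow> h) \<in> carrier ?B" for x
      by (cases x) (simp_all add: carrier tr_Bij h_Bij)
    then show ?thesis by (rule B.free_group_hom) (rule that)
  qed
  interpret \<phi>: group_hom free_group ?B \<phi>
    by (intro group_hom.intro group_hom_axioms.intro group_free_group B.group_axioms \<phi>)
  have tr_c [simp]: "tr i \<in> carrier ?B" "h \<in> carrier ?B" for i by (simp_all add: carrier tr_Bij h_Bij)
  have "\<phi> r = \<one>\<^bsub>?B\<^esub>" if "r \<in> sd_relators q" for r
  proof -
    let ?g = "fg_gen Gen_g" and ?h = "fg_gen Gen_h"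
    have "\<phi> (?g [^]\<^bsub>free_group\<^esub> (4 * q)) = \<one>\<^bsub>?B\<^esub>"
      using tr_m by (simp add: \<phi>.hom_nat_pow gen tr_pow m_def[symmetric])
    moreover have "\<phi> (?h [^]\<^bsub>free_group\<^esub> (2::nat)) = \<one>\<^bsub>?B\<^esub>"
      by (simp add: \<phi>.hom_nat_pow gen numeral_2_eq_2 hh)
    moreover have "\<phi> ((?h \<otimes>\<^bsub>free_group\<^esub> ?g \<otimes>\<^bsub>free_group\<^esub> inv\<^bsub>free_group\<^esub> ?h) \<otimes>\<^bsub>free_group\<^esub>
        inv\<^bsub>free_group\<^esub> (?g [^]\<^bsub>free_group\<^esub> (2 * q - 1))) = \<one>\<^bsub>?B\<^esub>"
    proof -
      have "int (2 * q - 1) = 2 * int q - 1" using q by simp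
      moreover have "tr (2 * int q - 1) \<otimes>\<^bsub>?B\<^esub> h \<otimes>\<^bsub>?B\<^esub> inv\<^bsub>?B\<^esub> h = tr (2 * int q - 1)"
        by (simp add: B.m_assoc)
      ultimately show ?thesis by (simp add: \<phi>.hom_nat_pow gen tr_pow hg)
    qed
    ultimately show ?thesis using that by (auto simp: sd_relators_def Let_def)
  qed
  then show ?thesis
    using that[of \<phi>] \<phi> gen tr_pow unfolding m_def[symmetric] by (simp add: tr_def h_def)
qed

text \<open>Elements are compared with the identity alone, because nonvanishing of the socle is read
  off from the coefficient there. The image of the point 0 determines i.\<close>

lemma SD_powers_distinct:
  assumes q: "2 \<le> q" and i: "i < 4 * q"
  shows "SD_g q [^]\<^bsub>SD q\<^esub> i = \<one>\<^bsub>SD q\<^esub> \<longleftrightarrow> i = 0"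
    and "SD_g q [^]\<^bsub>SD q\<^esub> i \<otimes>\<^bsub>SD q\<^esub> SD_h q \<noteq> \<one>\<^bsub>SD q\<^esub>"
proof -
  let ?Z = "{0..<4 * int q}" let ?B = "BijGroup ?Z"
  let ?g = "fg_gen Gen_g :: sd_gen group_word set" and ?h = "fg_gen Gen_h :: sd_gen group_word set"
  obtain \<phi> where \<phi>: "\<phi> \<in> hom free_group ?B"
    and rel: "\<And>r. r \<in> sd_relators q \<Longrightarrow> \<phi> r = \<one>\<^bsub>?B\<^esub>"
    and g: "\<And>i. \<phi> ?g [^]\<^bsub>?B\<^esub> i = (\<lambda>n\<in>?Z. (n + int i) mod (4 * int q))"
    and h: "\<phi> ?h = (\<lambda>n\<in>?Z. (2 * int q - 1) * n mod (4 * int q))"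
    using SD_affine_action[OF q] by blast
  interpret F: group free_group by (rule group_free_group)
  interpret S: group "SD q" by (rule group_SD)
  interpret B: group ?B by (rule group_BijGroup)
  interpret \<phi>: group_hom free_group ?B \<phi>
    by (intro group_hom.intro group_hom_axioms.intro group_free_group B.group_axioms \<phi>)
  have one: "\<one>\<^bsub>?B\<^esub> n = n" if "n \<in> ?Z" for n using that by (simp add: BijGroup_def)
  note gen = SD_g_def SD_h_def SD_def SD.pg_gen_eq
  have trivial: "\<phi> A = \<one>\<^bsub>?B\<^esub>" if "A \<in> carrier free_group" "SD.\<pi> q A = \<one>\<^bsub>SD q\<^esub>" for A
    using SD.hom_eq_one[OF B.group_axioms \<phi> rel] that by (simp add: SD_def)
  have zero: "i = 0" if "(\<lambda>n\<in>?Z. (n + int i) mod (4 * int q)) 0 = 0"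
    using that i q by simp
  show "SD_g q [^]\<^bsub>SD q\<^esub> i = \<one>\<^bsub>SD q\<^esub> \<longleftrightarrow> i = 0"
  proof
    assume "SD_g q [^]\<^bsub>SD q\<^esub> i = \<one>\<^bsub>SD q\<^esub>"
    then have "\<phi> (?g [^]\<^bsub>free_group\<^esub> i) = \<one>\<^bsub>?B\<^esub>"
      by (intro trivial) (simp_all add: gen SD.\<pi>.hom_nat_pow)
    then have "(\<phi> ?g [^]\<^bsub>?B\<^esub> i) 0 = 0" using one[of 0] q by (simp add: \<phi>.hom_nat_pow)
    then show "i = 0" unfolding g by (rule zero)
  qed simp
  show "SD_g q [^]\<^bsub>SD q\<^esub> i \<otimes>\<^bsub>SD q\<^esub> SD_h q \<noteq> \<one>\<^bsub>SD q\<^esub>"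
  proof
    assume "SD_g q [^]\<^bsub>SD q\<^esub> i \<otimes>\<^bsub>SD q\<^esub> SD_h q = \<one>\<^bsub>SD q\<^esub>"
    then have "\<phi> (?g [^]\<^bsub>free_group\<^esub> i \<otimes>\<^bsub>free_group\<^esub> ?h) = \<one>\<^bsub>?B\<^esub>"
      by (intro trivial) (simp_all add: gen SD.\<pi>.hom_nat_pow)
    then have eq: "\<phi> ?g [^]\<^bsub>?B\<^esub> i \<otimes>\<^bsub>?B\<^esub> \<phi> ?h = \<one>\<^bsub>?B\<^esub>" by (simp add: \<phi>.hom_nat_pow)
    have carrier: "carrier ?B = Bij ?Z" by (simp add: BijGroup_def)
    have mult: "f \<otimes>\<^bsub>?B\<^esub> f' = compose ?Z f f'" if "f \<in> Bij ?Z" "f' \<in> Bij ?Z" for f f'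
      using that by (simp add: BijGroup_def)
    have "\<phi> ?g \<in> carrier ?B" "\<phi> ?h \<in> carrier ?B" by simp_all
    then have "\<phi> ?g [^]\<^bsub>?B\<^esub> i \<in> Bij ?Z" "\<phi> ?h \<in> Bij ?Z"
      unfolding carrier[symmetric] by simp_all
    then have "\<phi> ?g [^]\<^bsub>?B\<^esub> i \<otimes>\<^bsub>?B\<^esub> \<phi> ?h = compose ?Z (\<phi> ?g [^]\<^bsub>?B\<^esub> i) (\<phi> ?h)"
      by (rule mult)
    then have comp: "(\<phi> ?g [^]\<^bsub>?B\<^esub> i) (\<phi> ?h n) = n" if "n \<in> ?Z" for n
      using one[OF that] compose_eq[OF that, of "\<phi> ?g [^]\<^bsub>?B\<^esub> i" "\<phi> ?h"] eq by (simp only:)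
    have "i = 0" using comp[of 0] q by (intro zero) (simp add: g h)
    \<comment> \<open>With i = 0 the map is h alone, which sends 1 to 2q-1; this differs from 1 as
      \<open>2 \<le> q\<close>.\<close>
    then show False using comp[of 1] one[of "2 * int q - 1"] q by (simp add: g h)
  qed
qed

section \<open>The presentation\<close>

lemma (in cring) xy_relations_closed: "xy_relations R q \<subseteq> carrier (free_algebra R)"
proof -
  interpret F: unital_algebra R "free_algebra R :: ('a, xy_gen list \<Rightarrow> 'a) module"
    by (rule unital_algebra_free_algebra)
  show ?thesis by (simp add: xy_relations_def Let_def)
qed

text \<open>An equivalence because both directions occur: equations in the group algebra kill the
  relators, and in the presented algebra the killed relators give the equations.\<close>

lemma (in cring) xy_relations_hom:
  assumes B: "ring B" and \<psi>: "\<psi> \<in> ring_hom (free_algebra R) B"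
    and x: "\<psi> (fa_gen R Gen_X) = x" and y: "\<psi> (fa_gen R Gen_Y) = y"
  shows "(\<forall>r\<in>xy_relations R q. \<psi> r = \<zero>\<^bsub>B\<^esub>) \<longleftrightarrow> x \<otimes>\<^bsub>B\<^esub> x = \<zero>\<^bsub>B\<^esub> \<and>
    y \<otimes>\<^bsub>B\<^esub> y = x \<otimes>\<^bsub>B\<^esub> (y \<otimes>\<^bsub>B\<^esub> x) [^]\<^bsub>B\<^esub> (2 * q - 1) \<oplus>\<^bsub>B\<^esub> (y \<otimes>\<^bsub>B\<^esub> x) [^]\<^bsub>B\<^esub> (2 * q)"
proof -
  interpret F: unital_algebra R "free_algebra R :: ('a, xy_gen list \<Rightarrow> 'a) module"
    by (rule unital_algebra_free_algebra)
  interpret B: ring B by fact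
  interpret H: ring_hom_ring "free_algebra R :: ('a, xy_gen list \<Rightarrow> 'a) module" B \<psi>
    by (rule ring_hom_ringI2[OF F.ring_axioms B \<psi>])
  have c: "x \<in> carrier B" "y \<in> carrier B" using x y H.hom_closed fa_gen_closed by metis+
  let ?F = "free_algebra R :: ('a, xy_gen list \<Rightarrow> 'a) module"
  let ?X = "fa_gen R Gen_X" and ?Y = "fa_gen R Gen_Y"
  let ?Z = "?X \<otimes>\<^bsub>?F\<^esub> (?Y \<otimes>\<^bsub>?F\<^esub> ?X) [^]\<^bsub>?F\<^esub> (2 * q - 1) \<oplus>\<^bsub>?F\<^esub> (?Y \<otimes>\<^bsub>?F\<^esub> ?X) [^]\<^bsub>?F\<^esub> (2 * q)"
  let ?z = "x \<otimes>\<^bsub>B\<^esub> (y \<otimes>\<^bsub>B\<^esub> x) [^]\<^bsub>B\<^esub> (2 * q - 1) \<oplus>\<^bsub>B\<^esub> (y \<otimes>\<^bsub>B\<^esub> x) [^]\<^bsub>B\<^esub> (2 * q)"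
  have square: "\<psi> (w [^]\<^bsub>?F\<^esub> (2::nat)) = \<psi> w \<otimes>\<^bsub>B\<^esub> \<psi> w" if "w \<in> carrier ?F" for w
    using that by (simp add: numeral_2_eq_2)
  have "\<psi> ?Z = ?z" by (simp add: H.hom_nat_pow x y)
  then have "\<psi> (?Y [^]\<^bsub>?F\<^esub> (2::nat) \<ominus>\<^bsub>?F\<^esub> ?Z) = y \<otimes>\<^bsub>B\<^esub> y \<ominus>\<^bsub>B\<^esub> ?z"
    unfolding a_minus_def by (subst H.hom_add) (simp_all add: square y)
  then have "\<psi> (?Y [^]\<^bsub>?F\<^esub> (2::nat) \<ominus>\<^bsub>?F\<^esub> ?Z) = \<zero>\<^bsub>B\<^esub> \<longleftrightarrow> y \<otimes>\<^bsub>B\<^esub> y = ?z"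
    using c by (simp add: B.minus_eq_zero_iff)
  moreover have "\<psi> (?X [^]\<^bsub>?F\<^esub> (2::nat)) = x \<otimes>\<^bsub>B\<^esub> x" by (simp add: square x)
  ultimately show ?thesis by (simp only: xy_relations_def Let_def ball_simps simp_thms)
qed

lemma ring_characteristic_two:
  assumes "cring k" "ring_characteristic k = 2"
  shows "\<one>\<^bsub>k\<^esub> \<oplus>\<^bsub>k\<^esub> \<one>\<^bsub>k\<^esub> = \<zero>\<^bsub>k\<^esub>"
proof -
  interpret cring k by fact
  let ?P = "\<lambda>n. n > 0 \<and> [(n::nat)] \<cdot>\<^bsub>k\<^esub> \<one>\<^bsub>k\<^esub> = \<zero>\<^bsub>k\<^esub>"
  have ex: "\<exists>n. ?P n" and "(LEAST n. ?P n) = 2"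
    using assms(2) by (auto simp: ring_characteristic_def split: if_splits)
  then have "[(2::nat)] \<cdot>\<^bsub>k\<^esub> \<one>\<^bsub>k\<^esub> = \<zero>\<^bsub>k\<^esub>" using LeastI_ex[OF ex] by simp
  then show ?thesis by (simp add: numeral_2_eq_2)
qed

section \<open>The group algebra of SD and the isomorphism\<close>

locale semidihedral_algebra = field k for k (structure) +
  fixes q r n :: nat
  assumes char_two: "\<one> \<oplus> \<one> = \<zero>" and q_eq: "q = 2 * r" and r_eq: "r = 2 ^ n"
begin

abbreviation A where "A \<equiv> kSD k q"
abbreviation g where "g \<equiv> basis_elt k (SD_g q)"
abbreviation h where "h \<equiv> basis_elt k (SD_h q)"

sublocale Grp: group "SD q" by (rule group_SD)

sublocale MA: monoid_alg k "SD q"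
  by (intro monoid_alg.intro cring_axioms Grp.monoid_axioms)

sublocale A: unital_algebra k "kSD k q"
  unfolding kSD_def by (rule MA.unital_algebra_monoid_algebra)

lemmas basis_closed = MA.basis_elt_closed[folded kSD_def]
lemmas basis_mult = MA.basis_elt_mult[folded kSD_def]
lemmas basis_power = MA.basis_elt_power[folded kSD_def]
lemmas basis_one = MA.monoid_algebra_simps(1)[folded kSD_def]

lemma q_ge_2: "2 \<le> q" by (simp add: q_eq r_eq)

sublocale sd: sd_ring "kSD k q" "basis_elt k (SD_g q)" q r n "basis_elt k (SD_h q)"
proof
  show "\<one>\<^bsub>A\<^esub> \<oplus>\<^bsub>A\<^esub> \<one>\<^bsub>A\<^esub> = \<zero>\<^bsub>A\<^esub>" by (rule A.one_add_one[OF char_two])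
  show "q = 2 * r" "r = 2 ^ n" by (rule q_eq r_eq)+
qed (simp_all add: basis_closed basis_mult basis_power basis_one SD_relations)

lemma SD_X_eq: "SD_X k q = sd.x"
  by (simp add: SD_X_def sd.x_def)

lemma SD_Y_eq: "SD_Y k q = sd.y"
  by (simp add: SD_Y_def Let_def sd.y_def sd.x_def sd.P.s_eq_sum sd.\<Gamma>_add sd.\<Gamma>_sum sd.\<Gamma>_power
      basis_power basis_mult del: power.simps)

text \<open>The element is the sum of the \<open>g ^ i\<close> times \<open>1 + h\<close>. At the
  identity only \<open>g ^ 0\<close> contributes, with coefficient 1.\<close>

lemma socle_neq_zero: "(sd.y \<otimes>\<^bsub>A\<^esub> sd.x) [^]\<^bsub>A\<^esub> (2 * q) \<noteq> \<zero>\<^bsub>A\<^esub>"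
proof -
  let ?g = "SD_g q" and ?h = "SD_h q" and ?G = "SD q"
  let ?c = "\<lambda>i::nat. ?g [^]\<^bsub>?G\<^esub> i" and ?S = "{..<4 * q}"
  let ?s = "(\<Oplus>\<^bsub>A\<^esub>i\<in>?S. basis_elt k (?c i)) \<oplus>\<^bsub>A\<^esub> (\<Oplus>\<^bsub>A\<^esub>i\<in>?S. basis_elt k (?c i \<otimes>\<^bsub>?G\<^esub> ?h))"
  have coeffs: "basis_elt k (?c i) \<one>\<^bsub>?G\<^esub> = (if 0 = i then \<one> else \<zero>)"
    "basis_elt k (?c i \<otimes>\<^bsub>?G\<^esub> ?h) \<one>\<^bsub>?G\<^esub> = \<zero>" if "i < 4 * q" for i
  proof -
    have "(\<one>\<^bsub>?G\<^esub> = ?c i) = (0 = i)" and "(\<one>\<^bsub>?G\<^esub> = ?c i \<otimes>\<^bsub>?G\<^esub> ?h) = False"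
      using SD_powers_distinct[OF q_ge_2 that] by metis+
    then show "basis_elt k (?c i) \<one>\<^bsub>?G\<^esub> = (if 0 = i then \<one> else \<zero>)"
      "basis_elt k (?c i \<otimes>\<^bsub>?G\<^esub> ?h) \<one>\<^bsub>?G\<^esub> = \<zero>"
      by (simp_all only: basis_elt_def if_False)
  qed
  have pow: "g [^]\<^bsub>A\<^esub> i = basis_elt k (?c i)" for i :: nat by (simp add: basis_power)
  have "(sd.y \<otimes>\<^bsub>A\<^esub> sd.x) [^]\<^bsub>A\<^esub> (2 * q) = (\<Oplus>\<^bsub>A\<^esub>i\<in>?S. g [^]\<^bsub>A\<^esub> i) \<oplus>\<^bsub>A\<^esub> (\<Oplus>\<^bsub>A\<^esub>i\<in>?S. g [^]\<^bsub>A\<^esub> i \<otimes>\<^bsub>A\<^esub> h)"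
    unfolding sd.y_x_power_2q_eq_sum unfolding sd.x_def
    by (simp add: A.A.r_distr A.A.finsum_ldistr Pi_def)
  also have "\<dots> = ?s" by (simp add: pow basis_mult)
  finally have "((sd.y \<otimes>\<^bsub>A\<^esub> sd.x) [^]\<^bsub>A\<^esub> (2 * q)) \<one>\<^bsub>?G\<^esub> = ?s \<one>\<^bsub>?G\<^esub>" by (simp only:)
  also have "\<dots> = (\<Oplus>i\<in>?S. basis_elt k (?c i) \<one>\<^bsub>?G\<^esub>) \<oplus> (\<Oplus>i\<in>?S. basis_elt k (?c i \<otimes>\<^bsub>?G\<^esub> ?h) \<one>\<^bsub>?G\<^esub>)"
    unfolding kSD_def by (simp add: MA.add_apply MA.finsum_apply)
  also have "(\<Oplus>i\<in>?S. basis_elt k (?c i) \<one>\<^bsub>?G\<^esub>) = (\<Oplus>i\<in>?S. if 0 = i then \<one> else \<zero>)"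
  proof (rule finsum_cong')
    show "(\<lambda>i. if 0 = i then \<one> else \<zero>) \<in> ?S \<rightarrow> carrier k" by (rule funcsetI) simp
    show "basis_elt k (?c i) \<one>\<^bsub>?G\<^esub> = (if 0 = i then \<one> else \<zero>)" if "i \<in> ?S" for i
      by (rule coeffs(1)) (use that in simp)
  qed (rule refl)
  also have "\<dots> = \<one>"
    by (rule finsum_singleton[of 0 ?S "\<lambda>_. \<one>"]) (use q_ge_2 in simp_all)
  also have "(\<Oplus>i\<in>?S. basis_elt k (?c i \<otimes>\<^bsub>?G\<^esub> ?h) \<one>\<^bsub>?G\<^esub>) = (\<Oplus>i\<in>?S. \<zero>)"
  proof (rule finsum_cong')
    show "basis_elt k (?c i \<otimes>\<^bsub>?G\<^esub> ?h) \<one>\<^bsub>?G\<^esub> = \<zero>" if "i \<in> ?S" for i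
      by (rule coeffs(2)) (use that in simp)
  qed simp_all
  finally have "((sd.y \<otimes>\<^bsub>A\<^esub> sd.x) [^]\<^bsub>A\<^esub> (2 * q)) \<one>\<^bsub>?G\<^esub> = \<one>" by simp
  moreover have "\<zero>\<^bsub>A\<^esub> \<one>\<^bsub>?G\<^esub> = \<zero>" by (simp add: kSD_def MA.monoid_algebra_simps(2))
  ultimately show ?thesis using one_not_zero by metis
qed

lemma generated_algebra:
  assumes sub: "B \<subseteq> carrier A" and B: "sd.x \<in> B" "sd.y \<in> B" "\<one>\<^bsub>A\<^esub> \<in> B"
    and add: "\<And>z w. z \<in> B \<Longrightarrow> w \<in> B \<Longrightarrow> z \<oplus>\<^bsub>A\<^esub> w \<in> B"
    and mult: "\<And>z w. z \<in> B \<Longrightarrow> w \<in> B \<Longrightarrow> z \<otimes>\<^bsub>A\<^esub> w \<in> B"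
    and smult: "\<And>c z. c \<in> carrier k \<Longrightarrow> z \<in> B \<Longrightarrow> c \<odot>\<^bsub>A\<^esub> z \<in> B"
  shows "carrier A = B"
proof
  have g: "g \<in> B" and h: "h \<in> B" using sd.generated[OF B add mult] by blast+
  have power: "g [^]\<^bsub>A\<^esub> i \<in> B" for i :: nat by (induction i) (simp_all add: B g mult)
  \<comment> \<open>Closure of \<open>B\<close> under inverses is not given, so the inverses of the
    generators are written as positive powers.\<close>
  have inv_g: "inv\<^bsub>SD q\<^esub> SD_g q = SD_g q [^]\<^bsub>SD q\<^esub> (4 * q - 1)"
  proof (rule Grp.inv_equality)
    have "Suc (4 * q - 1) = 4 * q" using q_ge_2 by simp
    then show "SD_g q [^]\<^bsub>SD q\<^esub> (4 * q - 1) \<otimes>\<^bsub>SD q\<^esub> SD_g q = \<one>\<^bsub>SD q\<^esub>"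
      using SD_relations(1)[of q] Grp.nat_pow_Suc[of "SD_g q" "4 * q - 1"] by simp
  qed simp_all
  have inv_h: "inv\<^bsub>SD q\<^esub> SD_h q = SD_h q"
    by (rule Grp.inv_equality) (simp_all add: SD_relations)
  have gens: "basis_elt k (pg_gen (sd_relators q) x) \<in> B"
    "basis_elt k (inv\<^bsub>SD q\<^esub> pg_gen (sd_relators q) x) \<in> B" for x
    using g h power[of "4 * q - 1"]
    by (cases x; simp add: inv_g inv_h basis_power flip: SD_g_def SD_h_def)+
  have pg_closed: "pg_gen (sd_relators q) x \<in> carrier (SD q)" for x
    by (cases x) (simp_all flip: SD_g_def SD_h_def)
  have basis: "basis_elt k z \<in> B" if z: "z \<in> carrier (SD q)" for z
    using z[unfolded SD_def]
  proof (induction z rule: SD.presented_group_induct)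
    case one
    then show ?case using B(3) by (simp add: basis_one SD_def)
  next
    case (gen x w)
    then show ?case using mult[OF gens(1)[of x], of "basis_elt k w"] pg_closed[of x]
      by (simp add: basis_mult flip: SD_def)
  next
    case (inv_gen x w)
    then show ?case using mult[OF gens(2)[of x], of "basis_elt k w"] pg_closed[of x]
      by (simp add: basis_mult flip: SD_def)
  qed
  have zero: "\<zero>\<^bsub>A\<^esub> \<in> B" using add[OF B(3) B(3)] A.one_add_one[OF char_two] by simp
  show "carrier A \<subseteq> B"
  proof
    fix f assume "f \<in> carrier A"
    then show "f \<in> B" unfolding kSD_def
      by (induction f rule: MA.monoid_algebra_induct)
        (use zero add smult basis in \<open>simp_all add: kSD_def\<close>)
  qed
qed (rule sub)

theorem presentation:
  "\<exists>\<phi> \<in> algebra_iso k (presented_algebra k (xy_relations k q)) A.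
     \<phi> (pa_gen k (xy_relations k q) Gen_X) = SD_X k q \<and>
     \<phi> (pa_gen k (xy_relations k q) Gen_Y) = SD_Y k q"
proof -
  let ?Rel = "xy_relations k q" let ?P = "presented_algebra k ?Rel"
  let ?F = "free_algebra k :: (_, xy_gen list \<Rightarrow> _) module"
  note Rel = xy_relations_closed[of q]
  interpret P: unital_algebra k ?P by (rule unital_algebra_presented[OF Rel])
  define b where "b x = (case x of Gen_X \<Rightarrow> sd.x | Gen_Y \<Rightarrow> sd.y)" for x
  have b_closed: "b x \<in> carrier A" for x by (cases x) (simp_all add: b_def)
  obtain \<phi> where \<phi>: "\<phi> \<in> algebra_hom k ?P A" and gen: "\<And>x. \<phi> (pa_gen k ?Rel x) = b x"
  proof (rule A.presented_algebra_hom[where b = b, OF b_closed Rel])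
    fix \<psi> \<rho> assume \<psi>: "\<psi> \<in> ring_hom ?F A" "\<And>x. \<psi> (fa_gen k x) = b x" and \<rho>: "\<rho> \<in> ?Rel"
    then show "\<psi> \<rho> = \<zero>\<^bsub>A\<^esub>"
      using xy_relations_hom[OF A.A.ring_axioms \<psi>(1), of sd.x sd.y q] sd.x_square sd.y_square
      by (simp add: b_def)
  qed (rule that)
  have hom: "\<phi> \<in> ring_hom ?P A"
    and smult: "\<And>c z. c \<in> carrier k \<Longrightarrow> z \<in> carrier ?P \<Longrightarrow> \<phi> (c \<odot>\<^bsub>?P\<^esub> z) = c \<odot>\<^bsub>A\<^esub> \<phi> z"
    using \<phi> by (auto simp: algebra_hom_def)
  interpret H: ring_hom_ring ?P A \<phi> by (rule ring_hom_ringI2[OF P.ring_axioms A.A.ring_axioms hom])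
  obtain \<pi> where \<pi>: "\<pi> \<in> ring_hom ?F ?P" "\<And>x. \<pi> (fa_gen k x) = pa_gen k ?Rel x"
      "\<And>\<rho>. \<rho> \<in> ?Rel \<Longrightarrow> \<pi> \<rho> = \<zero>\<^bsub>?P\<^esub>"
    using presented_algebra_proj[OF Rel] by blast
  let ?x = "pa_gen k ?Rel Gen_X" and ?y = "pa_gen k ?Rel Gen_Y"
  have gens: "?x \<in> carrier ?P" "?y \<in> carrier ?P" by (simp_all add: pa_gen_closed[OF Rel])
  \<comment> \<open>The two equations come from the projection of the free algebra, which sends the
    relators to zero.\<close>
  interpret xy: xy_algebra k ?P ?x ?y "2 * q"
    using xy_relations_hom[OF P.ring_axioms \<pi>(1) \<pi>(2) \<pi>(2), of q] \<pi>(3) gens q_ge_2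
    by unfold_locales simp_all
  have span: "z \<in> xy.L 0" if "z \<in> carrier ?P" for z
    using that Rel
  proof (induction z rule: presented_algebra_induct)
    case one
    show ?case using xy.words_in_L(1)[of 0 0] by simp
  next
    case (gen x u)
    then show ?case by (cases x) (simp_all add: xy.x_L xy.y_L)
  qed (auto intro: lin_span.intros)
  have "\<phi> ((?y \<otimes>\<^bsub>?P\<^esub> ?x) [^]\<^bsub>?P\<^esub> (2 * q)) \<noteq> \<zero>\<^bsub>A\<^esub>"
    using socle_neq_zero gens by (simp add: H.hom_nat_pow gen b_def)
  then have ker: "z = \<zero>\<^bsub>?P\<^esub>" if "z \<in> carrier ?P" "\<phi> z = \<zero>\<^bsub>A\<^esub>" for z
    using xy.hom_eq_zero[OF field_axioms A.unital_algebra_axioms \<phi>] span that by blast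
  have "inj_on \<phi> (carrier ?P)"
  proof (rule inj_onI)
    fix z w assume *: "z \<in> carrier ?P" "w \<in> carrier ?P" "\<phi> z = \<phi> w"
    then have "\<phi> (z \<ominus>\<^bsub>?P\<^esub> w) = \<zero>\<^bsub>A\<^esub>" by (simp add: a_minus_def A.M.r_neg)
    then show "z = w" using ker[of "z \<ominus>\<^bsub>?P\<^esub> w"] * by (simp add: P.minus_eq_zero_iff)
  qed
  moreover have "carrier A = \<phi> ` carrier ?P"
  proof (rule generated_algebra)
    show "sd.x \<in> \<phi> ` carrier ?P" "sd.y \<in> \<phi> ` carrier ?P"
      using imageI[OF gens(1), of \<phi>] imageI[OF gens(2), of \<phi>] by (simp_all add: gen b_def)
    show "\<one>\<^bsub>A\<^esub> \<in> \<phi> ` carrier ?P" using H.hom_one by (metis P.one_closed imageI)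
    show "z \<oplus>\<^bsub>A\<^esub> w \<in> \<phi> ` carrier ?P" if "z \<in> \<phi> ` carrier ?P" "w \<in> \<phi> ` carrier ?P" for z w
      using that by (auto simp flip: H.hom_add)
    show "z \<otimes>\<^bsub>A\<^esub> w \<in> \<phi> ` carrier ?P" if "z \<in> \<phi> ` carrier ?P" "w \<in> \<phi> ` carrier ?P" for z w
      using that by (auto simp flip: H.hom_mult)
    show "c \<odot>\<^bsub>A\<^esub> z \<in> \<phi> ` carrier ?P" if "c \<in> carrier k" "z \<in> \<phi> ` carrier ?P" for c z
      using that by (auto simp flip: smult)
  qed auto
  ultimately have "\<phi> \<in> algebra_iso k ?P A"
    using hom smult by (auto simp: algebra_iso_def ring_iso_def bij_betw_def)
  then show ?thesis
    using gen by (intro bexI[of _ \<phi>]) (simp_all add: b_def SD_X_eq SD_Y_eq)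
qed

end

theorem theorem3p2p1:
  fixes k :: "('a, 'c) ring_scheme" and q :: nat
  assumes "field k" and "ring_characteristic k = 2"
    and "q \<ge> 2" and "\<exists>n::nat. q = 2 ^ n"
  shows "\<exists>\<phi> \<in> algebra_iso k (presented_algebra k (xy_relations k q)) (kSD k q).
           \<phi> (pa_gen k (xy_relations k q) Gen_X) = SD_X k q \<and>
           \<phi> (pa_gen k (xy_relations k q) Gen_Y) = SD_Y k q"
proof -
  interpret field k by fact
  obtain m where "q = 2 ^ m" using assms(4) by blast
  \<comment> \<open>\<open>q \<ge> 2\<close> rules out the exponent 0, so a factor 2 splits off and
    q/2 is again a power of two.\<close>
  moreover from this obtain n where "m = Suc n" using assms(3) by (cases m) auto
  ultimately have q: "q = 2 * 2 ^ n" by simp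
  interpret semidihedral_algebra k q "2 ^ n" n
    by unfold_locales (use q ring_characteristic_two[OF cring_axioms assms(2)] in simp_all)
  show ?thesis by (rule presentation)
qed

end
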